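(* Let $N\geq 3$. Then the following strict set inclusions hold between the sets of $N$-time memoryless ($\mathtt{M}$), mixed memoryless ($\mathtt{MM}$), classical memory ($\mathtt{CM}$), separable ($\mathtt{SEP}$) and general ($\mathtt{QM}$) quantum processes: $$\mathtt{M} \subsetneq \mathtt{MM} \subsetneq \mathtt{CM} \subsetneq \mathtt{SEP} \subsetneq \mathtt{QM}.$$
   Context: All Hilbert spaces are complex, nonzero and finite-dimensional; $\mathcal{L}(\mathcal{H})$ denotes the linear operators on $\mathcal{H}$; $\mathbb{1}_X$ is the identity operator on $\mathcal{H}_X$. Tensor factors are labelled, and operators are identified up to reordering of labelled factors. Choi operators. A linear map $\mathcal{K}:\mathcal{L}(\mathcal{H}_{a})\to\mathcal{L}(\mathcal{H}_{b})$ is represented by $\mathsf{K}=\sum_{ij}|i\rangle\langle j|\otimes\mathcal{K}(|i\rangle\langle j|)\in\mathcal{L}(\mathcal{H}_a\otimes\mathcal{H}_b)$ (computational basis). The map is a channel (CPTP) iff $\mathsf{K}\geq0$ and $\mathrm{tr}_b[\mathsf{K}]=\mathbb{1}_a$. The Choi operator of the trace map on $\mathcal{H}_a$ is $\mathbb{1}_a$. Link product. For $\mathsf{A}_{12}\in\mathcal{L}(\mathcal{H}_1\otimes\mathcal{H}_2)$ and $\mathsf{B}_{23}\in\mathcal{L}(\mathcal{H}_2\otimes\mathcal{H}_3)$, $\mathsf{A}_{12}\star\mathsf{B}_{23}:=\mathrm{tr}_2[(\mathsf{A}_{12}^{\mathrm{T}_2}\otimes\mathbb{1}_3)(\mathbb{1}_1\otimes\mathsf{B}_{23})]$,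 with $\mathrm{T}_2$ the partial transpose on $\mathcal{H}_2$ (contract over shared spaces, tensor product on the others). $\bigstar_j$ denotes an iterated link product. Spaces. At each time $t_j$, $j=1,\dots,N-1$, the system has two spaces $\mathcal{H}_{S_{j^{\mathtt{i}}}}$ and $\mathcal{H}_{S_{j^{\mathtt{o}}}}$; at $t_N$ it has only $\mathcal{H}_{S_{N^{\mathtt{i}}}}$. $N$-time processes are operators in $\mathcal{L}(\mathcal{H}_{S_{N^{\mathtt{i}}}}\otimes\bigotimes_{j=1}^{N-1}\mathcal{H}_{S_{j^{\mathtt{o}}}}\otimes\mathcal{H}_{S_{j^{\mathtt{i}}}})$. Below, $j^{\mathtt{i}}$, $j^{\mathtt{o}}$ without $S$ refer to the system spaces. The environment has arbitrary finite-dimensional spaces $\mathcal{H}_{E_{j^{\mathtt{i}}}}$, $\mathcal{H}_{E_{j^{\mathtt{o}}}}$ ($j\le N-1$) and $\mathcal{H}_{E_{N^{\mathtt{i}}}}$, not fixed in advance. Convention. For given $N$, each set below consists of all such operators, for all choices of finite-dimensional system spaces. Thus $A\subsetneq B$ means: $A\subseteq B$ for every choice of system spaces, and for some choice of system spaces there is an element of $B$ not in $A$. Consider operators of the form $$\mathbb{1}_{E_{N^{\mathtt{i}}}}\star\Big(\bigstar_{j=1}^{N-1}\mathsf{U}_{(ES)_{j+1^{\mathtt{i}}j^{\mathtt{o}}}}\star\mathsf{X}_{E_j}\Big)\star\rho_{(ES)_{1^{\mathtt{i}}}}\qquad(\ast)$$ with $\rho_{(ES)_{1^{\mathtt{i}}}}$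 a density operator on $\mathcal{H}_{E_{1^{\mathtt{i}}}}\otimes\mathcal{H}_{S_{1^{\mathtt{i}}}}$, each $\mathsf{U}_{(ES)_{j+1^{\mathtt{i}}j^{\mathtt{o}}}}$ the Choi operator of a unitary channel $\mathcal{L}(\mathcal{H}_{E_{j^{\mathtt{o}}}}\otimes\mathcal{H}_{S_{j^{\mathtt{o}}}})\to\mathcal{L}(\mathcal{H}_{E_{j+1^{\mathtt{i}}}}\otimes\mathcal{H}_{S_{j+1^{\mathtt{i}}}})$, and each $\mathsf{X}_{E_j}\in\mathcal{L}(\mathcal{H}_{E_{j^{\mathtt{o}}}}\otimes\mathcal{H}_{E_{j^{\mathtt{i}}}})$ the Choi operator of a channel from $E_{j^{\mathtt{i}}}$ to $E_{j^{\mathtt{o}}}$. - $\mathtt{QM}$ (quantum processes): operators of the form $(\ast)$ with each $\mathsf{X}_{E_j}$ the Choi operator of the identity map. By a standard fact, equivalently: operators $\mathsf{C}_{N:1}\geq0$ for which there are $\mathsf{C}_{k:1}\geq0$ ($1\le k\le N-1$) with $\mathrm{tr}_{k^{\mathtt{i}}}[\mathsf{C}_{k:1}]=\mathbb{1}_{k-1^{\mathtt{o}}}\otimes\mathsf{C}_{k-1:1}$ for $k=N,\dots,2$ and $\mathrm{tr}_{1^{\mathtt{i}}}[\mathsf{C}_{1:1}]=1$. - $\mathtt{M}$ (memoryless): operators of the form $(\ast)$ with each $\mathsf{X}_{E_j}=\sigma_{E_{j^{\mathtt{o}}}}\otimes\mathbb{1}_{E_{j^{\mathtt{i}}}}$ a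 trace-and-prepare channel, $\sigma_{E_{j^{\mathtt{o}}}}$ a density operator. - $\mathtt{CM}$ (classical memory): operators of the form $(\ast)$ with each $\mathsf{X}_{E_j}=\sum_x\sigma^{(x)}_{E_{j^{\mathtt{o}}}}\otimes\mathsf{M}^{(x)}_{E_{j^{\mathtt{i}}}}$ an entanglement-breaking channel (finite sum; $\sigma^{(x)}$ density operators, $\{\mathsf{M}^{(x)}\}_x$ a POVM). - $\mathtt{MM}$ (mixed memoryless): operators $\sum_xp_x\,\mathsf{L}^{(x)}_{N^{\mathtt{i}}:N-1^{\mathtt{o}}}\otimes\dots\otimes\mathsf{L}^{(x)}_{2^{\mathtt{i}}:1^{\mathtt{o}}}\otimes\rho^{(x)}_{1^{\mathtt{i}}}$ (finite sum), with $p_x$ a probability distribution, each $\rho^{(x)}_{1^{\mathtt{i}}}$ a density operator on $\mathcal{H}_{S_{1^{\mathtt{i}}}}$, and each $\mathsf{L}^{(x)}_{j+1^{\mathtt{i}}:j^{\mathtt{o}}}\in\mathcal{L}(\mathcal{H}_{S_{j+1^{\mathtt{i}}}}\otimes\mathcal{H}_{S_{j^{\mathtt{o}}}})$ the Choi operator of a CPTP channel from $j^{\mathtt{o}}$ to $j+1^{\mathtt{i}}$. - $\mathtt{SEP}$ (separable): elements of $\mathtt{QM}$ that can be written as $\sum_xp_x\,\mathsf{L}^{(x)}_{N^{\mathtt{i}}:N-1^{\mathtt{o}}}\otimes\dots\otimes\mathsf{L}^{(x)}_{2^{\mathtt{i}}:1^{\mathtt{o}}}\otimes\rho^{(x)}_{1^{\mathtt{i}}}$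 (finite sum) with $p_x$ a probability distribution, each $\rho^{(x)}_{1^{\mathtt{i}}}\geq0$ and each $\mathsf{L}^{(x)}_{j+1^{\mathtt{i}}:j^{\mathtt{o}}}\geq0$ (no trace conditions on the individual factors). *)

theory Defs
  imports Complex_Main "HOL-Library.FuncSet" "HOL-Library.Nonpos_Ints"
begin

section \<open>Operators on labelled tensor products\<close>

text \<open>
  The factor with label \<open>l\<close> is the space of complex \<open>d l\<close>-tuples with its computational basis.
  The computational basis of the tensor product of the factors in \<open>L\<close> is then indexed by
  \<open>idx d L\<close>. Since indices are functions of the labels, no order of the factors is involved.
\<close>

definition idx :: "('l \<Rightarrow> nat) \<Rightarrow> 'l set \<Rightarrow> ('l \<Rightarrow> nat) set" where
  "idx d L = (\<Pi>\<^sub>E l\<in>L. {..<d l})"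

datatype 'l op = Op (factors: "'l set") (entry: "('l \<Rightarrow> nat) \<Rightarrow> ('l \<Rightarrow> nat) \<Rightarrow> complex")

text \<open>Entries outside the index set are fixed to zero, so that equality in \<^typ>\<open>'l op\<close> is
  equality of operators.\<close>

definition opers :: "('l \<Rightarrow> nat) \<Rightarrow> 'l set \<Rightarrow> 'l op set" where
  "opers d L = {A. factors A = L \<and>
     (\<forall>r c. \<not> (r \<in> idx d L \<and> c \<in> idx d L) \<longrightarrow> entry A r c = 0)}"

definition mk_op ::
  "('l \<Rightarrow> nat) \<Rightarrow> 'l set \<Rightarrow> (('l \<Rightarrow> nat) \<Rightarrow> ('l \<Rightarrow> nat) \<Rightarrow> complex) \<Rightarrow> 'l op" where
  "mk_op d L f = Op L (\<lambda>r c. if r \<in> idx d L \<and> c \<in> idx d L then f r c else 0)"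

definition ident :: "('l \<Rightarrow> nat) \<Rightarrow> 'l set \<Rightarrow> 'l op" where
  "ident d L = mk_op d L (\<lambda>r c. if r = c then 1 else 0)"

definition mat_unit :: "('l \<Rightarrow> nat) \<Rightarrow> 'l set \<Rightarrow> ('l \<Rightarrow> nat) \<Rightarrow> ('l \<Rightarrow> nat) \<Rightarrow> 'l op" where
  "mat_unit d L i j = mk_op d L (\<lambda>r c. if r = i \<and> c = j then 1 else 0)"

definition scale_op :: "complex \<Rightarrow> 'l op \<Rightarrow> 'l op" where
  "scale_op a A = Op (factors A) (\<lambda>r c. a * entry A r c)"

definition sum_op :: "('l \<Rightarrow> nat) \<Rightarrow> 'l set \<Rightarrow> ('x \<Rightarrow> 'l op) \<Rightarrow> 'x set \<Rightarrow> 'l op" where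
  "sum_op d L f I = mk_op d L (\<lambda>r c. \<Sum>x\<in>I. entry (f x) r c)"

definition mult_op :: "('l \<Rightarrow> nat) \<Rightarrow> 'l op \<Rightarrow> 'l op \<Rightarrow> 'l op" where
  "mult_op d A B = mk_op d (factors A)
     (\<lambda>r c. \<Sum>k\<in>idx d (factors A). entry A r k * entry B k c)"

text \<open>Only meant for operators without common factors.\<close>

definition tensor :: "('l \<Rightarrow> nat) \<Rightarrow> 'l op \<Rightarrow> 'l op \<Rightarrow> 'l op" where
  "tensor d A B = mk_op d (factors A \<union> factors B)
     (\<lambda>r c. entry A (restrict r (factors A)) (restrict c (factors A))
          * entry B (restrict r (factors B)) (restrict c (factors B)))"

primrec big_tensor :: "('l \<Rightarrow> nat) \<Rightarrow> (nat \<Rightarrow> 'l op) \<Rightarrow> nat \<Rightarrow> 'l op" where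
  "big_tensor d f 0 = ident d {}"
| "big_tensor d f (Suc n) = tensor d (f (Suc n)) (big_tensor d f n)"

definition trace_op :: "('l \<Rightarrow> nat) \<Rightarrow> 'l op \<Rightarrow> complex" where
  "trace_op d A = (\<Sum>r\<in>idx d (factors A). entry A r r)"

definition ptrace :: "('l \<Rightarrow> nat) \<Rightarrow> 'l set \<Rightarrow> 'l op \<Rightarrow> 'l op" where
  "ptrace d K A = mk_op d (factors A - K)
     (\<lambda>r c. \<Sum>s\<in>idx d (factors A \<inter> K). entry A (override_on r s K) (override_on c s K))"

definition ptranspose :: "('l \<Rightarrow> nat) \<Rightarrow> 'l set \<Rightarrow> 'l op \<Rightarrow> 'l op" where
  "ptranspose d K A = mk_op d (factors A)
     (\<lambda>r c. entry A (override_on r c K) (override_on c r K))"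

definition link :: "('l \<Rightarrow> nat) \<Rightarrow> 'l op \<Rightarrow> 'l op \<Rightarrow> 'l op" where
  "link d A B =
     (let K = factors A \<inter> factors B in
      ptrace d K (mult_op d (tensor d (ptranspose d K A) (ident d (factors B - factors A)))
                            (tensor d (ident d (factors A - factors B)) B)))"

text \<open>\<open>big_link d f n\<close> is the link product of \<open>f 1, \<dots>, f n\<close>; it starts from the scalar \<open>1\<close>,
  the identity on the empty tensor product.\<close>

primrec big_link :: "('l \<Rightarrow> nat) \<Rightarrow> (nat \<Rightarrow> 'l op) \<Rightarrow> nat \<Rightarrow> 'l op" where
  "big_link d f 0 = ident d {}"
| "big_link d f (Suc n) = link d (f (Suc n)) (big_link d f n)"

definition psd :: "('l \<Rightarrow> nat) \<Rightarrow> 'l set \<Rightarrow> 'l op \<Rightarrow> bool" where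
  "psd d L A \<longleftrightarrow> A \<in> opers d L \<and>
     (\<forall>v. (\<Sum>r\<in>idx d L. \<Sum>c\<in>idx d L. cnj (v r) * entry A r c * v c) \<in> \<real>\<^sub>\<ge>\<^sub>0)"

definition density :: "('l \<Rightarrow> nat) \<Rightarrow> 'l set \<Rightarrow> 'l op \<Rightarrow> bool" where
  "density d L A \<longleftrightarrow> psd d L A \<and> trace_op d A = 1"

definition prob_dist :: "nat \<Rightarrow> (nat \<Rightarrow> real) \<Rightarrow> bool" where
  "prob_dist m p \<longleftrightarrow> (\<forall>x<m. 0 \<le> p x) \<and> (\<Sum>x<m. p x) = 1"

definition povm :: "('l \<Rightarrow> nat) \<Rightarrow> 'l set \<Rightarrow> nat \<Rightarrow> (nat \<Rightarrow> 'l op) \<Rightarrow> bool" where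
  "povm d L m F \<longleftrightarrow> (\<forall>x<m. psd d L (F x)) \<and> sum_op d L F {..<m} = ident d L"


section \<open>Choi operators and channels\<close>

text \<open>Below, \<open>A\<close> and \<open>B\<close> are the (disjoint) sets of input and output factors. The \<open>(r, c)\<close> entry
  of the sum of all \<open>|i><j| \<otimes> \<Phi> (|i><j|)\<close> only sees the summand in which \<open>i\<close>, \<open>j\<close> are the input
  parts of \<open>r\<close>, \<open>c\<close>.\<close>

definition choi :: "('l \<Rightarrow> nat) \<Rightarrow> 'l set \<Rightarrow> 'l set \<Rightarrow> ('l op \<Rightarrow> 'l op) \<Rightarrow> 'l op" where
  "choi d A B \<Phi> = mk_op d (A \<union> B)
     (\<lambda>r c. entry (\<Phi> (mat_unit d A (restrict r A) (restrict c A))) (restrict r B) (restrict c B))"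

definition channel_choi :: "('l \<Rightarrow> nat) \<Rightarrow> 'l set \<Rightarrow> 'l set \<Rightarrow> 'l op \<Rightarrow> bool" where
  "channel_choi d A B K \<longleftrightarrow> psd d (A \<union> B) K \<and> ptrace d B K = ident d A"

text \<open>\<open>V k i\<close> is the matrix element between \<open>k \<in> idx d B\<close> and \<open>i \<in> idx d A\<close>.\<close>

definition unitary ::
  "('l \<Rightarrow> nat) \<Rightarrow> 'l set \<Rightarrow> 'l set \<Rightarrow> (('l \<Rightarrow> nat) \<Rightarrow> ('l \<Rightarrow> nat) \<Rightarrow> complex) \<Rightarrow> bool" where
  "unitary d A B V \<longleftrightarrow>
     (\<forall>i\<in>idx d A. \<forall>j\<in>idx d A.
        (\<Sum>k\<in>idx d B. cnj (V k i) * V k j) = (if i = j then 1 else 0)) \<and>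
     (\<forall>k\<in>idx d B. \<forall>l\<in>idx d B.
        (\<Sum>i\<in>idx d A. V k i * cnj (V l i)) = (if k = l then 1 else 0))"

definition conj_map ::
  "('l \<Rightarrow> nat) \<Rightarrow> 'l set \<Rightarrow> 'l set \<Rightarrow> (('l \<Rightarrow> nat) \<Rightarrow> ('l \<Rightarrow> nat) \<Rightarrow> complex) \<Rightarrow> 'l op \<Rightarrow> 'l op" where
  "conj_map d A B V \<rho> = mk_op d B
     (\<lambda>k l. \<Sum>i\<in>idx d A. \<Sum>j\<in>idx d A. V k i * entry \<rho> i j * cnj (V l j))"

definition unitary_choi :: "('l \<Rightarrow> nat) \<Rightarrow> 'l set \<Rightarrow> 'l set \<Rightarrow> 'l op \<Rightarrow> bool" where
  "unitary_choi d A B U \<longleftrightarrow> (\<exists>V. unitary d A B V \<and> U = choi d A B (conj_map d A B V))"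

text \<open>The identity map between the factors \<open>a\<close> and \<open>b\<close> of equal dimension.\<close>

definition relabel :: "('l \<Rightarrow> nat) \<Rightarrow> 'l \<Rightarrow> 'l \<Rightarrow> 'l op \<Rightarrow> 'l op" where
  "relabel d a b A = mk_op d {b} (\<lambda>r c. entry A (\<lambda>l\<in>{a}. r b) (\<lambda>l\<in>{a}. c b))"


section \<open>Multi-time processes\<close>

datatype port = In nat | Out nat

datatype label = Sys port | Env port

abbreviation dims :: "(port \<Rightarrow> nat) \<Rightarrow> (port \<Rightarrow> nat) \<Rightarrow> label \<Rightarrow> nat" where
  "dims s e \<equiv> case_label s e"

text \<open>\<open>circuits N s P\<close>: the operators obtained by linking an initial state, unitaries and operators
  \<open>X j\<close> subject to \<open>P\<close> on the environment, for arbitrary environment dimensions \<open>e\<close>; \<open>s\<close> gives the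
  dimensions of the system spaces.\<close>

definition circuits ::
  "nat \<Rightarrow> (port \<Rightarrow> nat) \<Rightarrow> ((label \<Rightarrow> nat) \<Rightarrow> nat \<Rightarrow> label op \<Rightarrow> bool) \<Rightarrow> label op set" where
  "circuits N s P = {C. \<exists>e U X \<rho>. let d = dims s e in
     (\<forall>p. 0 < e p) \<and>
     density d {Env (In 1), Sys (In 1)} \<rho> \<and>
     (\<forall>j\<in>{1..<N}.
        unitary_choi d {Env (Out j), Sys (Out j)} {Env (In (j + 1)), Sys (In (j + 1))} (U j) \<and>
        P d j (X j)) \<and>
     C = link d (ident d {Env (In N)})
           (link d (big_link d (\<lambda>j. link d (U j) (X j)) (N - 1)) \<rho>)}"

definition identity_choi :: "(label \<Rightarrow> nat) \<Rightarrow> nat \<Rightarrow> label op \<Rightarrow> bool" where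
  "identity_choi d j X \<longleftrightarrow> d (Env (In j)) = d (Env (Out j)) \<and>
     X = choi d {Env (In j)} {Env (Out j)} (relabel d (Env (In j)) (Env (Out j)))"

definition trace_and_prepare :: "(label \<Rightarrow> nat) \<Rightarrow> nat \<Rightarrow> label op \<Rightarrow> bool" where
  "trace_and_prepare d j X \<longleftrightarrow>
     (\<exists>\<sigma>. density d {Env (Out j)} \<sigma> \<and> X = tensor d \<sigma> (ident d {Env (In j)}))"

definition entanglement_breaking :: "(label \<Rightarrow> nat) \<Rightarrow> nat \<Rightarrow> label op \<Rightarrow> bool" where
  "entanglement_breaking d j X \<longleftrightarrow>
     (\<exists>m \<sigma> F. (\<forall>x<m. density d {Env (Out j)} (\<sigma> x)) \<and> povm d {Env (In j)} m F \<and>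
        X = sum_op d {Env (Out j), Env (In j)} (\<lambda>x. tensor d (\<sigma> x) (F x)) {..<m})"

definition QM :: "nat \<Rightarrow> (port \<Rightarrow> nat) \<Rightarrow> label op set" where
  "QM N s = circuits N s identity_choi"

definition M :: "nat \<Rightarrow> (port \<Rightarrow> nat) \<Rightarrow> label op set" where
  "M N s = circuits N s trace_and_prepare"

definition CM :: "nat \<Rightarrow> (port \<Rightarrow> nat) \<Rightarrow> label op set" where
  "CM N s = circuits N s entanglement_breaking"

definition sys_labels :: "nat \<Rightarrow> label set" where
  "sys_labels N = (\<lambda>j. Sys (In j)) ` {1..N} \<union> (\<lambda>j. Sys (Out j)) ` {1..<N}"

definition product_mixture ::
  "(label \<Rightarrow> nat) \<Rightarrow> nat \<Rightarrow> nat \<Rightarrow> (nat \<Rightarrow> real) \<Rightarrow> (nat \<Rightarrow> nat \<Rightarrow> label op) \<Rightarrow> (nat \<Rightarrow> label op) \<Rightarrow> label op"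
where
  "product_mixture d N m p L \<rho> = sum_op d (sys_labels N)
     (\<lambda>x. scale_op (complex_of_real (p x)) (tensor d (big_tensor d (L x) (N - 1)) (\<rho> x))) {..<m}"

text \<open>The operators in \<open>MM\<close> and \<open>SEP\<close> have no environment factors, so the environment dimensions
  in \<^term>\<open>dims s (\<lambda>_. 1)\<close> play no role.\<close>

definition MM :: "nat \<Rightarrow> (port \<Rightarrow> nat) \<Rightarrow> label op set" where
  "MM N s = (let d = dims s (\<lambda>_. 1) in
     {C. \<exists>m p L \<rho>. prob_dist m p \<and>
        (\<forall>x<m. density d {Sys (In 1)} (\<rho> x) \<and>
           (\<forall>j\<in>{1..<N}. channel_choi d {Sys (Out j)} {Sys (In (j + 1))} (L x j))) \<and>
        C = product_mixture d N m p L \<rho>})"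

definition SEP :: "nat \<Rightarrow> (port \<Rightarrow> nat) \<Rightarrow> label op set" where
  "SEP N s = (let d = dims s (\<lambda>_. 1) in
     {C \<in> QM N s. \<exists>m p L \<rho>. prob_dist m p \<and>
        (\<forall>x<m. psd d {Sys (In 1)} (\<rho> x) \<and>
           (\<forall>j\<in>{1..<N}. psd d {Sys (Out j), Sys (In (j + 1))} (L x j))) \<and>
        C = product_mixture d N m p L \<rho>})"

text \<open>Strict inclusion of two classes of operators that depend on the dimensions of the (nonzero)
  system spaces: inclusion for all dimensions, which is strict for some.\<close>

definition strictly_included ::
  "((port \<Rightarrow> nat) \<Rightarrow> label op set) \<Rightarrow> ((port \<Rightarrow> nat) \<Rightarrow> label op set) \<Rightarrow> bool" where
  "strictly_included \<A> \<B> \<longleftrightarrow>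
     (\<forall>s. (\<forall>p. 0 < s p) \<longrightarrow> \<A> s \<subseteq> \<B> s) \<and>
     (\<exists>s. (\<forall>p. 0 < s p) \<and> (\<exists>C \<in> \<B> s. C \<notin> \<A> s))"

end

(*
Contracting the link products turns a circuit into an iteration of kernels, one for each time step,
acting on the environment indices. Each kernel is the Choi operator of a channel. Conversely, every
sequence of channels arises from a circuit in QM: Kraus decompositions give isometries whose Kraus
index stays in the environment, and these extend to unitaries once the environment dimensions are
large and satisfy dim E(j,o) dim S(j,o) = dim E(j+1,i) dim S(j+1,i). If the channels only see the
diagonal of the memory, the same construction with a measurement between the steps stays in CM.

Strictness is witnessed at the first three times, all other dimensions being 1. Processes in M are
products, and in MM the first output cannot influence the third input. SEP without CM contains a
separable two-party measurement in which the second party's system selects the basis in which the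
first party's qubit is measured; with classical memory the first qubit is measured too early, which
would make two incompatible measurements jointly measurable. The coherent transmission of a qubit
is entangled, hence in QM but not in SEP.
*)
theory Submission
  imports Defs
begin

section \<open>Positive semidefinite kernels and unitary extensions\<close>


text \<open>Positivity is used through Gram vectors: sums, entrywise products, reindexings and
  contractions of Gram kernels are Gram because their vectors can be written down, and the vectors
  of a Choi operator are Kraus operators. That every positive form has such vectors is Cholesky
  elimination by Schur complements. The dimension equation couples all times for an identity memory,
  since such a memory keeps its dimension between two unitaries. It is solved for all times at once
  by a large common factor times the outputs already absorbed and the inputs still to come. An
  entanglement-breaking memory may change the dimension, so there each step is balanced by itself.
  The incompatibility behind SEP against CM is elementary. A classical outcome \<open>x\<close>
  leaves an unnormalised operator on the first output. In the computational basis the final answer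
  is certain, so for each \<open>x\<close> a diagonal entry of this operator vanishes, and the
  off-diagonal entries with it. The second basis, however, requires a weighted sum of these
  off-diagonal entries to be 1/2.\<close>

definition kdelta :: "'a \<Rightarrow> 'a \<Rightarrow> complex" where
  "kdelta x y = (if x = y then 1 else 0)"

lemma cnj_kdelta [simp]: "cnj (kdelta x y) = kdelta x y"
  by (simp add: kdelta_def)

lemma kdelta_commute: "kdelta x y = kdelta y x"
  by (simp add: kdelta_def)

lemma sum_kdelta [simp]:
  assumes "finite A"
  shows "(\<Sum>x\<in>A. kdelta x a * f x) = (if a \<in> A then f a else 0)"
    "(\<Sum>x\<in>A. kdelta a x * f x) = (if a \<in> A then f a else 0)"
    "(\<Sum>x\<in>A. f x * kdelta x a) = (if a \<in> A then f a else 0)"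
    "(\<Sum>x\<in>A. f x * kdelta a x) = (if a \<in> A then f a else 0)"
proof -
  have "kdelta x a * f x = (if x = a then f x else 0)" "f x * kdelta x a = (if x = a then f x else 0)"
    "kdelta a x * f x = (if a = x then f x else 0)" "f x * kdelta a x = (if a = x then f x else 0)" for x
    by (auto simp: kdelta_def)
  then show "(\<Sum>x\<in>A. kdelta x a * f x) = (if a \<in> A then f a else 0)"
    "(\<Sum>x\<in>A. kdelta a x * f x) = (if a \<in> A then f a else 0)"
    "(\<Sum>x\<in>A. f x * kdelta x a) = (if a \<in> A then f a else 0)"
    "(\<Sum>x\<in>A. f x * kdelta a x) = (if a \<in> A then f a else 0)"
    using assms by simp_all
qed

section \<open>Gram representations of kernels\<close>

definition pos_form :: "'a set \<Rightarrow> ('a \<Rightarrow> 'a \<Rightarrow> complex) \<Rightarrow> bool" where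
  "pos_form I f \<longleftrightarrow> (\<forall>v. (\<Sum>r\<in>I. \<Sum>c\<in>I. cnj (v r) * f r c * v c) \<in> \<real>\<^sub>\<ge>\<^sub>0)"

text \<open>The vectors are numbered by \<open>nat\<close> because an index type cannot be
  quantified over; \<open>gramI\<close> accepts any finite index set. For Choi operators the
  \<open>W y\<close> become Kraus operators.\<close>

definition gram :: "'a set \<Rightarrow> ('a \<Rightarrow> 'a \<Rightarrow> complex) \<Rightarrow> bool" where
  "gram I f \<longleftrightarrow> (\<exists>(n::nat) W. \<forall>r\<in>I. \<forall>c\<in>I. f r c = (\<Sum>y<n. W y r * cnj (W y c)))"

lemma gramI:
  assumes "finite Y" "\<And>r c. r \<in> I \<Longrightarrow> c \<in> I \<Longrightarrow> f r c = (\<Sum>y\<in>Y. W y r * cnj (W y c))"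
  shows "gram I f"
proof -
  obtain h where h: "bij_betw h {..<card Y} Y"
    using ex_bij_betw_nat_finite[OF assms(1)] by (auto simp: atLeast0LessThan)
  have "f r c = (\<Sum>y<card Y. W (h y) r * cnj (W (h y) c))" if "r \<in> I" "c \<in> I" for r c
    using assms(2)[OF that] sum.reindex_bij_betw[OF h, of "\<lambda>y. W y r * cnj (W y c)"] by simp
  then show ?thesis unfolding gram_def
    by (intro exI[of _ "card Y"] exI[of _ "\<lambda>y. W (h y)"]) blast
qed

lemma gram_cong:
  "(\<And>r c. r \<in> I \<Longrightarrow> c \<in> I \<Longrightarrow> f r c = g r c) \<Longrightarrow> gram I f \<longleftrightarrow> gram I g"
  unfolding gram_def by auto

lemma gram_rank1: "gram I (\<lambda>r c. f r * cnj (f c))"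
  by (rule gramI[of "{()}" _ _ "\<lambda>_. f"]) auto

text \<open>The map \<open>g\<close> need not be injective: the vectors are read off at
  \<open>g r\<close>. Restricting, renaming, forgetting and freezing coordinates are all
  instances.\<close>

lemma gram_pull:
  assumes "gram J f" "g ` I \<subseteq> J"
  shows "gram I (\<lambda>r c. f (g r) (g c))"
proof -
  obtain n W where W: "\<And>r c. r \<in> J \<Longrightarrow> c \<in> J \<Longrightarrow> f r c = (\<Sum>y<(n::nat). W y r * cnj (W y c))"
    using assms(1) unfolding gram_def by blast
  have "g r \<in> J" if "r \<in> I" for r using assms(2) that by auto
  then show ?thesis
    by (intro gramI[of "{..<n}" _ _ "\<lambda>y r. W y (g r)"]) (use W in simp_all)
qed

lemma gram_sum:
  assumes "finite X" "\<And>x. x \<in> X \<Longrightarrow> gram I (f x)"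
  shows "gram I (\<lambda>r c. \<Sum>x\<in>X. f x r c)"
proof -
  have "\<forall>x\<in>X. \<exists>n W. \<forall>r\<in>I. \<forall>c\<in>I. f x r c = (\<Sum>y<(n::nat). W y r * cnj (W y c))"
    using assms(2) unfolding gram_def by blast
  then obtain n W where W: "\<And>x r c. x \<in> X \<Longrightarrow> r \<in> I \<Longrightarrow> c \<in> I \<Longrightarrow>
      f x r c = (\<Sum>y<(n x::nat). W x y r * cnj (W x y c))" by metis
  show ?thesis
    by (rule gramI[of "Sigma X (\<lambda>x. {..<n x})" _ _ "\<lambda>(x,y). W x y"])
       (use assms(1) W in \<open>auto simp: sum.Sigma split_def intro!: sum.cong\<close>)
qed

text \<open>Schur product theorem; in Gram form the new vectors are the pairwise products of the old
  ones.\<close>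

lemma gram_mult:
  assumes "gram I f" "gram I g"
  shows "gram I (\<lambda>r c. f r c * g r c)"
proof -
  obtain n W where W: "\<And>r c. r \<in> I \<Longrightarrow> c \<in> I \<Longrightarrow> f r c = (\<Sum>y<(n::nat). W y r * cnj (W y c))"
    using assms(1) unfolding gram_def by blast
  obtain m Z where Z: "\<And>r c. r \<in> I \<Longrightarrow> c \<in> I \<Longrightarrow> g r c = (\<Sum>y<(m::nat). Z y r * cnj (Z y c))"
    using assms(2) unfolding gram_def by blast
  show ?thesis
    by (rule gramI[of "{..<n} \<times> {..<m}" _ _ "\<lambda>(x,y) r. W x r * Z y r"])
       (auto simp: W Z sum_product sum.cartesian_product split_def mult_ac intro!: sum.cong)
qed

lemma gram_kdelta: "finite I \<Longrightarrow> gram I kdelta"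
  by (rule gramI[of I _ _ "\<lambda>y r. kdelta r y"]) (auto simp: cnj_kdelta kdelta_commute)

lemma gram_kdelta_pull: "finite I \<Longrightarrow> gram I (\<lambda>r c. kdelta (g r) (g c))"
  by (rule gram_pull[OF gram_kdelta[of "g ` I"]]) auto

text \<open>Each Gram vector is paired with the all-ones vector in the coordinate from
  \<open>A\<close>.\<close>

lemma gram_marginal:
  assumes "finite A" "gram (A \<times> I) f"
  shows "gram I (\<lambda>r c. \<Sum>a\<in>A. \<Sum>b\<in>A. f (a, r) (b, c))"
proof -
  obtain n W where W: "\<And>r c. r \<in> A \<times> I \<Longrightarrow> c \<in> A \<times> I \<Longrightarrow> f r c = (\<Sum>y<(n::nat). W y r * cnj (W y c))"
    using assms(2) unfolding gram_def by blast
  show ?thesis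
  proof (rule gramI[of "{..<n}" _ _ "\<lambda>y r. \<Sum>a\<in>A. W y (a, r)"])
    fix r c assume "r \<in> I" "c \<in> I"
    then have "(\<Sum>a\<in>A. \<Sum>b\<in>A. f (a, r) (b, c)) = (\<Sum>a\<in>A. \<Sum>b\<in>A. \<Sum>y<n. W y (a, r) * cnj (W y (b, c)))"
      by (intro sum.cong refl W) auto
    also have "\<dots> = (\<Sum>y<n. \<Sum>a\<in>A. \<Sum>b\<in>A. W y (a, r) * cnj (W y (b, c)))"
      by (subst sum.swap[of _ "{..<n}"]) (intro sum.cong refl sum.swap)
    finally show "(\<Sum>a\<in>A. \<Sum>b\<in>A. f (a, r) (b, c)) = (\<Sum>y<n. (\<Sum>a\<in>A. W y (a, r)) * cnj (\<Sum>a\<in>A. W y (a, c)))"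
      by (simp add: sum_product)
  qed auto
qed

text \<open>Positivity of a link product: entrywise multiplication by \<open>F\<close>, then the
  all-ones pairing. The partial transpose in the link product is the reason why \<open>F\<close> and
  \<open>f\<close> carry \<open>a\<close>, \<open>b\<close> in the same order.\<close>

lemma gram_contract:
  assumes "finite A" "gram A F" "gram (A \<times> I) f"
  shows "gram I (\<lambda>r c. \<Sum>a\<in>A. \<Sum>b\<in>A. F a b * f (a, r) (b, c))"
proof -
  have "gram (A \<times> I) (\<lambda>p q. F (fst p) (fst q) * f p q)"
    by (rule gram_mult[OF gram_pull[OF assms(2)] assms(3)]) auto
  from gram_marginal[OF assms(1) this] show ?thesis by simp
qed

lemma gram_trace:
  assumes "finite A" "gram (A \<times> I) f"
  shows "gram I (\<lambda>r c. \<Sum>a\<in>A. f (a, r) (a, c))"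
  by (rule gram_sum[OF assms(1)]) (rule gram_pull[OF assms(2)], auto)

lemma gram_cmult: "gram I f \<Longrightarrow> 0 \<le> a \<Longrightarrow> gram I (\<lambda>r c. complex_of_real a * f r c)"
proof -
  assume "gram I f" "0 \<le> a"
  moreover have "complex_of_real a = complex_of_real (sqrt a) * cnj (complex_of_real (sqrt a))"
    using \<open>0 \<le> a\<close> by (simp flip: of_real_mult)
  ultimately show ?thesis using gram_mult[OF gram_rank1[of I "\<lambda>_. complex_of_real (sqrt a)"]] by simp
qed

lemma gram_one: "gram I (\<lambda>_ _. 1)"
  using gram_rank1[of I "\<lambda>_. 1"] by simp

lemma gram_diag_nonneg:
  assumes "gram I f" "r \<in> I"
  shows "\<exists>x\<ge>0. f r r = complex_of_real x"
proof -
  obtain n W where W: "\<And>r c. r \<in> I \<Longrightarrow> c \<in> I \<Longrightarrow> f r c = (\<Sum>y<(n::nat). W y r * cnj (W y c))"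
    using assms(1) unfolding gram_def by blast
  show ?thesis
    by (rule exI[of _ "\<Sum>y<n. (cmod (W y r))\<^sup>2"])
       (auto simp: W assms(2) sum_nonneg complex_norm_square simp del: of_real_power intro!: sum.cong)
qed

text \<open>\<open>f r r\<close> is the sum of the squared moduli of all \<open>W y r\<close>, so
  its vanishing kills each of them. The strictness proofs use this to turn vanishing probabilities
  into vanishing coherences.\<close>

lemma gram_zero_row:
  assumes "gram I f" "r \<in> I" "c \<in> I" "f r r = 0"
  shows "f r c = 0" "f c r = 0"
proof -
  obtain n W where W: "\<And>r c. r \<in> I \<Longrightarrow> c \<in> I \<Longrightarrow> f r c = (\<Sum>y<(n::nat). W y r * cnj (W y c))"
    using assms(1) unfolding gram_def by blast
  have "complex_of_real (\<Sum>y<n. (cmod (W y r))\<^sup>2) = 0"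
    using assms(4) W[OF assms(2,2)] by (simp add: complex_norm_square del: of_real_power)
  then have "(\<Sum>y<n. (cmod (W y r))\<^sup>2) = 0" by (simp only: of_real_eq_0_iff)
  then have "\<forall>y<n. W y r = 0" by (subst (asm) sum_nonneg_eq_0_iff) auto
  then show "f r c = 0" "f c r = 0" using W assms by auto
qed

lemma gram_pos_form:
  assumes "finite I" "gram I f" shows "pos_form I f"
  unfolding pos_form_def
proof
  fix v :: "_ \<Rightarrow> complex"
  obtain n W where W: "\<And>r c. r \<in> I \<Longrightarrow> c \<in> I \<Longrightarrow> f r c = (\<Sum>y<(n::nat). W y r * cnj (W y c))"
    using assms(2) unfolding gram_def by blast
  have "(\<Sum>r\<in>I. \<Sum>c\<in>I. cnj (v r) * f r c * v c)
      = (\<Sum>r\<in>I. \<Sum>c\<in>I. \<Sum>y<n. (cnj (v r) * W y r) * cnj (cnj (v c) * W y c))"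
    by (intro sum.cong refl) (simp add: W sum_distrib_left sum_distrib_right mult_ac)
  also have "\<dots> = (\<Sum>y<n. \<Sum>r\<in>I. \<Sum>c\<in>I. (cnj (v r) * W y r) * cnj (cnj (v c) * W y c))"
    by (subst sum.swap[of _ "{..<n}"]) (intro sum.cong refl sum.swap)
  also have "\<dots> = (\<Sum>y<n. complex_of_real ((cmod (\<Sum>r\<in>I. cnj (v r) * W y r))\<^sup>2))"
    by (intro sum.cong refl) (simp only: complex_norm_square cnj_sum sum_product)
  also have "\<dots> = complex_of_real (\<Sum>y<n. (cmod (\<Sum>r\<in>I. cnj (v r) * W y r))\<^sup>2)" by simp
  finally show "(\<Sum>r\<in>I. \<Sum>c\<in>I. cnj (v r) * f r c * v c) \<in> \<real>\<^sub>\<ge>\<^sub>0"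
    by (simp only: nonneg_Reals_of_real_iff sum_nonneg zero_le_power2)
qed

section \<open>Cholesky decomposition of positive forms\<close>

lemma pos_form_subset:
  assumes "pos_form I f" "finite I" "J \<subseteq> I" shows "pos_form J f"
  unfolding pos_form_def
proof
  fix v :: "_ \<Rightarrow> complex"
  let ?v = "\<lambda>r. if r \<in> J then v r else 0"
  have "(\<Sum>r\<in>J. \<Sum>c\<in>J. cnj (v r) * f r c * v c) = (\<Sum>r\<in>J. \<Sum>c\<in>J. cnj (?v r) * f r c * ?v c)"
    by (intro sum.cong refl) auto
  also have "\<dots> = (\<Sum>r\<in>J. \<Sum>c\<in>I. cnj (?v r) * f r c * ?v c)"
    by (intro sum.cong refl sum.mono_neutral_left assms) auto
  also have "\<dots> = (\<Sum>r\<in>I. \<Sum>c\<in>I. cnj (?v r) * f r c * ?v c)"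
    by (intro sum.mono_neutral_left assms) auto
  finally show "(\<Sum>r\<in>J. \<Sum>c\<in>J. cnj (v r) * f r c * v c) \<in> \<real>\<^sub>\<ge>\<^sub>0"
    using assms(1) unfolding pos_form_def by simp
qed

lemma pos_form_two:
  assumes "pos_form I f" "finite I" "r \<in> I" "c \<in> I" "r \<noteq> c"
  shows "cnj a * f r r * a + cnj a * f r c * b + cnj b * f c r * a + cnj b * f c c * b \<in> \<real>\<^sub>\<ge>\<^sub>0"
proof -
  have "pos_form {r, c} f" using pos_form_subset[OF assms(1,2)] assms by auto
  from this[unfolded pos_form_def, rule_format, of "\<lambda>x. if x = r then a else b"]
  show ?thesis using assms(5) by (simp add: add_ac)
qed

lemma pos_form_diag:
  assumes "pos_form I f" "finite I" "r \<in> I"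
  shows "\<exists>x\<ge>0. f r r = complex_of_real x"
proof -
  have "pos_form {r} f" using pos_form_subset[OF assms(1,2)] assms by auto
  then have "f r r \<in> \<real>\<^sub>\<ge>\<^sub>0" unfolding pos_form_def by (auto dest: spec[of _ "\<lambda>_. 1"])
  then show ?thesis by (auto elim: nonneg_Reals_cases)
qed

lemma pos_form_hermitian:
  assumes "pos_form I f" "finite I" "r \<in> I" "c \<in> I"
  shows "f c r = cnj (f r c)"
proof (cases "r = c")
  case True
  then show ?thesis using pos_form_diag[OF assms(1-3)] by auto
next
  case False
  obtain x y where xy: "f r r = complex_of_real x" "f c c = complex_of_real y"
    using pos_form_diag[OF assms(1-3)] pos_form_diag[OF assms(1,2,4)] by auto
  \<comment> \<open>The test vectors with entries 1, 1 and 1, i at \<open>r\<close>,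
    \<open>c\<close> control the imaginary and the real part of
    \<open>f c r - cnj (f r c)\<close>.\<close>
  have "Im (f r c + f c r) = 0" "Im (\<i> * f r c - \<i> * f c r) = 0"
    using pos_form_two[OF assms False, of 1 1] pos_form_two[OF assms False, of 1 \<i>]
    by (auto simp: xy complex_nonneg_Reals_iff)
  then show ?thesis by (simp add: complex_eq_iff)
qed

text \<open>With \<open>- s * f r c\<close> at \<open>r\<close> and 1 at \<open>c\<close> the form
  equals \<open>f c c\<close> minus \<open>2 * s\<close> times the squared modulus of
  \<open>f r c\<close>. This is affine in \<open>s\<close>, so it stays nonnegative for large
  \<open>s\<close> only if \<open>f r c = 0\<close>.\<close>

lemma pos_form_zero_row:
  assumes "pos_form I f" "finite I" "r \<in> I" "c \<in> I" "f r r = 0"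
  shows "f r c = 0"
proof (cases "r = c")
  case False
  obtain y where y: "f c c = complex_of_real y" "y \<ge> 0"
    using pos_form_diag[OF assms(1,2,4)] by auto
  define t where "t = y + 1"
  have h: "f c r = cnj (f r c)" using pos_form_hermitian[OF assms(1-4)] .
  have "cnj (complex_of_real t * - f r c) * f r c * 1 + cnj 1 * f c r * (complex_of_real t * - f r c) + cnj 1 * f c c * 1 \<in> \<real>\<^sub>\<ge>\<^sub>0"
    using pos_form_two[OF assms(1-4) False, of "complex_of_real t * - f r c" 1] assms(5) by simp
  moreover have "cnj (complex_of_real t * - f r c) * f r c * 1 + cnj 1 * f c r * (complex_of_real t * - f r c) + cnj 1 * f c c * 1
     = complex_of_real (y - 2 * t * (cmod (f r c))\<^sup>2)"
    by (simp add: h y complex_norm_square algebra_simps del: of_real_power)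
  ultimately have le: "2 * t * (cmod (f r c))\<^sup>2 \<le> y" by (simp only: nonneg_Reals_of_real_iff)
  have scale: "(cmod (f r c))\<^sup>2 * s * 2 \<le> y" if "s \<ge> 0" for s :: real
  proof -
    have "cnj (complex_of_real s * - f r c) * f r c * 1 + cnj 1 * f c r * (complex_of_real s * - f r c) + cnj 1 * f c c * 1 \<in> \<real>\<^sub>\<ge>\<^sub>0"
      using pos_form_two[OF assms(1-4) False, of "complex_of_real s * - f r c" 1] assms(5) by simp
    moreover have "cnj (complex_of_real s * - f r c) * f r c * 1 + cnj 1 * f c r * (complex_of_real s * - f r c) + cnj 1 * f c c * 1
       = complex_of_real (y - 2 * s * (cmod (f r c))\<^sup>2)"
      by (simp add: h y complex_norm_square algebra_simps del: of_real_power)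
    ultimately show ?thesis by (simp only: nonneg_Reals_of_real_iff) (simp add: mult_ac)
  qed
  show ?thesis
  proof (rule ccontr)
    assume "f r c \<noteq> 0"
    then have "(cmod (f r c))\<^sup>2 * ((y + 1) / (cmod (f r c))\<^sup>2) * 2 = 2 * (y + 1)" by simp
    then show False using scale[of "(y + 1) / (cmod (f r c))\<^sup>2"] y(2) by simp
  qed
qed (use assms in auto)

text \<open>Completing the square: \<open>w\<close> is the entry at \<open>i\<close> that minimises
  the form for given \<open>v\<close> on \<open>J\<close>, and the minimum is the Schur complement
  evaluated at \<open>v\<close>.\<close>

lemma pos_form_schur:
  assumes "pos_form (insert i J) f" "finite J" "i \<notin> J" "f i i \<noteq> 0"
  shows "pos_form J (\<lambda>r c. f r c - f r i * f i c / f i i)"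
  unfolding pos_form_def
proof
  fix v :: "_ \<Rightarrow> complex"
  define w where "w = - (\<Sum>c\<in>J. f i c * v c) / f i i"
  define u where "u = (\<Sum>c\<in>J. f i c * v c)"
  have fin: "finite (insert i J)" using assms by simp
  have herm: "f r i = cnj (f i r)" if "r \<in> J" for r
    using pos_form_hermitian[OF assms(1) fin, of i r] that by auto
  have fii: "cnj (f i i) = f i i" using pos_form_diag[OF assms(1) fin, of i] by auto
  have u': "(\<Sum>r\<in>J. cnj (v r) * f r i) = cnj u"
    unfolding u_def by (auto simp: herm mult_ac intro!: sum.cong)
  let ?v = "v(i := w)"
  have "(\<Sum>r\<in>insert i J. \<Sum>c\<in>insert i J. cnj (?v r) * f r c * ?v c)
     = cnj w * f i i * w + (\<Sum>c\<in>J. cnj w * f i c * v c) + (\<Sum>r\<in>J. cnj (v r) * f r i * w)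
       + (\<Sum>r\<in>J. \<Sum>c\<in>J. cnj (v r) * f r c * v c)"
  proof -
    have "(\<Sum>c\<in>insert i J. cnj (?v r) * f r c * ?v c) = cnj (v r) * f r i * w + (\<Sum>c\<in>J. cnj (v r) * f r c * v c)" if "r \<in> J" for r
    proof -
      have "(\<Sum>c\<in>J. cnj (?v r) * f r c * ?v c) = (\<Sum>c\<in>J. cnj (v r) * f r c * v c)"
        by (intro sum.cong refl) (use assms that in auto)
      then show ?thesis using assms that by (subst sum.insert) auto
    qed
    moreover have "(\<Sum>c\<in>insert i J. cnj (?v i) * f i c * ?v c) = cnj w * f i i * w + (\<Sum>c\<in>J. cnj w * f i c * v c)"
    proof -
      have "(\<Sum>c\<in>J. cnj (?v i) * f i c * ?v c) = (\<Sum>c\<in>J. cnj w * f i c * v c)"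
        by (intro sum.cong refl) (use assms in auto)
      then show ?thesis using assms by (subst sum.insert) auto
    qed
    ultimately show ?thesis using assms(2,3) by (subst sum.insert) (simp_all add: sum.distrib)
  qed
  also have "\<dots> = cnj w * f i i * w + cnj w * u + cnj u * w + (\<Sum>r\<in>J. \<Sum>c\<in>J. cnj (v r) * f r c * v c)"
    unfolding u'[symmetric] by (simp add: u_def sum_distrib_left sum_distrib_right mult_ac)
  also have "\<dots> = (\<Sum>r\<in>J. \<Sum>c\<in>J. cnj (v r) * f r c * v c) - cnj u * u / f i i"
    using assms(4) fii by (simp add: w_def flip: u_def)
  also have "cnj u * u / f i i = (\<Sum>r\<in>J. \<Sum>c\<in>J. cnj (v r) * (f r i * f i c / f i i) * v c)"
    unfolding u'[symmetric] by (simp add: u_def sum_product sum_divide_distrib mult_ac) (rule sum.swap)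
  also have "(\<Sum>r\<in>J. \<Sum>c\<in>J. cnj (v r) * f r c * v c) - (\<Sum>r\<in>J. \<Sum>c\<in>J. cnj (v r) * (f r i * f i c / f i i) * v c)
     = (\<Sum>r\<in>J. \<Sum>c\<in>J. cnj (v r) * (f r c - f r i * f i c / f i i) * v c)"
    unfolding sum_subtractf[symmetric] by (intro sum.cong refl) (simp add: algebra_simps)
  finally have "(\<Sum>r\<in>insert i J. \<Sum>c\<in>insert i J. cnj (?v r) * f r c * ?v c)
     = (\<Sum>r\<in>J. \<Sum>c\<in>J. cnj (v r) * (f r c - f r i * f i c / f i i) * v c)" .
  then show "(\<Sum>r\<in>J. \<Sum>c\<in>J. cnj (v r) * (f r c - f r i * f i c / f i i) * v c) \<in> \<real>\<^sub>\<ge>\<^sub>0"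
    using assms(1)[unfolded pos_form_def, rule_format, of ?v] by (simp only:)
qed

text \<open>Elimination of one index at a time. For a zero pivot the row and column vanish and the
  vectors for \<open>J\<close> are extended by zero; otherwise the rank-one kernel of column
  \<open>i\<close> is split off and the Schur complement is left on \<open>J\<close>.\<close>

lemma pos_form_gram:
  assumes "finite I" "pos_form I f" shows "gram I f"
  using assms
proof (induction I arbitrary: f rule: finite_induct)
  case empty
  show ?case by (rule gramI[of "{}"]) auto
next
  case (insert i J)
  have fin: "finite (insert i J)" using insert by simp
  note herm = pos_form_hermitian[OF insert.prems fin]
  show ?case
  proof (cases "f i i = 0")
    case True
    have z: "f i c = 0" "f c i = 0" if "c \<in> insert i J" for c
      using pos_form_zero_row[OF insert.prems fin _ that True] herm[OF _ that] by auto
    have "gram J f"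
      by (rule insert.IH) (rule pos_form_subset[OF insert.prems fin], auto)
    then obtain n W where W: "\<And>r c. r \<in> J \<Longrightarrow> c \<in> J \<Longrightarrow> f r c = (\<Sum>y<(n::nat). W y r * cnj (W y c))"
      unfolding gram_def by blast
    show ?thesis
    proof (rule gramI[of "{..<n}" _ _ "\<lambda>y r. if r = i then 0 else W y r"])
      fix r c assume rc: "r \<in> insert i J" "c \<in> insert i J"
      show "f r c = (\<Sum>y<n. (if r = i then 0 else W y r) * cnj (if c = i then 0 else W y c))"
        using rc z W[of r c] by (cases "r = i \<or> c = i") auto
    qed auto
  next
    case False
    obtain x where x: "f i i = complex_of_real x" "x > 0"
      using pos_form_diag[OF insert.prems fin, of i] False by (auto simp: less_le)
    have "gram J (\<lambda>r c. f r c - f r i * f i c / f i i)"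
      by (rule insert.IH, rule pos_form_schur[OF insert.prems insert.hyps False])
    then obtain n W where W: "\<And>r c. r \<in> J \<Longrightarrow> c \<in> J \<Longrightarrow> f r c - f r i * f i c / f i i = (\<Sum>y<(n::nat). W y r * cnj (W y c))"
      unfolding gram_def by blast
    \<comment> \<open>\<open>None\<close> indexes the new vector, column \<open>i\<close> divided by
      the square root of the pivot; the old vectors are 0 at \<open>i\<close>.\<close>
    define Z where "Z = (\<lambda>y r. case y of None \<Rightarrow> f r i / complex_of_real (sqrt x)
              | Some y \<Rightarrow> if r = i then 0 else W y r)"
    show ?thesis
    proof (rule gramI[of "insert None (Some ` {..<n})" _ _ Z])
      fix r c assume rc: "r \<in> insert i J" "c \<in> insert i J"
      have "f c i = cnj (f i c)" using herm[OF _ rc(2), of i] by simp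
      then have 1: "Z None r * cnj (Z None c) = f r i * f i c / f i i"
        using x unfolding Z_def by (simp flip: of_real_mult)
      have "(\<Sum>y\<in>insert None (Some ` {..<n}). Z y r * cnj (Z y c)) = Z None r * cnj (Z None c) + (\<Sum>y<n. Z (Some y) r * cnj (Z (Some y) c))"
        by (subst sum.insert) (auto simp: sum.reindex)
      also have "\<dots> = f r c"
      proof (cases "r = i \<or> c = i")
        case True
        then show ?thesis unfolding 1 using False by (auto simp: Z_def)
      next
        case ri: False
        then have "(\<Sum>y<n. Z (Some y) r * cnj (Z (Some y) c)) = f r c - f r i * f i c / f i i"
          using rc W[of r c] by (simp add: Z_def)
        then show ?thesis unfolding 1 by simp
      qed
      finally show "f r c = (\<Sum>y\<in>insert None (Some ` {..<n}). Z y r * cnj (Z y c))" by simp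
    qed auto
  qed
qed

lemma pos_form_iff_gram: "finite I \<Longrightarrow> pos_form I f \<longleftrightarrow> gram I f"
  using gram_pos_form pos_form_gram by blast

section \<open>Isometries and their extension to unitaries\<close>

definition orthonormal_cols :: "'a set \<Rightarrow> 'b set \<Rightarrow> ('b \<Rightarrow> 'a \<Rightarrow> complex) \<Rightarrow> bool" where
  "orthonormal_cols A B V \<longleftrightarrow>
     (\<forall>i\<in>A. \<forall>j\<in>A. (\<Sum>k\<in>B. cnj (V k i) * V k j) = kdelta i j)"

definition unitary_on :: "'a set \<Rightarrow> 'b set \<Rightarrow> ('b \<Rightarrow> 'a \<Rightarrow> complex) \<Rightarrow> bool" where
  "unitary_on A B V \<longleftrightarrow> orthonormal_cols A B V \<and>
     (\<forall>k\<in>B. \<forall>l\<in>B. (\<Sum>i\<in>A. V k i * cnj (V l i)) = kdelta k l)"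

text \<open>The squared Hilbert--Schmidt distance between the projection onto the columns and the identity
  is the difference of the two cardinalities.\<close>

lemma projection_defect:
  assumes "finite A" "finite B" "orthonormal_cols A B V"
  defines "P \<equiv> \<lambda>k l. \<Sum>i\<in>A. V k i * cnj (V l i)"
  shows "(\<Sum>k\<in>B. \<Sum>l\<in>B. (cmod (kdelta k l - P k l))\<^sup>2) = real (card B) - real (card A)"
proof -
  have orth: "(\<Sum>k\<in>B. cnj (V k i) * V k j) = kdelta i j" if "i \<in> A" "j \<in> A" for i j
    using assms(3) that unfolding orthonormal_cols_def by blast
  have tr: "(\<Sum>k\<in>B. P k k) = of_nat (card A)"
    unfolding P_def
    by (subst sum.swap, subst sum.cong[OF refl, of A _ "\<lambda>_. 1"])
       (use orth in \<open>auto simp: mult_ac kdelta_def\<close>)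
  have herm: "cnj (P k l) = P l k" for k l unfolding P_def by (simp add: mult_ac)
  have idem: "(\<Sum>l\<in>B. P k l * P l m) = P k m" for k m
  proof -
    have "(\<Sum>l\<in>B. P k l * P l m) = (\<Sum>l\<in>B. \<Sum>i\<in>A. \<Sum>j\<in>A. V k i * cnj (V m j) * (cnj (V l i) * V l j))"
      unfolding P_def sum_product by (simp add: mult_ac)
    also have "\<dots> = (\<Sum>i\<in>A. \<Sum>j\<in>A. V k i * cnj (V m j) * (\<Sum>l\<in>B. cnj (V l i) * V l j))"
      by (subst sum.swap[of _ _ B], rule sum.cong[OF refl], subst sum.swap[of _ _ B]) (simp add: sum_distrib_left)
    also have "\<dots> = (\<Sum>i\<in>A. \<Sum>j\<in>A. V k i * cnj (V m j) * kdelta i j)"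
      by (intro sum.cong refl) (simp add: orth)
    also have "\<dots> = P k m" unfolding P_def by (intro sum.cong refl) (simp add: assms)
    finally show ?thesis .
  qed
  have "complex_of_real (\<Sum>k\<in>B. \<Sum>l\<in>B. (cmod (kdelta k l - P k l))\<^sup>2)
     = (\<Sum>k\<in>B. \<Sum>l\<in>B. (kdelta k l - P k l) * (kdelta l k - P l k))"
    by (simp add: complex_norm_square herm kdelta_def del: of_real_power) (intro sum.cong refl, auto)
  also have "\<dots> = (\<Sum>k\<in>B. \<Sum>l\<in>B. kdelta k l * kdelta l k) - (\<Sum>k\<in>B. \<Sum>l\<in>B. kdelta k l * P l k) - (\<Sum>k\<in>B. \<Sum>l\<in>B. P k l * kdelta l k)
      + (\<Sum>k\<in>B. \<Sum>l\<in>B. P k l * P l k)"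
    by (simp add: algebra_simps sum.distrib sum_subtractf)
  also have "\<dots> = of_nat (card B) - of_nat (card A)"
    by (simp add: assms(2) tr idem) (simp add: kdelta_def)
  finally have "complex_of_real (\<Sum>k\<in>B. \<Sum>l\<in>B. (cmod (kdelta k l - P k l))\<^sup>2) = complex_of_real (real (card B) - real (card A))"
    by simp
  then show ?thesis by (simp only: of_real_eq_iff)
qed

text \<open>For equal cardinalities the defect is 0, so the projection onto the columns is the
  identity.\<close>

lemma orthonormal_square_unitary:
  assumes "finite A" "finite B" "orthonormal_cols A B V" "card A = card B"
  shows "unitary_on A B V"
proof -
  have "(\<Sum>k\<in>B. \<Sum>l\<in>B. (cmod (kdelta k l - (\<Sum>i\<in>A. V k i * cnj (V l i))))\<^sup>2) = 0"
    using projection_defect[OF assms(1-3)] assms(4) by simp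
  then have "\<forall>k\<in>B. \<forall>l\<in>B. kdelta k l - (\<Sum>i\<in>A. V k i * cnj (V l i)) = 0"
    using assms(2) by (subst (asm) sum_nonneg_eq_0_iff) (auto simp: sum_nonneg sum_nonneg_eq_0_iff)
  then show ?thesis using assms(3) unfolding unitary_on_def by auto
qed

text \<open>One Gram-Schmidt step. A positive defect provides a basis vector \<open>b\<close> with a
  nonzero component \<open>w\<close> orthogonal to all columns; normalised by \<open>t\<close>, it
  is the new column.\<close>

lemma orthonormal_cols_insert:
  assumes "finite A" "finite B" "orthonormal_cols A B V" "card A < card B" "a \<notin> A"
  shows "\<exists>V'. orthonormal_cols (insert a A) B V' \<and> (\<forall>i\<in>A. \<forall>k. V' k i = V k i)"
proof -
  define P where "P = (\<lambda>k l. \<Sum>i\<in>A. V k i * cnj (V l i))"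
  have orth: "(\<Sum>k\<in>B. cnj (V k i) * V k j) = kdelta i j" if "i \<in> A" "j \<in> A" for i j
    using assms(3) that unfolding orthonormal_cols_def by blast
  have "\<exists>k\<in>B. \<exists>l\<in>B. kdelta k l - P k l \<noteq> 0"
  proof (rule ccontr)
    assume "\<not> ?thesis"
    then have "(\<Sum>k\<in>B. \<Sum>l\<in>B. (cmod (kdelta k l - P k l))\<^sup>2) = 0" by simp
    then show False using projection_defect[OF assms(1-3)] assms(4) by (simp add: P_def)
  qed
  then obtain k0 b where kb: "k0 \<in> B" "b \<in> B" "kdelta k0 b - P k0 b \<noteq> 0" by blast
  define w where "w = (\<lambda>k. kdelta k b - P k b)"
  define t where "t = sqrt (\<Sum>k\<in>B. (cmod (w k))\<^sup>2)"
  have "(\<Sum>k\<in>B. (cmod (w k))\<^sup>2) \<ge> (cmod (w k0))\<^sup>2"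
    by (rule member_le_sum) (use kb assms in auto)
  then have "(\<Sum>k\<in>B. (cmod (w k))\<^sup>2) > 0" using kb unfolding w_def by (smt (verit) zero_less_norm_iff zero_less_power)
  then have t: "t > 0" "t * t = (\<Sum>k\<in>B. (cmod (w k))\<^sup>2)" unfolding t_def by auto
  have ow: "(\<Sum>k\<in>B. cnj (V k i) * w k) = 0" if "i \<in> A" for i
  proof -
    have "(\<Sum>k\<in>B. cnj (V k i) * P k b) = (\<Sum>k\<in>B. \<Sum>j\<in>A. cnj (V b j) * (cnj (V k i) * V k j))"
      unfolding P_def sum_distrib_left by (simp add: mult_ac)
    also have "\<dots> = (\<Sum>j\<in>A. cnj (V b j) * kdelta i j)"
      by (subst sum.swap) (simp add: orth that flip: sum_distrib_left)
    finally show ?thesis using assms that kb unfolding w_def by (simp add: algebra_simps sum_subtractf)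
  qed
  have ow': "(\<Sum>k\<in>B. cnj (w k) * V k i) = 0" if "i \<in> A" for i
    using arg_cong[OF ow[OF that], of cnj] by (simp add: mult_ac)
  have ww: "(\<Sum>k\<in>B. cnj (w k) * w k) = of_real (t * t)"
    by (simp only: t(2) of_real_sum complex_norm_square mult.commute)
  let ?V = "\<lambda>k i. if i = a then w k / of_real t else V k i"
  have tt: "of_real (t * t) / (of_real t * of_real t) = (1::complex)" using t(1) by simp
  have "(\<Sum>k\<in>B. cnj (?V k i) * ?V k j) = kdelta i j" if "i \<in> insert a A" "j \<in> insert a A" for i j
  proof (cases "i = a"; cases "j = a")
    assume "i = a" "j = a"
    then show ?thesis using tt by (simp add: kdelta_def ww flip: sum_divide_distrib)
  next
    assume "i = a" "j \<noteq> a"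
    then show ?thesis using that ow'[of j] by (simp add: kdelta_def flip: sum_divide_distrib)
  next
    assume "i \<noteq> a" "j = a"
    then show ?thesis using that ow[of i] by (simp add: kdelta_def flip: sum_divide_distrib)
  next
    assume "i \<noteq> a" "j \<noteq> a"
    then show ?thesis using that orth[of i j] by simp
  qed
  then have "orthonormal_cols (insert a A) B ?V" unfolding orthonormal_cols_def by blast
  then show ?thesis using assms(5) by (intro exI[of _ ?V]) auto
qed

text \<open>\<open>A0\<close> will be the part of the environment that a dilation really uses; the
  missing columns are added one by one until the matrix is square.\<close>

lemma unitary_extension:
  assumes "finite A" "finite B" "card A = card B" "A0 \<subseteq> A" "orthonormal_cols A0 B T"
  shows "\<exists>V. unitary_on A B V \<and> (\<forall>i\<in>A0. \<forall>k. V k i = T k i)"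
proof -
  have "\<exists>V. orthonormal_cols (A0 \<union> C) B V \<and> (\<forall>i\<in>A0. \<forall>k. V k i = T k i)" if "C \<subseteq> A - A0" "finite C" for C
    using that(2,1)
  proof (induction C rule: finite_induct)
    case empty
    then show ?case using assms by auto
  next
    case (insert a C)
    then obtain V where V: "orthonormal_cols (A0 \<union> C) B V" "\<forall>i\<in>A0. \<forall>k. V k i = T k i" by auto
    have fin: "finite (A0 \<union> C)" using assms insert by (auto dest: finite_subset)
    have "A0 \<union> C \<subset> A" and a: "a \<notin> A0 \<union> C" using insert assms by auto
    then have "card (A0 \<union> C) < card B" using psubset_card_mono[OF assms(1)] assms(3) by simp
    then obtain V' where "orthonormal_cols (insert a (A0 \<union> C)) B V'" "\<forall>i\<in>A0 \<union> C. \<forall>k. V' k i = V k i"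
      using orthonormal_cols_insert[OF fin assms(2) V(1)] a by blast
    then show ?case using V by (intro exI[of _ V']) auto
  qed
  from this[of "A - A0"] assms obtain V where "orthonormal_cols A B V" "\<forall>i\<in>A0. \<forall>k. V k i = T k i"
    by (auto simp: Un_absorb1)
  then show ?thesis using orthonormal_square_unitary assms by blast
qed

section \<open>Entries of operators and of link products\<close>


text \<open>Indices are total here: every label gets an admissible value, also outside the factors
  of a given operator, so that one index serves operators with different factors.\<close>

definition bounded :: "('l \<Rightarrow> nat) \<Rightarrow> ('l \<Rightarrow> nat) \<Rightarrow> bool" where
  "bounded d r \<longleftrightarrow> (\<forall>l. r l < d l)"

text \<open>Evaluating operators at total index functions makes their factors irrelevant in products.\<close>

definition ev :: "'l op \<Rightarrow> ('l \<Rightarrow> nat) \<Rightarrow> ('l \<Rightarrow> nat) \<Rightarrow> complex" where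
  "ev A r c = entry A (restrict r (factors A)) (restrict c (factors A))"

lemma finite_idx [simp]: "finite L \<Longrightarrow> finite (idx d L)"
  unfolding idx_def by (rule finite_PiE) auto

lemma idx_outside: "r \<in> idx d L \<Longrightarrow> l \<notin> L \<Longrightarrow> r l = undefined"
  unfolding idx_def by (rule PiE_arb)

lemma restrict_idx: "bounded d r \<Longrightarrow> restrict r L \<in> idx d L"
  unfolding idx_def bounded_def by auto

lemma bounded_upd: "bounded d r \<Longrightarrow> a < d l \<Longrightarrow> bounded d (r(l := a))"
  unfolding bounded_def by auto

lemma bounded_override: "bounded d r \<Longrightarrow> s \<in> idx d K \<Longrightarrow> bounded d (override_on r s K)"
  unfolding bounded_def idx_def by (auto simp: override_on_def dest: PiE_mem)

lemma ev_cong: "(\<And>l. l \<in> factors A \<Longrightarrow> r l = r' l) \<Longrightarrow> (\<And>l. l \<in> factors A \<Longrightarrow> c l = c' l) \<Longrightarrow> ev A r c = ev A r' c'"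
  unfolding ev_def by (metis restrict_ext)

lemma factors_mk_op [simp]: "factors (mk_op d L f) = L"
  by (simp add: mk_op_def)

lemma factors_ident [simp]: "factors (ident d L) = L"
  by (simp add: ident_def)

lemma factors_tensor [simp]: "factors (tensor d A B) = factors A \<union> factors B"
  by (simp add: tensor_def)

lemma factors_scale_op [simp]: "factors (scale_op a A) = factors A"
  by (simp add: scale_op_def)

lemma factors_sum_op [simp]: "factors (sum_op d L f I) = L"
  by (simp add: sum_op_def)

lemma factors_link [simp]: "factors (link d A B) = factors A \<union> factors B - factors A \<inter> factors B"
  by (auto simp: link_def ptrace_def mult_op_def ptranspose_def Let_def)

lemma mk_op_opers [simp]: "mk_op d L f \<in> opers d L"
  by (auto simp: opers_def mk_op_def)

lemma link_opers: "link d A B \<in> opers d (factors A \<union> factors B - factors A \<inter> factors B)"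
proof -
  have "link d A B \<in> opers d (factors (link d A B))"
    by (simp add: link_def ptrace_def Let_def del: factors_link)
  then show ?thesis by simp
qed

lemma ev_mk_op: "bounded d r \<Longrightarrow> bounded d c \<Longrightarrow> ev (mk_op d L f) r c = f (restrict r L) (restrict c L)"
  by (simp add: ev_def mk_op_def restrict_idx)

lemma ev_ident: "bounded d r \<Longrightarrow> bounded d c \<Longrightarrow> ev (ident d L) r c = kdelta (restrict r L) (restrict c L)"
  by (simp add: ident_def ev_mk_op kdelta_def)

lemma ev_ident_empty [simp]: "ev (ident d {}) r c = 1"
  by (simp add: ident_def ev_def mk_op_def idx_def fun_eq_iff)

lemma ev_tensor: "bounded d r \<Longrightarrow> bounded d c \<Longrightarrow> ev (tensor d A B) r c = ev A r c * ev B r c"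
  by (simp add: tensor_def ev_mk_op) (simp add: ev_def Int_absorb1)

lemma ev_scale_op [simp]: "ev (scale_op a A) r c = a * ev A r c"
  by (simp add: scale_op_def ev_def)

lemma ev_sum_op:
  "bounded d r \<Longrightarrow> bounded d c \<Longrightarrow> (\<And>x. x \<in> I \<Longrightarrow> factors (f x) = L) \<Longrightarrow>
    ev (sum_op d L f I) r c = (\<Sum>x\<in>I. ev (f x) r c)"
  by (simp add: sum_op_def ev_mk_op) (simp add: ev_def)

lemma op_eqI:
  assumes "A \<in> opers d L" "B \<in> opers d L" "\<And>l. 0 < d l"
    "\<And>r c. bounded d r \<Longrightarrow> bounded d c \<Longrightarrow> ev A r c = ev B r c"
  shows "A = B"
proof -
  have "entry A r c = entry B r c" for r c
  proof (cases "r \<in> idx d L \<and> c \<in> idx d L")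
    case True
    \<comment> \<open>Outside \<open>L\<close> the value 0 is admissible because all dimensions are
      positive.\<close>
    define t where "t = (\<lambda>f l. if l \<in> L then f l else (0::nat))"
    have t: "bounded d (t f)" "restrict (t f) L = f" if "f \<in> idx d L" for f
      using that assms(3) by (auto simp: bounded_def t_def idx_def fun_eq_iff PiE_iff extensional_def)
    show ?thesis
      using assms(4)[of "t r" "t c"] assms(1,2) True by (simp add: ev_def t opers_def)
  qed (use assms in \<open>auto simp: opers_def\<close>)
  then have "entry A = entry B" by blast
  moreover have "factors A = factors B" using assms by (auto simp: opers_def)
  ultimately show ?thesis by (simp add: op.expand)
qed

lemma ev_ptrace:
  assumes "bounded d r" "bounded d c" "K \<subseteq> factors A"
  shows "ev (ptrace d K A) r c = (\<Sum>s\<in>idx d K. ev A (override_on r s K) (override_on c s K))"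
proof -
  have ov: "override_on (restrict f (factors A - K)) s K = restrict (override_on f s K) (factors A)"
    if "s \<in> idx d K" for s and f :: "_ \<Rightarrow> nat"
    using that assms(3) by (auto simp: fun_eq_iff override_on_def idx_def)
  have "factors A \<inter> K = K" using assms(3) by auto
  then show ?thesis
    unfolding ptrace_def using assms(1,2) by (simp add: ev_mk_op) (simp add: ev_def ov)
qed

text \<open>The partial transpose undoes the exchange of row and column made by the matrix product.
  Shared factors are therefore contracted row with row and column with column.\<close>

lemma ev_link:
  assumes "bounded d r" "bounded d c" "finite (factors A)" "finite (factors B)"
  defines "K \<equiv> factors A \<inter> factors B"
  shows "ev (link d A B) r c = (\<Sum>s\<in>idx d K. \<Sum>t\<in>idx d K.
     ev A (override_on r s K) (override_on c t K) * ev B (override_on r s K) (override_on c t K))"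
proof -
  define FA FB where "FA = factors A" and "FB = factors B"
  define X where "X = tensor d (ptranspose d K A) (ident d (FB - FA))"
  define Y where "Y = tensor d (ident d (FA - FB)) B"
  have K: "K = FA \<inter> FB" "K \<subseteq> FA" "K \<subseteq> FB" by (auto simp: K_def FA_def FB_def)
  have fX: "factors X = FA \<union> FB" "factors Y = FA \<union> FB"
    by (auto simp: X_def Y_def ptranspose_def FA_def FB_def)
  define M where "M = mult_op d X Y"
  have fM: "factors M = FA \<union> FB" by (simp add: M_def mult_op_def fX)
  have lk: "link d A B = ptrace d K M"
    by (simp add: link_def Let_def K_def M_def X_def Y_def FA_def FB_def)
  have 1: "ev (link d A B) r c = (\<Sum>s\<in>idx d K. ev M (override_on r s K) (override_on c s K))"
    unfolding lk by (rule ev_ptrace) (use assms(1,2) K in \<open>auto simp: fM\<close>)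
  have evX: "ev X r c = ev A (override_on r c K) (override_on c r K) * kdelta (restrict r (FB - FA)) (restrict c (FB - FA))"
    if "bounded d r" "bounded d c" for r c
  proof -
    have "override_on (restrict f FA) (restrict g FA) K = restrict (override_on f g K) FA" for f g :: "_ \<Rightarrow> nat"
      using K by (auto simp: fun_eq_iff override_on_def)
    then show ?thesis unfolding X_def using that
      by (simp add: ev_tensor ev_ident ptranspose_def ev_mk_op) (simp add: ev_def FA_def)
  qed
  have evY: "ev Y r c = kdelta (restrict r (FA - FB)) (restrict c (FA - FB)) * ev B r c"
    if "bounded d r" "bounded d c" for r c
    unfolding Y_def using that by (simp add: ev_tensor ev_ident)
  have 2: "ev M r c = (\<Sum>t\<in>idx d K. ev A (override_on r t K) (override_on c r K) * ev B (override_on r t K) (override_on c c K))"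
    if b: "bounded d r" "bounded d c" for r c
  proof -
    \<comment> \<open>The identity factors fix the intermediate index outside \<open>K\<close>: it
      follows the row on the factors of \<open>B\<close> alone and the column on those of
      \<open>A\<close> alone. Only its part \<open>t\<close> on \<open>K\<close> is free.\<close>
    define u where "u = (\<lambda>t l. if l \<in> K then t l else if l \<in> FA then c l else r l)"
    define g where "g = (\<lambda>t. restrict (u t) (FA \<union> FB))"
    have ub: "bounded d (u t)" if "t \<in> idx d K" for t
      using b that by (auto simp: bounded_def u_def idx_def dest: PiE_mem)
    have inj: "inj_on g (idx d K)"
    proof (rule inj_onI)
      fix s t assume st: "s \<in> idx d K" "t \<in> idx d K" "g s = g t"
      have "s l = t l" for l
      proof (cases "l \<in> K")
        case True
        then show ?thesis using fun_cong[OF st(3), of l] K by (auto simp: g_def u_def)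
      next
        case False
        show ?thesis by (simp only: idx_outside[OF st(1) False] idx_outside[OF st(2) False])
      qed
      then show "s = t" by blast
    qed
    have gi: "g ` idx d K \<subseteq> idx d (FA \<union> FB)" using ub by (auto simp: g_def intro!: restrict_idx)
    have fin: "finite (idx d (FA \<union> FB))" using assms(3,4) by (simp add: FA_def FB_def)
    let ?h = "\<lambda>k. entry X (restrict r (FA \<union> FB)) k * entry Y k (restrict c (FA \<union> FB))"
    have "ev M r c = (\<Sum>k\<in>idx d (FA \<union> FB). ?h k)"
      unfolding M_def mult_op_def using b by (simp add: ev_mk_op fX)
    also have "\<dots> = (\<Sum>k\<in>g ` idx d K. ?h k)"
    proof (rule sum.mono_neutral_right[OF fin gi], rule ballI)
      fix k assume k: "k \<in> idx d (FA \<union> FB) - g ` idx d K"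
      have kd: "k l < d l" if "l \<in> FA \<union> FB" for l using k that by (auto simp: idx_def)
      have ku: "k l = undefined" if "l \<notin> FA \<union> FB" for l
        using k idx_outside[OF _ that, of k d] by blast
      define k' where "k' = (\<lambda>l. if l \<in> FA \<union> FB then k l else r l)"
      have k'b: "bounded d k'" using b kd by (auto simp: bounded_def k'_def)
      have k'r: "restrict k' (FA \<union> FB) = k" using ku by (auto simp: k'_def fun_eq_iff)
      have h: "?h k = ev X r k' * ev Y k' c" by (simp add: ev_def fX k'r)
      show "?h k = 0"
      proof (rule ccontr)
        assume "?h k \<noteq> 0"
        then have "ev X r k' \<noteq> 0" "ev Y k' c \<noteq> 0" unfolding h by auto
        then have *: "restrict r (FB - FA) = restrict k' (FB - FA)" "restrict k' (FA - FB) = restrict c (FA - FB)"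
          unfolding evX[OF b(1) k'b] evY[OF k'b b(2)] kdelta_def by (simp_all split: if_splits)
        have e: "r l = k l" if "l \<in> FB - FA" for l
          using fun_cong[OF *(1), of l] that by (simp add: k'_def)
        have e2: "k l = c l" if "l \<in> FA - FB" for l
          using fun_cong[OF *(2), of l] that by (simp add: k'_def)
        have "k l = g (restrict k K) l" for l
          using ku[of l] e[of l] e2[of l] K
          by (cases "l \<in> FA"; cases "l \<in> FB") (simp_all add: g_def u_def)
        then have "k = g (restrict k K)" by blast
        moreover have "restrict k K \<in> idx d K" using kd K by (auto simp: idx_def)
        ultimately show False using k by blast
      qed
    qed
    also have "\<dots> = (\<Sum>t\<in>idx d K. ?h (g t))" by (rule sum.reindex_cong[OF inj]) (simp_all)
    also have "\<dots> = (\<Sum>t\<in>idx d K. ev A (override_on r t K) (override_on c r K) * ev B (override_on r t K) (override_on c c K))"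
    proof (rule sum.cong[OF refl])
      fix t assume t: "t \<in> idx d K"
      have "?h (g t) = ev X r (u t) * ev Y (u t) c" by (simp add: ev_def fX g_def)
      also have "\<dots> = ev A (override_on r (u t) K) (override_on (u t) r K) * ev B (u t) c"
      proof -
        have "restrict r (FB - FA) = restrict (u t) (FB - FA)" "restrict (u t) (FA - FB) = restrict c (FA - FB)"
          using K by (auto simp: u_def fun_eq_iff)
        then show ?thesis using t by (simp add: evX evY b ub kdelta_def)
      qed
      also have "ev A (override_on r (u t) K) (override_on (u t) r K) = ev A (override_on r t K) (override_on c r K)"
        by (rule ev_cong) (auto simp: override_on_def u_def FA_def)
      also have "ev B (u t) c = ev B (override_on r t K) (override_on c c K)"
        by (rule ev_cong) (use K in \<open>auto simp: override_on_def u_def FB_def\<close>)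
      finally show "?h (g t) = ev A (override_on r t K) (override_on c r K) * ev B (override_on r t K) (override_on c c K)" .
    qed
    finally show ?thesis .
  qed
  have "ev (link d A B) r c = (\<Sum>s\<in>idx d K. \<Sum>t\<in>idx d K.
      ev A (override_on r t K) (override_on c s K) * ev B (override_on r t K) (override_on c s K))"
    unfolding 1
  proof (rule sum.cong[OF refl])
    fix s assume s: "s \<in> idx d K"
    have o: "override_on (override_on f s K) t K = override_on f t K" "override_on f (override_on g s K) K = override_on f s K" for f g t
      by (auto simp: override_on_def fun_eq_iff)
    show "ev M (override_on r s K) (override_on c s K) = (\<Sum>t\<in>idx d K.
      ev A (override_on r t K) (override_on c s K) * ev B (override_on r t K) (override_on c s K))"
      using s assms(1,2) by (simp add: 2 bounded_override o)
  qed
  also have "\<dots> = (\<Sum>s\<in>idx d K. \<Sum>t\<in>idx d K.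
     ev A (override_on r s K) (override_on c t K) * ev B (override_on r s K) (override_on c t K))"
    by (rule sum.swap)
  finally show ?thesis .
qed

lemma idx_empty [simp]: "idx d {} = {\<lambda>_. undefined}"
  by (simp add: idx_def)

lemma sum_idx1: "(\<Sum>s\<in>idx d {l}. f s) = (\<Sum>a<d l. f ((\<lambda>_. undefined)(l := a)))"
proof (rule sum.reindex_cong)
  show "inj_on (\<lambda>a. (\<lambda>_. undefined)(l := a)) {..<d l}" by (auto simp: inj_on_def dest: fun_cong[of _ _ l])
  show "idx d {l} = (\<lambda>a. (\<lambda>_. undefined)(l := a)) ` {..<d l}"
    by (auto simp: idx_def PiE_insert_eq image_iff)
qed auto

lemma ev_link_single:
  assumes "bounded d r" "bounded d c" "finite (factors A)" "finite (factors B)" "factors A \<inter> factors B = {l}"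
  shows "ev (link d A B) r c = (\<Sum>a<d l. \<Sum>b<d l. ev A (r(l := a)) (c(l := b)) * ev B (r(l := a)) (c(l := b)))"
proof -
  have "override_on f ((\<lambda>_. undefined)(l := a)) {l} = f(l := a)" for f :: "_ \<Rightarrow> nat" and a
    by (auto simp: override_on_def fun_eq_iff)
  then show ?thesis using ev_link[OF assms(1-4)] by (simp add: assms(5) sum_idx1)
qed

lemma ev_link_disjoint:
  assumes "bounded d r" "bounded d c" "finite (factors A)" "finite (factors B)" "factors A \<inter> factors B = {}"
  shows "ev (link d A B) r c = ev A r c * ev B r c"
  using ev_link[OF assms(1-4)] by (simp add: assms(5))

text \<open>The value off \<open>x\<close>, \<open>y\<close> must be \<open>undefined\<close>
  because \<open>idx\<close> is a set of extensional functions.\<close>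

definition pt :: "'l \<Rightarrow> 'l \<Rightarrow> nat \<times> nat \<Rightarrow> 'l \<Rightarrow> nat" where
  "pt x y p = (\<lambda>_. undefined)(x := fst p, y := snd p)"

lemma idx2: assumes "x \<noteq> y" shows "idx d {x, y} = pt x y ` ({..<d x} \<times> {..<d y})" "inj (pt x y)"
proof -
  show "inj (pt x y)" using assms
    by (auto intro!: injI simp: pt_def prod_eq_iff dest: fun_cong[of _ _ x] fun_cong[of _ _ y])
  show "idx d {x, y} = pt x y ` ({..<d x} \<times> {..<d y})"
  proof (intro equalityI subsetI)
    fix r assume "r \<in> idx d {x, y}"
    then have "r = pt x y (r x, r y)" "r x < d x" "r y < d y"
      using assms by (auto simp: idx_def pt_def fun_eq_iff PiE_iff extensional_def)
    then show "r \<in> pt x y ` ({..<d x} \<times> {..<d y})" by (intro image_eqI[of _ _ "(r x, r y)"]) auto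
  qed (use assms in \<open>auto simp: idx_def pt_def PiE_iff extensional_def\<close>)
qed

lemma sum_idx2:
  assumes "x \<noteq> y"
  shows "(\<Sum>s\<in>idx d {x, y}. f s) = (\<Sum>p\<in>{..<d x} \<times> {..<d y}. f (pt x y p))"
  by (rule sum.reindex_cong[OF inj_on_subset[OF idx2(2)[OF assms]]]) (auto simp: idx2(1)[OF assms])

lemma restrict_pt: "x \<noteq> y \<Longrightarrow> restrict r {x, y} = pt x y (r x, r y)"
  by (auto simp: pt_def fun_eq_iff)

lemma pt_apply [simp]: "x \<noteq> y \<Longrightarrow> pt x y p x = fst p" "pt x y p y = snd p"
  by (simp_all add: pt_def)

section \<open>Operators on one or two factors\<close>


lemma psd_iff_gram: "finite L \<Longrightarrow> psd d L A \<longleftrightarrow> A \<in> opers d L \<and> gram (idx d L) (entry A)"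
  unfolding psd_def by (simp flip: pos_form_iff_gram add: pos_form_def)

lemma entry_mk_op: "r \<in> idx d L \<Longrightarrow> c \<in> idx d L \<Longrightarrow> entry (mk_op d L f) r c = f r c"
  by (simp add: mk_op_def)

lemma mk_op_cong:
  "L = L' \<Longrightarrow> (\<And>r c. r \<in> idx d L \<Longrightarrow> c \<in> idx d L \<Longrightarrow> f r c = g r c) \<Longrightarrow> mk_op d L f = mk_op d L' g"
  by (auto simp: mk_op_def fun_eq_iff)

lemma mk_op_entry: "A \<in> opers d L \<Longrightarrow> mk_op d L (entry A) = A"
  by (cases A) (auto simp: mk_op_def opers_def fun_eq_iff)

section \<open>Operators given by matrices over numbers and pairs\<close>

definition op1 :: "('l \<Rightarrow> nat) \<Rightarrow> 'l \<Rightarrow> (nat \<Rightarrow> nat \<Rightarrow> complex) \<Rightarrow> 'l op" where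
  "op1 d x f = mk_op d {x} (\<lambda>r c. f (r x) (c x))"

definition op2 :: "('l \<Rightarrow> nat) \<Rightarrow> 'l \<Rightarrow> 'l \<Rightarrow> (nat \<times> nat \<Rightarrow> nat \<times> nat \<Rightarrow> complex) \<Rightarrow> 'l op" where
  "op2 d x y f = mk_op d {x, y} (\<lambda>r c. f (r x, r y) (c x, c y))"

definition op_unitary :: "('l \<Rightarrow> nat) \<Rightarrow> 'l \<Rightarrow> 'l \<Rightarrow> 'l \<Rightarrow> 'l \<Rightarrow> (nat \<times> nat \<Rightarrow> nat \<times> nat \<Rightarrow> complex) \<Rightarrow> 'l op" where
  "op_unitary d x y x' y' V = mk_op d ({x, y} \<union> {x', y'})
     (\<lambda>r c. V (r x', r y') (r x, r y) * cnj (V (c x', c y') (c x, c y)))"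

lemma factors_op [simp]:
  "factors (op1 d x f) = {x}" "factors (op2 d x y g) = {x, y}" "factors (op_unitary d x y x' y' V) = {x, y, x', y'}"
  by (auto simp: op1_def op2_def op_unitary_def)

lemma ev_op1: "bounded d r \<Longrightarrow> bounded d c \<Longrightarrow> ev (op1 d x f) r c = f (r x) (c x)"
  by (simp add: op1_def ev_mk_op)

lemma ev_op2: "bounded d r \<Longrightarrow> bounded d c \<Longrightarrow> ev (op2 d x y f) r c = f (r x, r y) (c x, c y)"
  by (simp add: op2_def ev_mk_op)

lemma ev_op_unitary: "bounded d r \<Longrightarrow> bounded d c \<Longrightarrow>
    ev (op_unitary d x y x' y' V) r c = V (r x', r y') (r x, r y) * cnj (V (c x', c y') (c x, c y))"
  by (simp add: op_unitary_def ev_mk_op)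

definition pt1 :: "'l \<Rightarrow> nat \<Rightarrow> 'l \<Rightarrow> nat" where
  "pt1 x a = (\<lambda>_. undefined)(x := a)"

lemma pt1_apply [simp]: "pt1 x a x = a"
  by (simp add: pt1_def)

lemma pt1_idx: "pt1 x a \<in> idx d {x} \<longleftrightarrow> a < d x"
  by (auto simp: pt1_def idx_def PiE_iff extensional_def)

lemma idx_less: "r \<in> idx d L \<Longrightarrow> l \<in> L \<Longrightarrow> r l < d l"
  by (auto simp: idx_def)

lemma pt1_idx_eq: "r \<in> idx d {x} \<Longrightarrow> pt1 x (r x) = r"
  by (auto simp: pt1_def idx_def PiE_iff extensional_def fun_eq_iff)

lemma pt_idx_eq: "x \<noteq> y \<Longrightarrow> r \<in> idx d {x, y} \<Longrightarrow> pt x y (r x, r y) = r"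
  by (auto simp: pt_def idx_def PiE_iff extensional_def fun_eq_iff)

lemma pt_idx: "x \<noteq> y \<Longrightarrow> pt x y p \<in> idx d {x, y} \<longleftrightarrow> p \<in> {..<d x} \<times> {..<d y}"
  by (cases p) (auto simp: pt_def idx_def PiE_iff extensional_def)

lemma psd_op1: "psd d {x} (op1 d x f) \<longleftrightarrow> gram {..<d x} f"
proof -
  have "gram (idx d {x}) (entry (op1 d x f)) \<longleftrightarrow> gram (idx d {x}) (\<lambda>r c. f (r x) (c x))"
    by (rule gram_cong) (simp add: op1_def entry_mk_op)
  also have "\<dots> \<longleftrightarrow> gram {..<d x} f"
  proof
    assume "gram (idx d {x}) (\<lambda>r c. f (r x) (c x))"
    from gram_pull[OF this, of "pt1 x" "{..<d x}"] show "gram {..<d x} f" by (simp add: image_subset_iff pt1_idx)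
  next
    assume "gram {..<d x} f"
    then show "gram (idx d {x}) (\<lambda>r c. f (r x) (c x))"
      by (rule gram_pull) (auto dest: idx_less)
  qed
  finally show ?thesis by (simp add: psd_iff_gram) (simp add: op1_def)
qed

lemma psd_op2:
  assumes "x \<noteq> y"
  shows "psd d {x, y} (op2 d x y f) \<longleftrightarrow> gram ({..<d x} \<times> {..<d y}) f"
proof -
  have "gram (idx d {x, y}) (entry (op2 d x y f)) \<longleftrightarrow> gram (idx d {x, y}) (\<lambda>r c. f (r x, r y) (c x, c y))"
    by (rule gram_cong) (simp add: op2_def entry_mk_op)
  also have "\<dots> \<longleftrightarrow> gram ({..<d x} \<times> {..<d y}) f"
  proof
    assume "gram (idx d {x, y}) (\<lambda>r c. f (r x, r y) (c x, c y))"
    from gram_pull[OF this, of "pt x y" "{..<d x} \<times> {..<d y}"] show "gram ({..<d x} \<times> {..<d y}) f"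
      using assms by (simp add: image_subset_iff pt_idx)
  next
    assume "gram ({..<d x} \<times> {..<d y}) f"
    then show "gram (idx d {x, y}) (\<lambda>r c. f (r x, r y) (c x, c y))"
      by (rule gram_pull) (auto dest: idx_less)
  qed
  finally show ?thesis by (simp add: psd_iff_gram) (simp add: op2_def)
qed

lemma psd1E:
  assumes "psd d {x} A"
  obtains f where "A = op1 d x f" "gram {..<d x} f"
proof -
  have A: "A = op1 d x (\<lambda>a b. entry A (pt1 x a) (pt1 x b))"
  proof -
    have "A = mk_op d {x} (entry A)" using assms by (simp add: psd_def mk_op_entry)
    also have "\<dots> = op1 d x (\<lambda>a b. entry A (pt1 x a) (pt1 x b))"
      unfolding op1_def by (rule mk_op_cong) (simp_all add: pt1_idx_eq)
    finally show ?thesis .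
  qed
  then show ?thesis using that assms psd_op1 by metis
qed

lemma psd2E:
  assumes "psd d {x, y} A" "x \<noteq> y"
  obtains f where "A = op2 d x y f" "gram ({..<d x} \<times> {..<d y}) f"
proof -
  have A: "A = op2 d x y (\<lambda>a b. entry A (pt x y a) (pt x y b))"
  proof -
    have "A = mk_op d {x, y} (entry A)" using assms by (simp add: psd_def mk_op_entry)
    also have "\<dots> = op2 d x y (\<lambda>a b. entry A (pt x y a) (pt x y b))"
      unfolding op2_def
      by (rule mk_op_cong) (simp_all add: pt_idx_eq[OF assms(2)])
    finally show ?thesis .
  qed
  then show ?thesis using that assms psd_op2 by metis
qed

lemma trace_op1: "trace_op d (op1 d x f) = (\<Sum>a<d x. f a a)"
  unfolding trace_op_def factors_op sum_idx1 pt1_def[symmetric]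
  by (intro sum.cong refl) (simp add: op1_def entry_mk_op pt1_idx)

lemma trace_op2: "x \<noteq> y \<Longrightarrow> trace_op d (op2 d x y f) = (\<Sum>p\<in>{..<d x} \<times> {..<d y}. f p p)"
  unfolding trace_op_def factors_op by (simp add: sum_idx2) 
    (intro sum.cong refl, simp add: op2_def entry_mk_op pt_idx)

lemma density_op1: "density d {x} (op1 d x f) \<longleftrightarrow> gram {..<d x} f \<and> (\<Sum>a<d x. f a a) = 1"
  by (simp add: density_def psd_op1 trace_op1)

lemma density_op2: "x \<noteq> y \<Longrightarrow> density d {x, y} (op2 d x y f) \<longleftrightarrow>
    gram ({..<d x} \<times> {..<d y}) f \<and> (\<Sum>p\<in>{..<d x} \<times> {..<d y}. f p p) = 1"
  by (simp add: density_def psd_op2 trace_op2)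

lemma ident_op1: "ident d {x} = op1 d x kdelta"
proof -
  have "r = c \<longleftrightarrow> r x = c x" if "r \<in> idx d {x}" "c \<in> idx d {x}" for r c
    using pt1_idx_eq[OF that(1)] pt1_idx_eq[OF that(2)] by metis
  then show ?thesis unfolding ident_def op1_def kdelta_def by (intro mk_op_cong) simp_all
qed

lemma op1_eq_iff: "op1 d x f = op1 d x g \<longleftrightarrow> (\<forall>a<d x. \<forall>b<d x. f a b = g a b)"
proof
  assume eq: "op1 d x f = op1 d x g"
  show "\<forall>a<d x. \<forall>b<d x. f a b = g a b"
  proof (intro allI impI)
    fix a b assume "a < d x" "b < d x"
    then show "f a b = g a b"
      using arg_cong[OF eq, of "\<lambda>A. entry A (pt1 x a) (pt1 x b)"] by (simp add: op1_def entry_mk_op pt1_idx)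
  qed
next
  assume *: "\<forall>a<d x. \<forall>b<d x. f a b = g a b"
  then show "op1 d x f = op1 d x g"
    unfolding op1_def by (intro mk_op_cong) (simp_all add: idx_less)
qed

lemma channel_choi_op2:
  assumes "x \<noteq> y" and pos: "\<And>l. 0 < d l"
  shows "channel_choi d {x} {y} (op2 d x y f) \<longleftrightarrow> gram ({..<d x} \<times> {..<d y}) f \<and>
    (\<forall>a<d x. \<forall>b<d x. (\<Sum>i<d y. f (a, i) (b, i)) = kdelta a b)"
proof -
  have "ptrace d {y} (op2 d x y f) = op1 d x (\<lambda>a b. \<Sum>i<d y. f (a, i) (b, i))"
  proof (rule op_eqI[OF _ _ pos])
    show "ptrace d {y} (op2 d x y f) \<in> opers d {x}"
      using assms(1) mk_op_opers[of d "{x}"] by (simp add: ptrace_def insert_Diff_if)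
    show "op1 d x (\<lambda>a b. \<Sum>i<d y. f (a, i) (b, i)) \<in> opers d {x}" by (simp add: op1_def)
    fix r c assume b: "bounded d r" "bounded d c"
    have o: "override_on g ((\<lambda>_. undefined)(y := a)) {y} = g(y := a)" for g :: "_ \<Rightarrow> nat" and a
      by (auto simp: override_on_def fun_eq_iff)
    show "ev (ptrace d {y} (op2 d x y f)) r c = ev (op1 d x (\<lambda>a b. \<Sum>i<d y. f (a, i) (b, i))) r c"
      using b assms(1) by (simp add: ev_ptrace sum_idx1 o ev_op2 ev_op1 bounded_upd)
  qed
  moreover have "{x} \<union> {y} = {x, y}" by auto
  ultimately show ?thesis
    unfolding channel_choi_def by (simp add: psd_op2[OF assms(1)] ident_op1 op1_eq_iff)
qed

text \<open>A matrix unit selects one column of \<open>V\<close> on each side, so the Choi operator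
  of a conjugation is the rank-one kernel of the vector of matrix elements of
  \<open>V\<close>.\<close>

lemma choi_conj_map:
  assumes "finite A" "finite B"
  shows "choi d A B (conj_map d A B V) = mk_op d (A \<union> B)
     (\<lambda>r c. V (restrict r B) (restrict r A) * cnj (V (restrict c B) (restrict c A)))"
  unfolding choi_def
proof (rule mk_op_cong[OF refl])
  fix r c assume rc: "r \<in> idx d (A \<union> B)" "c \<in> idx d (A \<union> B)"
  have res: "restrict f A \<in> idx d A" "restrict f B \<in> idx d B" if "f \<in> idx d (A \<union> B)" for f
    using that by (auto simp: idx_def)
  have "entry (conj_map d A B V (mat_unit d A (restrict r A) (restrict c A))) (restrict r B) (restrict c B)
     = (\<Sum>i\<in>idx d A. \<Sum>j\<in>idx d A. kdelta i (restrict r A) * (kdelta j (restrict c A) * (V (restrict r B) i * cnj (V (restrict c B) j))))"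
    using rc by (simp add: conj_map_def entry_mk_op res)
      (intro sum.cong refl, auto simp: mat_unit_def entry_mk_op kdelta_def)
  also have "\<dots> = V (restrict r B) (restrict r A) * cnj (V (restrict c B) (restrict c A))"
    using rc assms by (simp add: res flip: sum_distrib_left)
  finally show "entry (conj_map d A B V (mat_unit d A (restrict r A) (restrict c A))) (restrict r B) (restrict c B)
     = V (restrict r B) (restrict r A) * cnj (V (restrict c B) (restrict c A))" .
qed

lemma unitary_iff_on:
  "unitary d A B V \<longleftrightarrow> unitary_on (idx d A) (idx d B) V"
  by (simp add: unitary_def unitary_on_def orthonormal_cols_def kdelta_def)

lemma unitary_on_pt:
  assumes "x \<noteq> y" "x' \<noteq> y'"
  shows "unitary_on (idx d {x, y}) (idx d {x', y'}) V \<longleftrightarrow>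
    unitary_on ({..<d x} \<times> {..<d y}) ({..<d x'} \<times> {..<d y'}) (\<lambda>p q. V (pt x' y' p) (pt x y q))"
proof -
  have k: "kdelta (pt x y p) (pt x y q) = kdelta p q" "kdelta (pt x' y' p) (pt x' y' q) = kdelta p q" for p q
    using idx2(2)[OF assms(1)] idx2(2)[OF assms(2)] by (auto simp: kdelta_def inj_eq)
  show ?thesis
    unfolding unitary_on_def orthonormal_cols_def
    by (simp only: sum_idx2[OF assms(1)] sum_idx2[OF assms(2)]) (simp add: idx2(1)[OF assms(1)] idx2(1)[OF assms(2)] k)
qed

lemma unitary_choiE:
  assumes "unitary_choi d {x, y} {x', y'} U" "x \<noteq> y" "x' \<noteq> y'"
  obtains V where "unitary_on ({..<d x} \<times> {..<d y}) ({..<d x'} \<times> {..<d y'}) V" "U = op_unitary d x y x' y' V"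
proof -
  obtain V where V: "unitary d {x, y} {x', y'} V" "U = choi d {x, y} {x', y'} (conj_map d {x, y} {x', y'} V)"
    using assms(1) unfolding unitary_choi_def by blast
  show ?thesis
  proof (rule that[of "\<lambda>p q. V (pt x' y' p) (pt x y q)"])
    show "unitary_on ({..<d x} \<times> {..<d y}) ({..<d x'} \<times> {..<d y'}) (\<lambda>p q. V (pt x' y' p) (pt x y q))"
      using V(1) assms by (simp add: unitary_iff_on unitary_on_pt)
    show "U = op_unitary d x y x' y' (\<lambda>p q. V (pt x' y' p) (pt x y q))"
      unfolding V(2) op_unitary_def by (simp add: choi_conj_map restrict_pt assms(2,3))
  qed
qed

lemma unitary_choiI:
  assumes "unitary_on ({..<d x} \<times> {..<d y}) ({..<d x'} \<times> {..<d y'}) V" "x \<noteq> y" "x' \<noteq> y'"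
  shows "unitary_choi d {x, y} {x', y'} (op_unitary d x y x' y' V)"
proof -
  define W where "W = (\<lambda>k i. V (k x', k y') (i x, i y))"
  have "unitary d {x, y} {x', y'} W"
    using assms by (simp add: unitary_iff_on unitary_on_pt W_def)
  moreover have "op_unitary d x y x' y' V = choi d {x, y} {x', y'} (conj_map d {x, y} {x', y'} W)"
    unfolding op_unitary_def by (simp add: choi_conj_map W_def)
  ultimately show ?thesis unfolding unitary_choi_def by blast
qed

section \<open>Circuits as iterated contractions\<close>


text \<open>A step operator has indices \<open>(a, o, a', i)\<close>: environment before, system output, environment
  after, system input. \<open>run k G \<rho> r c n\<close> is the environment state before the \<open>(n + 1)\<close>st step,
  for given system indices \<open>r\<close>, \<open>c\<close>.\<close>

type_synonym step = "nat \<times> nat \<times> nat \<times> nat \<Rightarrow> nat \<times> nat \<times> nat \<times> nat \<Rightarrow> complex"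

primrec run :: "(nat \<Rightarrow> nat) \<Rightarrow> (nat \<Rightarrow> step) \<Rightarrow> (nat \<times> nat \<Rightarrow> nat \<times> nat \<Rightarrow> complex) \<Rightarrow>
    (port \<Rightarrow> nat) \<Rightarrow> (port \<Rightarrow> nat) \<Rightarrow> nat \<Rightarrow> nat \<Rightarrow> nat \<Rightarrow> complex" where
  "run k G \<rho> r c 0 = (\<lambda>a b. \<rho> (a, r (In 1)) (b, c (In 1)))"
| "run k G \<rho> r c (Suc n) = (\<lambda>a b. \<Sum>a'<k (Suc n). \<Sum>b'<k (Suc n).
     G (Suc n) (a', r (Out (Suc n)), a, r (In (Suc (Suc n)))) (b', c (Out (Suc n)), b, c (In (Suc (Suc n))))
     * run k G \<rho> r c n a' b')"

text \<open>Setting ports outside the process to 0 gives each basis index exactly one representative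
  in \<open>sys_idx\<close>; this makes \<open>sys_op_cong\<close> and \<open>sys_op_inj\<close>
  possible.\<close>

definition sys_ext :: "nat \<Rightarrow> (label \<Rightarrow> nat) \<Rightarrow> port \<Rightarrow> nat" where
  "sys_ext N r = (\<lambda>p. if Sys p \<in> sys_labels N then r (Sys p) else 0)"

definition sys_idx :: "nat \<Rightarrow> (port \<Rightarrow> nat) \<Rightarrow> (port \<Rightarrow> nat) set" where
  "sys_idx N s = {r. (\<forall>p. r p < s p) \<and> (\<forall>p. Sys p \<notin> sys_labels N \<longrightarrow> r p = 0)}"

definition sys_op :: "nat \<Rightarrow> (port \<Rightarrow> nat) \<Rightarrow> ((port \<Rightarrow> nat) \<Rightarrow> (port \<Rightarrow> nat) \<Rightarrow> complex) \<Rightarrow> label op" where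
  "sys_op N s f = mk_op (dims s (\<lambda>_. 1)) (sys_labels N) (\<lambda>r c. f (sys_ext N r) (sys_ext N c))"

text \<open>The dimensions \<open>k\<close> and kernels \<open>G\<close> need not come from a
  circuit: the same formula serves abstract sequences of channels, which are realised by circuits
  later.\<close>

definition process :: "nat \<Rightarrow> (port \<Rightarrow> nat) \<Rightarrow> (nat \<Rightarrow> nat) \<Rightarrow> (nat \<Rightarrow> step) \<Rightarrow>
    (nat \<times> nat \<Rightarrow> nat \<times> nat \<Rightarrow> complex) \<Rightarrow> label op" where
  "process N s k G \<rho> = sys_op N s (\<lambda>r c. \<Sum>a<k N. run k G \<rho> r c (N - 1) a a)"

lemma run_cong:
  assumes "\<And>i. i \<in> {1..Suc n} \<Longrightarrow> r (In i) = r' (In i) \<and> c (In i) = c' (In i)"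
    "\<And>i. i \<in> {1..n} \<Longrightarrow> r (Out i) = r' (Out i) \<and> c (Out i) = c' (Out i)"
  shows "run k G \<rho> r c n = run k G \<rho> r' c' n"
  using assms
proof (induction n)
  case (Suc n)
  have "run k G \<rho> r c n = run k G \<rho> r' c' n" by (rule Suc.IH) (use Suc.prems in auto)
  then show ?case using Suc.prems by simp
qed simp

lemma idx_sys: "L \<subseteq> range Sys \<Longrightarrow> idx (dims s e) L = idx (dims s e') L"
  unfolding idx_def by (rule PiE_cong) auto

lemma sys_labels_Sys: "sys_labels N \<subseteq> range Sys"
  by (auto simp: sys_labels_def)

lemma mk_op_sys: "mk_op (dims s e) (sys_labels N) f = mk_op (dims s e') (sys_labels N) f"
  using idx_sys[OF sys_labels_Sys, of s e N e'] by (simp add: mk_op_def)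

lemma sys_op_cong:
  assumes "\<And>p. 0 < s p" "\<And>r c. r \<in> sys_idx N s \<Longrightarrow> c \<in> sys_idx N s \<Longrightarrow> f r c = g r c"
  shows "sys_op N s f = sys_op N s g"
proof -
  have "sys_ext N r \<in> sys_idx N s" if "r \<in> idx (dims s (\<lambda>_. 1)) (sys_labels N)" for r
    using idx_less[OF that] assms(1) by (fastforce simp: sys_ext_def sys_idx_def)
  then show ?thesis unfolding sys_op_def using assms(2) by (intro mk_op_cong) simp_all
qed

text \<open>The strictness proofs compare processes entry by entry through this fact.\<close>

lemma sys_op_inj:
  assumes "sys_op N s f = sys_op N s g" "r \<in> sys_idx N s" "c \<in> sys_idx N s"
  shows "f r c = g r c"
proof -
  let ?t = "\<lambda>r. restrict (case_label r (\<lambda>_. 0)) (sys_labels N)"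
  have t: "?t r \<in> idx (dims s (\<lambda>_. 1)) (sys_labels N)" "sys_ext N (?t r) = r" if "r \<in> sys_idx N s" for r
    using that sys_labels_Sys[of N] by (auto simp: sys_idx_def idx_def sys_ext_def fun_eq_iff)
  show ?thesis
    using arg_cong[OF assms(1), of "\<lambda>A. entry A (?t r) (?t c)"] t[OF assms(2)] t[OF assms(3)]
    by (simp add: sys_op_def entry_mk_op)
qed

lemma sys_op_opers: "sys_op N s f \<in> opers (dims s e) (sys_labels N)"
  unfolding sys_op_def mk_op_sys[of s "\<lambda>_. 1" N _ e] by simp

lemma ev_sys_op:
  assumes "bounded (dims s e) r" "bounded (dims s e) c"
  shows "ev (sys_op N s f) r c = f (sys_ext N r) (sys_ext N c)"
proof -
  have "sys_ext N (restrict r (sys_labels N)) = sys_ext N r" for r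
    by (simp add: sys_ext_def fun_eq_iff)
  then show ?thesis unfolding sys_op_def mk_op_sys[of s "\<lambda>_. 1" N _ e] using assms by (simp add: ev_mk_op)
qed

lemma ev_process:
  assumes "bounded (dims s e) r" "bounded (dims s e) c" "N \<ge> 1"
  shows "ev (process N s k G \<rho>) r c = (\<Sum>a<k N. run k G \<rho> (r \<circ> Sys) (c \<circ> Sys) (N - 1) a a)"
proof -
  have "run k G \<rho> (sys_ext N r) (sys_ext N c) (N - 1) = run k G \<rho> (r \<circ> Sys) (c \<circ> Sys) (N - 1)"
    by (rule run_cong) (use assms(3) in \<open>auto simp: sys_labels_def sys_ext_def\<close>)
  then show ?thesis unfolding process_def by (simp add: ev_sys_op[OF assms(1,2)])
qed

definition circuit_step :: "(port \<Rightarrow> nat) \<Rightarrow> (nat \<Rightarrow> nat \<times> nat \<Rightarrow> nat \<times> nat \<Rightarrow> complex) \<Rightarrow>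
    (nat \<Rightarrow> nat \<times> nat \<Rightarrow> nat \<times> nat \<Rightarrow> complex) \<Rightarrow> nat \<Rightarrow> step" where
  "circuit_step e V x j = (\<lambda>(a, p, a', i) (b, q, b', l). \<Sum>\<alpha><e (Out j). \<Sum>\<beta><e (Out j).
     V j (a', i) (\<alpha>, p) * cnj (V j (b', l) (\<beta>, q)) * x j (\<alpha>, a) (\<beta>, b))"

text \<open>Neighbouring steps share one environment label, which is contracted.
  \<open>Env (In 1)\<close> stays open because the initial state is linked only afterwards.\<close>

lemma factors_big_link:
  assumes "\<And>j. j \<in> {1..n} \<Longrightarrow> factors (f j) = {Env (In j), Env (In (Suc j)), Sys (Out j), Sys (In (Suc j))}"
    and "n \<ge> 1"
  shows "factors (big_link d f n) =
     {Env (In 1), Env (In (Suc n))} \<union> (\<lambda>j. Sys (Out j)) ` {1..n} \<union> (\<lambda>j. Sys (In j)) ` {2..Suc n}"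
  using assms(2,1)
proof (induction n rule: dec_induct)
  case base
  have f: "factors (f (Suc 0)) = {Env (In (Suc 0)), Env (In (Suc (Suc 0))), Sys (Out (Suc 0)), Sys (In (Suc (Suc 0)))}"
    by (rule base) simp
  show ?case unfolding One_nat_def big_link.simps factors_link factors_ident f numeral_2_eq_2
    by (simp add: insert_commute)
next
  case (step n)
  have IH: "factors (big_link d f n) =
     {Env (In 1), Env (In (Suc n))} \<union> (\<lambda>j. Sys (Out j)) ` {1..n} \<union> (\<lambda>j. Sys (In j)) ` {2..Suc n}"
    by (rule step.IH, rule step.prems) simp
  have f: "factors (f (Suc n)) = {Env (In (Suc n)), Env (In (Suc (Suc n))), Sys (Out (Suc n)), Sys (In (Suc (Suc n)))}"
    by (rule step.prems) simp
  have ins: "{1..Suc n} = insert (Suc n) {1..n}" "{2..Suc (Suc n)} = insert (Suc (Suc n)) {2..Suc n}"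
    by auto
  let ?Q = "(\<lambda>j. Sys (Out j)) ` {1..n} \<union> (\<lambda>j. Sys (In j)) ` {2..Suc n}"
  have Q: "Env (In i) \<notin> ?Q" "Sys (Out (Suc n)) \<notin> ?Q" "Sys (In (Suc (Suc n))) \<notin> ?Q" for i by auto
  show ?case unfolding big_link.simps factors_link IH f ins image_insert
    using step.hyps(1) Q by (simp add: Un_assoc) (simp add: insert_commute insert_Diff_if Int_Un_distrib)
qed

lemma sum_swap4:
  "(\<Sum>a\<in>A. \<Sum>b\<in>B. \<Sum>a'\<in>A'. \<Sum>b'\<in>B'. h a b a' b') = (\<Sum>a'\<in>A'. \<Sum>b'\<in>B'. \<Sum>a\<in>A. \<Sum>b\<in>B. h a b a' b')"
proof -
  have "(\<Sum>a\<in>A. \<Sum>b\<in>B. \<Sum>a'\<in>A'. \<Sum>b'\<in>B'. h a b a' b') = (\<Sum>a\<in>A. \<Sum>a'\<in>A'. \<Sum>b'\<in>B'. \<Sum>b\<in>B. h a b a' b')"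
    by (rule sum.cong[OF refl], subst sum.swap, rule sum.cong[OF refl], rule sum.swap)
  also have "\<dots> = (\<Sum>a'\<in>A'. \<Sum>b'\<in>B'. \<Sum>a\<in>A. \<Sum>b\<in>B. h a b a' b')"
    by (subst sum.swap, rule sum.cong[OF refl], rule sum.swap)
  finally show ?thesis .
qed

text \<open>\<open>X j\<close> enters only through its matrix \<open>x j\<close>, so that a single
  computation covers identity, trace-and-prepare and entanglement-breaking memory.\<close>

locale circuit =
  fixes N :: nat and s e :: "port \<Rightarrow> nat" and d :: "label \<Rightarrow> nat"
    and V x :: "nat \<Rightarrow> nat \<times> nat \<Rightarrow> nat \<times> nat \<Rightarrow> complex"
    and X :: "nat \<Rightarrow> label op" and \<rho> :: "nat \<times> nat \<Rightarrow> nat \<times> nat \<Rightarrow> complex"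
  defines "d \<equiv> dims s e"
  assumes N: "N \<ge> 2" and pos: "\<And>p. 0 < s p" "\<And>p. 0 < e p"
    and fX: "\<And>j. j \<in> {1..<N} \<Longrightarrow> factors (X j) = {Env (Out j), Env (In j)}"
    and evX: "\<And>j r c. j \<in> {1..<N} \<Longrightarrow> bounded d r \<Longrightarrow> bounded d c \<Longrightarrow>
      ev (X j) r c = x j (r (Env (Out j)), r (Env (In j))) (c (Env (Out j)), c (Env (In j)))"
begin

abbreviation "U j \<equiv> op_unitary d (Env (Out j)) (Sys (Out j)) (Env (In (j + 1))) (Sys (In (j + 1))) (V j)"
abbreviation "G \<equiv> circuit_step e V x"
abbreviation "R \<equiv> op2 d (Env (In 1)) (Sys (In 1)) \<rho>"
abbreviation "k \<equiv> (\<lambda>n. e (In n))"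

definition F where "F = (\<lambda>j. link d (U j) (X j))"

lemma pos_d: "0 < d l"
  using pos by (cases l) (auto simp: d_def)

lemma factors_f: "j \<in> {1..<N} \<Longrightarrow> factors (F j) = {Env (In j), Env (In (Suc j)), Sys (Out j), Sys (In (Suc j))}"
  by (auto simp: fX F_def)

lemma ev_f:
  assumes "j \<in> {1..<N}" "bounded d r" "bounded d c"
  shows "ev (F j) r c = G j (r (Env (In j)), r (Sys (Out j)), r (Env (In (Suc j))), r (Sys (In (Suc j))))
     (c (Env (In j)), c (Sys (Out j)), c (Env (In (Suc j))), c (Sys (In (Suc j))))"
proof -
  have "factors (U j) \<inter> factors (X j) = {Env (Out j)}" using assms(1) by (auto simp: fX)
  from ev_link_single[OF assms(2,3) _ _ this] have
    "ev (F j) r c = (\<Sum>\<alpha><e (Out j). \<Sum>\<beta><e (Out j). ev (U j) (r(Env (Out j) := \<alpha>)) (c(Env (Out j) := \<beta>))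
      * ev (X j) (r(Env (Out j) := \<alpha>)) (c(Env (Out j) := \<beta>)))"
    using assms(1) by (simp add: fX F_def) (simp add: d_def)
  also have "\<dots> = G j (r (Env (In j)), r (Sys (Out j)), r (Env (In (Suc j))), r (Sys (In (Suc j))))
     (c (Env (In j)), c (Sys (Out j)), c (Env (In (Suc j))), c (Sys (In (Suc j))))"
  proof -
    have "bounded d (g(Env (Out j) := \<alpha>))" if "bounded d g" "\<alpha> < e (Out j)" for g \<alpha>
      by (rule bounded_upd[OF that(1)]) (use that in \<open>simp add: d_def\<close>)
    then show ?thesis using assms unfolding circuit_step_def
      by (simp add: ev_op_unitary evX)
  qed
  finally show ?thesis .
qed

lemma factors_T: "1 \<le> n \<Longrightarrow> n < N \<Longrightarrow> factors (big_link d F n) =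
     {Env (In 1), Env (In (Suc n))} \<union> (\<lambda>j. Sys (Out j)) ` {1..n} \<union> (\<lambda>j. Sys (In j)) ` {2..Suc n}"
  by (rule factors_big_link, rule factors_f) auto

lemma d_Env: "d (Env p) = e p"
  by (simp add: d_def)

text \<open>A circuit links the steps first and the state last, whereas \<open>run\<close> starts
  from the state. Keeping the contraction with \<open>R\<close> over \<open>Env (In 1)\<close>
  inside the statement reconciles the two orders.\<close>

lemma ev_big_link:
  assumes "1 \<le> n" "n < N" "bounded d r" "bounded d c"
  shows "(\<Sum>a<e (In 1). \<Sum>b<e (In 1). ev (big_link d F n) (r(Env (In 1) := a)) (c(Env (In 1) := b))
      * ev R (r(Env (In 1) := a)) (c(Env (In 1) := b)))
    = run k G \<rho> (r \<circ> Sys) (c \<circ> Sys) n (r (Env (In (Suc n)))) (c (Env (In (Suc n))))"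
  using assms
proof (induction n arbitrary: r c rule: dec_induct)
  case base
  let ?E = "Env (In 1)"
  have "factors (F 1) \<inter> factors (ident d {}) = {}" by simp
  note l = ev_link_disjoint[OF _ _ _ _ this]
  have eq: "ev (big_link d F 1) (r(?E := a)) (c(?E := b)) * ev R (r(?E := a)) (c(?E := b))
     = G 1 (a, r (Sys (Out 1)), r (Env (In 2)), r (Sys (In 2))) (b, c (Sys (Out 1)), c (Env (In 2)), c (Sys (In 2))) *
       \<rho> (a, r (Sys (In 1))) (b, c (Sys (In 1)))"
    if "a < e (In 1)" "b < e (In 1)" for a b
  proof -
    have bd: "bounded d (r(?E := a))" "bounded d (c(?E := b))"
      using that base by (auto intro!: bounded_upd simp: d_def)
    have 1: "1 \<in> {1..<N}" using N by auto
    have "ev (big_link d F 1) (r(?E := a)) (c(?E := b)) = ev (F 1) (r(?E := a)) (c(?E := b))"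
      using l[OF bd] factors_f[OF 1] by simp
    moreover have "ev R (r(?E := a)) (c(?E := b)) = \<rho> (a, r (Sys (In 1))) (b, c (Sys (In 1)))"
      using ev_op2[OF bd] by simp
    ultimately show ?thesis using ev_f[OF 1 bd] by (simp add: numeral_2_eq_2)
  qed
  show ?case
    unfolding One_nat_def run.simps
    by (intro sum.cong refl)
      (simp only: eq[unfolded One_nat_def numeral_2_eq_2] lessThan_iff comp_def)
next
  case (step n)
  let ?E = "Env (In 1)" and ?E2 = "Env (In (Suc n))"
  \<comment> \<open>From the second step on, the label being contracted differs from the open label
    \<open>Env (In 1)\<close>, so the two updates commute.\<close>
  have EF: "?E \<noteq> ?E2" using step.hyps(1) by simp
  have Sn: "Suc n \<in> {1..<N}" using step.prems(1) by simp
  have fT: "factors (big_link d F n) =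
     {Env (In 1), Env (In (Suc n))} \<union> (\<lambda>j. Sys (Out j)) ` {1..n} \<union> (\<lambda>j. Sys (In j)) ` {2..Suc n}"
    by (rule factors_T) (use step.hyps step.prems(1) in simp_all)
  have int: "factors (F (Suc n)) \<inter> factors (big_link d F n) = {?E2}"
    unfolding factors_f[OF Sn] fT using step.hyps(1) by auto
  define g where "g = (\<lambda>a b. G (Suc n) (a, r (Sys (Out (Suc n))), r (Env (In (Suc (Suc n)))), r (Sys (In (Suc (Suc n)))))
      (b, c (Sys (Out (Suc n))), c (Env (In (Suc (Suc n)))), c (Sys (In (Suc (Suc n))))))"
  have upd: "bounded d (h(l := a))" if "bounded d h" "a < e p" "l = Env p" for h l a p
    using that by (auto intro!: bounded_upd simp: d_def)
  have "(\<Sum>a<e (In 1). \<Sum>b<e (In 1). ev (big_link d F (Suc n)) (r(?E := a)) (c(?E := b)) * ev R (r(?E := a)) (c(?E := b)))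
    = (\<Sum>a<e (In 1). \<Sum>b<e (In 1). \<Sum>a'<e (In (Suc n)). \<Sum>b'<e (In (Suc n)).
       g a' b' * (ev (big_link d F n) (r(?E2 := a', ?E := a)) (c(?E2 := b', ?E := b))
        * ev R (r(?E2 := a', ?E := a)) (c(?E2 := b', ?E := b))))"
  proof (intro sum.cong refl)
    fix a b assume "a \<in> {..<e (In 1)}" "b \<in> {..<e (In 1)}"
    then have ab: "bounded d (r(?E := a))" "bounded d (c(?E := b))" using upd step.prems by auto
    have "ev (big_link d F (Suc n)) (r(?E := a)) (c(?E := b)) =
      (\<Sum>a'<e (In (Suc n)). \<Sum>b'<e (In (Suc n)). ev (F (Suc n)) (r(?E := a, ?E2 := a')) (c(?E := b, ?E2 := b'))
        * ev (big_link d F n) (r(?E := a, ?E2 := a')) (c(?E := b, ?E2 := b')))"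
      using ev_link_single[OF ab _ _ int] factors_f[OF Sn] fT by (simp add: d_Env)
    also have "\<dots> = (\<Sum>a'<e (In (Suc n)). \<Sum>b'<e (In (Suc n)). g a' b' *
       ev (big_link d F n) (r(?E2 := a', ?E := a)) (c(?E2 := b', ?E := b)))"
    proof (intro sum.cong refl)
      fix a' b' assume "a' \<in> {..<e (In (Suc n))}" "b' \<in> {..<e (In (Suc n))}"
      then have "bounded d (r(?E := a, ?E2 := a'))" "bounded d (c(?E := b, ?E2 := b'))"
        using upd ab by auto
      then show "ev (F (Suc n)) (r(?E := a, ?E2 := a')) (c(?E := b, ?E2 := b')) *
        ev (big_link d F n) (r(?E := a, ?E2 := a')) (c(?E := b, ?E2 := b')) =
        g a' b' * ev (big_link d F n) (r(?E2 := a', ?E := a)) (c(?E2 := b', ?E := b))"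
        by (simp only: ev_f[OF Sn] fun_upd_twist[OF EF]) (use EF in \<open>simp add: g_def\<close>)
    qed
    finally have eq: "ev (big_link d F (Suc n)) (r(?E := a)) (c(?E := b)) = \<dots>" .
    have R: "ev R (r(?E := a)) (c(?E := b)) = ev R (r(?E2 := a', ?E := a)) (c(?E2 := b', ?E := b))" for a' b'
      by (rule ev_cong) (use EF in auto)
    show "ev (big_link d F (Suc n)) (r(?E := a)) (c(?E := b)) * ev R (r(?E := a)) (c(?E := b)) =
       (\<Sum>a'<e (In (Suc n)). \<Sum>b'<e (In (Suc n)).
       g a' b' * (ev (big_link d F n) (r(?E2 := a', ?E := a)) (c(?E2 := b', ?E := b))
        * ev R (r(?E2 := a', ?E := a)) (c(?E2 := b', ?E := b))))"
      unfolding eq sum_distrib_right mult.assoc by (intro sum.cong refl) (subst R, rule refl)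
  qed
  also have "\<dots> = (\<Sum>a'<e (In (Suc n)). \<Sum>b'<e (In (Suc n)). g a' b' * (\<Sum>a<e (In 1). \<Sum>b<e (In 1).
       ev (big_link d F n) (r(?E2 := a', ?E := a)) (c(?E2 := b', ?E := b))
        * ev R (r(?E2 := a', ?E := a)) (c(?E2 := b', ?E := b))))"
    unfolding sum_distrib_left by (rule sum_swap4)
  also have "\<dots> = (\<Sum>a'<e (In (Suc n)). \<Sum>b'<e (In (Suc n)). g a' b' * run k G \<rho> (r \<circ> Sys) (c \<circ> Sys) n a' b')"
  proof (intro sum.cong refl arg_cong2[of _ _ _ _ "(*)"])
    fix a' b' assume "a' \<in> {..<e (In (Suc n))}" "b' \<in> {..<e (In (Suc n))}"
    then have b: "bounded d (r(?E2 := a'))" "bounded d (c(?E2 := b'))" using upd step.prems by auto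
    have o: "h(?E2 := z) \<circ> Sys = h \<circ> Sys" for h :: "label \<Rightarrow> nat" and z by (auto simp: fun_eq_iff)
    have "n < N" using Sn by simp
    from step.IH[OF this b] show "(\<Sum>a<e (In 1). \<Sum>b<e (In 1).
       ev (big_link d F n) (r(?E2 := a', ?E := a)) (c(?E2 := b', ?E := b))
        * ev R (r(?E2 := a', ?E := a)) (c(?E2 := b', ?E := b))) = run k G \<rho> (r \<circ> Sys) (c \<circ> Sys) n a' b'"
      by (simp only: o fun_upd_same)
  qed
  finally show ?case unfolding g_def by (simp only: run.simps fun_upd_def comp_def)
qed

lemma link_eq_process:
  "link d (ident d {Env (In N)}) (link d (big_link d F (N - 1)) R) = process N s k G \<rho>"
proof -
  let ?T = "big_link d F (N - 1)" and ?E = "Env (In 1)" and ?E2 = "Env (In N)"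
  have fT: "factors ?T = {?E, ?E2} \<union> (\<lambda>j. Sys (Out j)) ` {1..N - 1} \<union> (\<lambda>j. Sys (In j)) ` {2..N}"
    using factors_T[of "N - 1"] N by simp
  have fL: "factors (link d ?T R) = {?E2} \<union> (\<lambda>j. Sys (Out j)) ` {1..N - 1} \<union> (\<lambda>j. Sys (In j)) ` {1..N}"
    using N unfolding factors_link fT by (auto simp: image_iff)
  have iR: "factors ?T \<inter> factors R = {?E}" using N unfolding fT by auto
  have iL: "factors (ident d {?E2}) \<inter> factors (link d ?T R) = {?E2}" unfolding fL by auto
  have fin: "finite (factors ?T)" "finite (factors (link d ?T R))" unfolding fT fL by simp_all
  have fC: "{?E2} \<union> factors (link d ?T R) - {?E2} \<inter> factors (link d ?T R) = sys_labels N"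
    unfolding fL sys_labels_def using N by (auto simp: image_iff)
  show ?thesis
  proof (rule op_eqI[of _ d "sys_labels N"])
    show "link d (ident d {?E2}) (link d ?T R) \<in> opers d (sys_labels N)"
      using link_opers[of d "ident d {?E2}" "link d ?T R"] fC by (simp only: factors_ident)
    show "process N s k G \<rho> \<in> opers d (sys_labels N)" unfolding d_def process_def by (rule sys_op_opers)
    show "0 < d l" for l by (rule pos_d)
    fix r c assume b: "bounded d r" "bounded d c"
    have o: "h(?E2 := z) \<circ> Sys = h \<circ> Sys" for h :: "label \<Rightarrow> nat" and z by (auto simp: fun_eq_iff)
    have upd: "bounded d (h(?E2 := a))" if "bounded d h" "a < e (In N)" for h a
      using that by (auto intro!: bounded_upd simp: d_def)
    have "ev (link d (ident d {?E2}) (link d ?T R)) r c =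
       (\<Sum>a<e (In N). \<Sum>b<e (In N). kdelta a b * ev (link d ?T R) (r(?E2 := a)) (c(?E2 := b)))"
      using ev_link_single[OF b _ _ iL] fin upd b by (simp add: d_Env ident_op1 ev_op1 del: factors_link)
    also have "\<dots> = (\<Sum>a<e (In N). ev (link d ?T R) (r(?E2 := a)) (c(?E2 := a)))"
      by simp
    also have "\<dots> = (\<Sum>a<e (In N). run k G \<rho> (r \<circ> Sys) (c \<circ> Sys) (N - 1) a a)"
    proof (intro sum.cong refl)
      fix a assume "a \<in> {..<e (In N)}"
      then have b': "bounded d (r(?E2 := a))" "bounded d (c(?E2 := a))" using upd b by auto
      have "1 \<le> N - 1" "N - 1 < N" "Suc (N - 1) = N" using N by auto
      then show "ev (link d ?T R) (r(?E2 := a)) (c(?E2 := a)) = run k G \<rho> (r \<circ> Sys) (c \<circ> Sys) (N - 1) a a"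
        using ev_link_single[OF b' fin(1) _ iR] ev_big_link[OF _ _ b', of "N - 1"] by (simp add: d_Env o)
    qed
    finally show "ev (link d (ident d {?E2}) (link d ?T R)) r c = ev (process N s k G \<rho>) r c"
      using ev_process[of s e r c N] b N by (simp add: d_def)
  qed
qed

end

section \<open>Circuits with entanglement-breaking memory\<close>


lemma dims_pos: "(\<And>p. 0 < s p) \<Longrightarrow> (\<And>p. 0 < e p) \<Longrightarrow> 0 < dims s e l"
  by (cases l) auto

lemma circuitsI:
  fixes s e :: "port \<Rightarrow> nat"
  defines "d \<equiv> dims s e"
  assumes N: "N \<ge> 2" and pos: "\<And>p. 0 < s p" "\<And>p. 0 < e p"
    and \<rho>: "gram ({..<e (In 1)} \<times> {..<s (In 1)}) \<rho>" "(\<Sum>p\<in>{..<e (In 1)} \<times> {..<s (In 1)}. \<rho> p p) = 1"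
    and V: "\<And>j. j \<in> {1..<N} \<Longrightarrow> unitary_on ({..<e (Out j)} \<times> {..<s (Out j)})
       ({..<e (In (Suc j))} \<times> {..<s (In (Suc j))}) (V j)"
    and X: "\<And>j. j \<in> {1..<N} \<Longrightarrow> P d j (X j)"
    and fX: "\<And>j. j \<in> {1..<N} \<Longrightarrow> factors (X j) = {Env (Out j), Env (In j)}"
    and evX: "\<And>j r c. j \<in> {1..<N} \<Longrightarrow> bounded d r \<Longrightarrow> bounded d c \<Longrightarrow>
      ev (X j) r c = x j (r (Env (Out j)), r (Env (In j))) (c (Env (Out j)), c (Env (In j)))"
  shows "process N s (\<lambda>n. e (In n)) (circuit_step e V x) \<rho> \<in> circuits N s P"
proof -
  interpret circuit N s e d V x X \<rho>
    by unfold_locales (fact N pos fX evX[unfolded d_def] d_def)+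
  have "density d {Env (In 1), Sys (In 1)} R"
    using \<rho> by (simp add: density_op2 d_def)
  moreover have "unitary_choi d {Env (Out j), Sys (Out j)} {Env (In (j + 1)), Sys (In (j + 1))} (U j)"
    if "j \<in> {1..<N}" for j
    by (rule unitary_choiI) (use V[OF that] in \<open>simp_all add: d_def\<close>)
  ultimately show ?thesis
    using link_eq_process pos X unfolding circuits_def Let_def F_def
    by (intro CollectI exI[of _ e] exI[of _ U] exI[of _ X] exI[of _ R] conjI ballI) (simp_all add: d_def)
qed

text \<open>The last conclusion quantifies over \<open>x\<close> because the matrices of the
  \<open>X j\<close> become known only when \<open>Q\<close> is unfolded by the user of the
  rule.\<close>

lemma circuitsE:
  assumes C: "C \<in> circuits N s P" and N: "N \<ge> 2" and pos: "\<And>p. 0 < s p"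
    and P: "\<And>e j X. (\<And>p. 0 < e p) \<Longrightarrow> P (dims s e) j X \<Longrightarrow> Q e j X \<and> factors X = {Env (Out j), Env (In j)}"
  obtains e V X \<rho> where "\<And>p. 0 < e p" "\<And>j. j \<in> {1..<N} \<Longrightarrow> Q e j (X j)"
    "gram ({..<e (In 1)} \<times> {..<s (In 1)}) \<rho>" "(\<Sum>p\<in>{..<e (In 1)} \<times> {..<s (In 1)}. \<rho> p p) = 1"
    "\<And>j. j \<in> {1..<N} \<Longrightarrow> unitary_on ({..<e (Out j)} \<times> {..<s (Out j)})
       ({..<e (In (Suc j))} \<times> {..<s (In (Suc j))}) (V j)"
    "\<And>x. (\<And>j r c. j \<in> {1..<N} \<Longrightarrow> bounded (dims s e) r \<Longrightarrow> bounded (dims s e) c \<Longrightarrow>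
      ev (X j) r c = x j (r (Env (Out j)), r (Env (In j))) (c (Env (Out j)), c (Env (In j)))) \<Longrightarrow>
      C = process N s (\<lambda>n. e (In n)) (circuit_step e V x) \<rho>"
proof -
  obtain e U X R where *: "(\<forall>p. 0 < e p) \<and> density (dims s e) {Env (In 1), Sys (In 1)} R \<and>
     (\<forall>j\<in>{1..<N}. unitary_choi (dims s e) {Env (Out j), Sys (Out j)} {Env (In (j + 1)), Sys (In (j + 1))} (U j) \<and>
        P (dims s e) j (X j)) \<and>
     C = link (dims s e) (ident (dims s e) {Env (In N)})
           (link (dims s e) (big_link (dims s e) (\<lambda>j. link (dims s e) (U j) (X j)) (N - 1)) R)"
    using C unfolding circuits_def Let_def by blast
  then have e: "\<And>p. 0 < e p" and R: "density (dims s e) {Env (In 1), Sys (In 1)} R"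
    and U: "\<And>j. j \<in> {1..<N} \<Longrightarrow> unitary_choi (dims s e) {Env (Out j), Sys (Out j)} {Env (In (j + 1)), Sys (In (j + 1))} (U j)"
    and X: "\<And>j. j \<in> {1..<N} \<Longrightarrow> P (dims s e) j (X j)"
    and Ceq: "C = link (dims s e) (ident (dims s e) {Env (In N)})
           (link (dims s e) (big_link (dims s e) (\<lambda>j. link (dims s e) (U j) (X j)) (N - 1)) R)"
    by blast+
  have "psd (dims s e) {Env (In 1), Sys (In 1)} R" using R by (simp add: density_def)
  then obtain \<rho> where R': "R = op2 (dims s e) (Env (In 1)) (Sys (In 1)) \<rho>"
    using psd2E by (metis label.distinct(1))
  have "\<forall>j\<in>{1..<N}. \<exists>V. unitary_on ({..<e (Out j)} \<times> {..<s (Out j)}) ({..<e (In (Suc j))} \<times> {..<s (In (Suc j))}) V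
      \<and> U j = op_unitary (dims s e) (Env (Out j)) (Sys (Out j)) (Env (In (j + 1))) (Sys (In (j + 1))) V"
  proof
    fix j assume "j \<in> {1..<N}"
    from unitary_choiE[OF U[OF this]] obtain V where
      "unitary_on ({..<dims s e (Env (Out j))} \<times> {..<dims s e (Sys (Out j))})
         ({..<dims s e (Env (In (j + 1)))} \<times> {..<dims s e (Sys (In (j + 1)))}) V"
      "U j = op_unitary (dims s e) (Env (Out j)) (Sys (Out j)) (Env (In (j + 1))) (Sys (In (j + 1))) V"
      by auto
    then show "\<exists>V. unitary_on ({..<e (Out j)} \<times> {..<s (Out j)}) ({..<e (In (Suc j))} \<times> {..<s (In (Suc j))}) V
      \<and> U j = op_unitary (dims s e) (Env (Out j)) (Sys (Out j)) (Env (In (j + 1))) (Sys (In (j + 1))) V"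
      by (intro exI[of _ V]) simp
  qed
  then obtain V where V: "\<And>j. j \<in> {1..<N} \<Longrightarrow> unitary_on ({..<e (Out j)} \<times> {..<s (Out j)})
       ({..<e (In (Suc j))} \<times> {..<s (In (Suc j))}) (V j)"
    "\<And>j. j \<in> {1..<N} \<Longrightarrow> U j = op_unitary (dims s e) (Env (Out j)) (Sys (Out j)) (Env (In (j + 1))) (Sys (In (j + 1))) (V j)"
    by metis
  show ?thesis
  proof (rule that[of e X \<rho> V])
    show "gram ({..<e (In 1)} \<times> {..<s (In 1)}) \<rho>" "(\<Sum>p\<in>{..<e (In 1)} \<times> {..<s (In 1)}. \<rho> p p) = 1"
      using R unfolding R' by (simp_all add: density_op2)
    show "Q e j (X j)" if "j \<in> {1..<N}" for j using P[OF e X[OF that]] by blast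
    fix x assume evX: "\<And>j r c. j \<in> {1..<N} \<Longrightarrow> bounded (dims s e) r \<Longrightarrow> bounded (dims s e) c \<Longrightarrow>
      ev (X j) r c = x j (r (Env (Out j)), r (Env (In j))) (c (Env (Out j)), c (Env (In j)))"
    interpret circuit N s e "dims s e" V x X \<rho>
      by unfold_locales (use N pos e evX P[OF e X] in auto)
    \<comment> \<open>The given \<open>U j\<close> are known to agree with those of the locale only
      for \<open>1 \<le> j < N\<close>; \<open>big_link\<close> stops at
      \<open>N - 1\<close>.\<close>
    have "big_link (dims s e) (\<lambda>j. link (dims s e) (U j) (X j)) n = big_link (dims s e) F n" if "n < N" for n
      using that by (induction n) (simp_all add: V(2) F_def)
    then show "C = process N s (\<lambda>n. e (In n)) (circuit_step e V x) \<rho>"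
      using Ceq link_eq_process N by (simp add: R')
  qed (use e V in auto)
qed

definition eb_entry :: "nat \<Rightarrow> (nat \<Rightarrow> nat \<Rightarrow> nat \<Rightarrow> complex) \<Rightarrow> (nat \<Rightarrow> nat \<Rightarrow> nat \<Rightarrow> complex) \<Rightarrow>
    nat \<times> nat \<Rightarrow> nat \<times> nat \<Rightarrow> complex" where
  "eb_entry m \<sigma> F = (\<lambda>(\<alpha>, a) (\<beta>, b). \<Sum>x<m. \<sigma> x \<alpha> \<beta> * F x a b)"

definition eb_data :: "nat \<Rightarrow> nat \<Rightarrow> nat \<Rightarrow> (nat \<Rightarrow> nat \<Rightarrow> nat \<Rightarrow> complex) \<Rightarrow> (nat \<Rightarrow> nat \<Rightarrow> nat \<Rightarrow> complex) \<Rightarrow> bool" where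
  "eb_data eo ei m \<sigma> F \<longleftrightarrow>
     (\<forall>x<m. gram {..<eo} (\<sigma> x) \<and> (\<Sum>a<eo. \<sigma> x a a) = 1 \<and> gram {..<ei} (F x)) \<and>
     (\<forall>a<ei. \<forall>b<ei. (\<Sum>x<m. F x a b) = kdelta a b)"

definition eb_op :: "(label \<Rightarrow> nat) \<Rightarrow> nat \<Rightarrow> nat \<Rightarrow> (nat \<Rightarrow> nat \<Rightarrow> nat \<Rightarrow> complex) \<Rightarrow>
    (nat \<Rightarrow> nat \<Rightarrow> nat \<Rightarrow> complex) \<Rightarrow> label op" where
  "eb_op d j m \<sigma> F = sum_op d {Env (Out j), Env (In j)}
     (\<lambda>x. tensor d (op1 d (Env (Out j)) (\<sigma> x)) (op1 d (Env (In j)) (F x))) {..<m}"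

lemma factors_eb_op: "factors (eb_op d j m \<sigma> F) = {Env (Out j), Env (In j)}"
  by (simp add: eb_op_def)

lemma ev_eb_op: "bounded d r \<Longrightarrow> bounded d c \<Longrightarrow> ev (eb_op d j m \<sigma> F) r c =
    eb_entry m \<sigma> F (r (Env (Out j)), r (Env (In j))) (c (Env (Out j)), c (Env (In j)))"
  by (simp add: eb_op_def ev_sum_op insert_commute ev_tensor ev_op1 eb_entry_def)

lemma povm_op1:
  assumes "\<And>l. 0 < d l"
  shows "povm d {l} m (\<lambda>x. op1 d l (F x)) \<longleftrightarrow>
    (\<forall>x<m. gram {..<d l} (F x)) \<and> (\<forall>a<d l. \<forall>b<d l. (\<Sum>x<m. F x a b) = kdelta a b)"
proof -
  have "sum_op d {l} (\<lambda>x. op1 d l (F x)) {..<m} = op1 d l (\<lambda>a b. \<Sum>x<m. F x a b)"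
  proof (rule op_eqI[of _ d "{l}"])
    show "0 < d l" for l by (rule assms)
  qed (simp_all add: ev_sum_op ev_op1, simp_all add: sum_op_def op1_def)
  then show ?thesis unfolding povm_def by (simp add: psd_op1 ident_op1 op1_eq_iff)
qed

lemma sum_op_cong: "(\<And>x. x \<in> I \<Longrightarrow> f x = g x) \<Longrightarrow> sum_op d L f I = sum_op d L g I"
  unfolding sum_op_def by (intro mk_op_cong refl sum.cong) auto

lemma entanglement_breakingE:
  assumes "entanglement_breaking (dims s e) j X" "\<And>p. 0 < s p" "\<And>p. 0 < e p"
  shows "\<exists>m \<sigma> F. eb_data (e (Out j)) (e (In j)) m \<sigma> F \<and> X = eb_op (dims s e) j m \<sigma> F"
proof -
  let ?d = "dims s e"
  obtain m \<sigma> F where *: "\<And>x. x < m \<Longrightarrow> density ?d {Env (Out j)} (\<sigma> x)" "povm ?d {Env (In j)} m F"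
    "X = sum_op ?d {Env (Out j), Env (In j)} (\<lambda>x. tensor ?d (\<sigma> x) (F x)) {..<m}"
    using assms(1) unfolding entanglement_breaking_def by blast
  have "\<forall>x<m. \<exists>f. \<sigma> x = op1 ?d (Env (Out j)) f" using *(1) psd1E unfolding density_def by metis
  then obtain \<sigma>' where \<sigma>': "\<And>x. x < m \<Longrightarrow> \<sigma> x = op1 ?d (Env (Out j)) (\<sigma>' x)" by metis
  have "\<forall>x<m. \<exists>f. F x = op1 ?d (Env (In j)) f" using *(2) psd1E unfolding povm_def by metis
  then obtain F' where F': "\<And>x. x < m \<Longrightarrow> F x = op1 ?d (Env (In j)) (F' x)" by metis
  have pos: "0 < ?d l" for l by (rule dims_pos[OF assms(2,3)])
  have "povm ?d {Env (In j)} m (\<lambda>x. op1 ?d (Env (In j)) (F' x))"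
    using *(2) F' sum_op_cong[of "{..<m}" F "\<lambda>x. op1 ?d (Env (In j)) (F' x)" ?d "{Env (In j)}"]
    unfolding povm_def by simp
  then have "eb_data (e (Out j)) (e (In j)) m \<sigma>' F'"
    unfolding eb_data_def using *(1) \<sigma>' povm_op1[of ?d "Env (In j)" m F', OF pos] by (simp add: density_op1)
  moreover have "X = eb_op ?d j m \<sigma>' F'"
    unfolding *(3) eb_op_def by (rule sum_op_cong) (simp add: \<sigma>' F')
  ultimately show ?thesis by blast
qed

lemma entanglement_breakingI:
  assumes "eb_data (e (Out j)) (e (In j)) m \<sigma> F" "\<And>p. 0 < s p" "\<And>p. 0 < e p"
  shows "entanglement_breaking (dims s e) j (eb_op (dims s e) j m \<sigma> F)"
proof -
  have pos: "0 < dims s e l" for l by (rule dims_pos[OF assms(2,3)])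
  have "povm (dims s e) {Env (In j)} m (\<lambda>x. op1 (dims s e) (Env (In j)) (F x))"
    using assms(1) povm_op1[of "dims s e" "Env (In j)" m F, OF pos] by (simp add: eb_data_def)
  moreover have "\<forall>x<m. density (dims s e) {Env (Out j)} (op1 (dims s e) (Env (Out j)) (\<sigma> x))"
    using assms(1) by (simp add: eb_data_def density_op1)
  ultimately show ?thesis unfolding entanglement_breaking_def eb_op_def
    by (intro exI[of _ m] exI[of _ "\<lambda>x. op1 (dims s e) (Env (Out j)) (\<sigma> x)"]
        exI[of _ "\<lambda>x. op1 (dims s e) (Env (In j)) (F x)"]) simp
qed

text \<open>Trace-and-prepare is entanglement breaking with a single outcome whose effect is the
  identity, so \<open>M\<close> shares the normal form of \<open>CM\<close>.\<close>

lemma trace_and_prepareE: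
  assumes "trace_and_prepare (dims s e) j X" "\<And>p. 0 < s p" "\<And>p. 0 < e p"
  shows "\<exists>\<sigma>. eb_data (e (Out j)) (e (In j)) 1 \<sigma> (\<lambda>_. kdelta) \<and> X = eb_op (dims s e) j 1 \<sigma> (\<lambda>_. kdelta)"
proof -
  let ?d = "dims s e"
  obtain \<sigma> where *: "density ?d {Env (Out j)} \<sigma>" "X = tensor ?d \<sigma> (ident ?d {Env (In j)})"
    using assms(1) unfolding trace_and_prepare_def by blast
  obtain f where f: "\<sigma> = op1 ?d (Env (Out j)) f" using *(1) psd1E unfolding density_def by metis
  have "eb_data (e (Out j)) (e (In j)) 1 (\<lambda>_. f) (\<lambda>_. kdelta)"
    using *(1) unfolding f eb_data_def by (simp add: density_op1 gram_kdelta)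
  moreover have "X = eb_op ?d j 1 (\<lambda>_. f) (\<lambda>_. kdelta)"
  proof (rule op_eqI[of _ ?d "{Env (Out j), Env (In j)}"])
    show "0 < ?d l" for l by (rule dims_pos[OF assms(2,3)])
    show "X \<in> opers ?d {Env (Out j), Env (In j)}" unfolding *(2) f
      using mk_op_opers by (simp add: tensor_def) (simp add: insert_commute)
  qed (simp_all add: ev_eb_op *(2) f ev_tensor ev_op1 ident_op1 eb_entry_def, simp add: eb_op_def sum_op_def)
  ultimately show ?thesis by blast
qed

text \<open>The effect \<open>F j x\<close> acts on the old memory, and \<open>Q j x\<close> is the
  Choi operator of all that follows outcome \<open>x\<close> within the step. The two sides are
  connected only through the number \<open>x\<close>.\<close>

definition eb_step :: "(nat \<Rightarrow> nat) \<Rightarrow> (nat \<Rightarrow> nat \<Rightarrow> nat \<Rightarrow> nat \<Rightarrow> complex) \<Rightarrow>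
    (nat \<Rightarrow> nat \<Rightarrow> nat \<times> nat \<times> nat \<Rightarrow> nat \<times> nat \<times> nat \<Rightarrow> complex) \<Rightarrow> nat \<Rightarrow> step" where
  "eb_step m F Q j = (\<lambda>(a, z) (b, w). \<Sum>x<m j. F j x a b * Q j x z w)"

text \<open>Normal form for classical memory: of the preparations and unitaries it keeps only that
  each \<open>Q j x\<close> is a channel.\<close>

definition cm_data :: "nat \<Rightarrow> (port \<Rightarrow> nat) \<Rightarrow> (nat \<Rightarrow> nat) \<Rightarrow> (nat \<Rightarrow> nat) \<Rightarrow>
    (nat \<Rightarrow> nat \<Rightarrow> nat \<Rightarrow> nat \<Rightarrow> complex) \<Rightarrow> (nat \<Rightarrow> nat \<Rightarrow> nat \<times> nat \<times> nat \<Rightarrow> nat \<times> nat \<times> nat \<Rightarrow> complex) \<Rightarrow>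
    (nat \<times> nat \<Rightarrow> nat \<times> nat \<Rightarrow> complex) \<Rightarrow> bool" where
  "cm_data N s k m F Q \<rho> \<longleftrightarrow> (\<forall>n. 0 < k n) \<and>
     gram ({..<k 1} \<times> {..<s (In 1)}) \<rho> \<and> (\<Sum>p\<in>{..<k 1} \<times> {..<s (In 1)}. \<rho> p p) = 1 \<and>
     (\<forall>j\<in>{1..<N}. (\<forall>a<k j. \<forall>b<k j. (\<Sum>x<m j. F j x a b) = kdelta a b) \<and>
        (\<forall>x<m j. gram {..<k j} (F j x) \<and>
           gram ({..<s (Out j)} \<times> {..<k (Suc j)} \<times> {..<s (In (Suc j))}) (Q j x) \<and>
           (\<forall>p<s (Out j). \<forall>q<s (Out j).
              (\<Sum>z\<in>{..<k (Suc j)} \<times> {..<s (In (Suc j))}. Q j x (p, z) (q, z)) = kdelta p q)))"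

text \<open>Choi operator of the channel that adjoins the environment state \<open>\<sigma>\<close>
  to a system output and applies \<open>V\<close>.\<close>

definition prepare_apply :: "nat \<Rightarrow> (nat \<Rightarrow> nat \<Rightarrow> complex) \<Rightarrow> (nat \<times> nat \<Rightarrow> nat \<times> nat \<Rightarrow> complex) \<Rightarrow>
    nat \<times> nat \<times> nat \<Rightarrow> nat \<times> nat \<times> nat \<Rightarrow> complex" where
  "prepare_apply eo \<sigma> V = (\<lambda>(p, z) (q, w). \<Sum>\<alpha><eo. \<Sum>\<beta><eo. \<sigma> \<alpha> \<beta> * (V z (\<alpha>, p) * cnj (V w (\<beta>, q))))"

lemma gram_prepare_apply: "gram {..<eo} \<sigma> \<Longrightarrow> gram I (prepare_apply eo \<sigma> V)"
proof -
  assume \<sigma>: "gram {..<eo} \<sigma>"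
  have "gram ({..<eo} \<times> I) (\<lambda>r c. (case r of (\<alpha>, p, z) \<Rightarrow> V z (\<alpha>, p)) * cnj (case c of (\<alpha>, p, z) \<Rightarrow> V z (\<alpha>, p)))"
    by (rule gram_rank1)
  from gram_contract[OF _ \<sigma> this] show ?thesis
    by (simp add: prepare_apply_def split_def)
qed

lemma prepare_apply_trace:
  assumes "orthonormal_cols ({..<eo} \<times> {..<so}) B V" "(\<Sum>a<eo. \<sigma> a a) = 1" "p < so" "q < so"
  shows "(\<Sum>z\<in>B. prepare_apply eo \<sigma> V (p, z) (q, z)) = kdelta p q"
proof -
  have V: "(\<Sum>z\<in>B. V z (\<alpha>, p) * cnj (V z (\<beta>, q))) = kdelta \<alpha> \<beta> * kdelta p q" if "\<alpha> < eo" "\<beta> < eo" for \<alpha> \<beta>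
  proof -
    have "(\<Sum>z\<in>B. cnj (V z (\<beta>, q)) * V z (\<alpha>, p)) = kdelta (\<beta>, q) (\<alpha>, p)"
      using assms(1,3,4) that unfolding orthonormal_cols_def by auto
    then show ?thesis by (simp add: mult.commute kdelta_def)
  qed
  have "(\<Sum>z\<in>B. prepare_apply eo \<sigma> V (p, z) (q, z))
    = (\<Sum>\<alpha><eo. \<Sum>\<beta><eo. \<sigma> \<alpha> \<beta> * (\<Sum>z\<in>B. V z (\<alpha>, p) * cnj (V z (\<beta>, q))))"
    unfolding prepare_apply_def prod.case sum_distrib_left
    by (subst sum.swap, intro sum.cong refl, subst sum.swap, rule refl)
  also have "\<dots> = (\<Sum>\<alpha><eo. \<Sum>\<beta><eo. kdelta \<alpha> \<beta> * (\<sigma> \<alpha> \<beta> * kdelta p q))"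
    by (intro sum.cong refl) (simp add: V)
  also have "\<dots> = (\<Sum>\<alpha><eo. \<sigma> \<alpha> \<alpha>) * kdelta p q" by (simp add: sum_distrib_right)
  finally show ?thesis using assms(2) by simp
qed

lemma circuit_step_eb:
  assumes "x j = eb_entry (m j) (\<sigma> j) (F j)"
  shows "circuit_step e V x j = eb_step m F (\<lambda>j y. prepare_apply (e (Out j)) (\<sigma> j y) (V j)) j"
proof (intro ext, clarify)
  fix a p a' i b q b' l
  have "circuit_step e V x j (a, p, a', i) (b, q, b', l) = (\<Sum>\<alpha><e (Out j). \<Sum>\<beta><e (Out j). \<Sum>y<m j.
     F j y a b * (\<sigma> j y \<alpha> \<beta> * (V j (a', i) (\<alpha>, p) * cnj (V j (b', l) (\<beta>, q)))))"
    by (simp add: circuit_step_def assms eb_entry_def sum_distrib_left mult_ac)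
  also have "\<dots> = (\<Sum>y<m j. \<Sum>\<alpha><e (Out j). \<Sum>\<beta><e (Out j).
     F j y a b * (\<sigma> j y \<alpha> \<beta> * (V j (a', i) (\<alpha>, p) * cnj (V j (b', l) (\<beta>, q)))))"
    by (subst sum.swap[of _ _ "{..<m j}"]) (intro sum.cong refl sum.swap)
  finally show "circuit_step e V x j (a, p, a', i) (b, q, b', l)
    = eb_step m F (\<lambda>j y. prepare_apply (e (Out j)) (\<sigma> j y) (V j)) j (a, p, a', i) (b, q, b', l)"
    by (simp add: eb_step_def prepare_apply_def sum_distrib_left)
qed

lemma cm_data_circuit:
  assumes "\<And>p. 0 < e p" "\<And>j. j \<in> {1..<N} \<Longrightarrow> eb_data (e (Out j)) (e (In j)) (m j) (\<sigma> j) (F j)"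
    "gram ({..<e (In 1)} \<times> {..<s (In 1)}) \<rho>" "(\<Sum>p\<in>{..<e (In 1)} \<times> {..<s (In 1)}. \<rho> p p) = 1"
    "\<And>j. j \<in> {1..<N} \<Longrightarrow> unitary_on ({..<e (Out j)} \<times> {..<s (Out j)})
       ({..<e (In (Suc j))} \<times> {..<s (In (Suc j))}) (V j)"
  shows "cm_data N s (\<lambda>n. e (In n)) m F (\<lambda>j y. prepare_apply (e (Out j)) (\<sigma> j y) (V j)) \<rho>"
  unfolding cm_data_def
proof (intro conjI ballI allI impI)
  fix j x p q assume j: "j \<in> {1..<N}" and x: "x < m j" "p < s (Out j)" "q < s (Out j)"
  show "(\<Sum>z\<in>{..<e (In (Suc j))} \<times> {..<s (In (Suc j))}. prepare_apply (e (Out j)) (\<sigma> j x) (V j) (p, z) (q, z)) = kdelta p q"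
    by (rule prepare_apply_trace[of _ "s (Out j)"])
       (use assms(5)[OF j] assms(2)[OF j] x in \<open>auto simp: unitary_on_def eb_data_def\<close>)
qed (use assms gram_prepare_apply in \<open>auto simp: eb_data_def\<close>)

text \<open>\<open>\<Phi>\<close> carries what is known about the measurements beyond
  \<open>eb_data\<close>: nothing for \<open>CM\<close>, a single trivial outcome for
  \<open>M\<close>.\<close>

lemma eb_circuit_cases:
  assumes "C \<in> circuits N s P" "N \<ge> 2" "\<And>p. 0 < s p"
    and P: "\<And>e j X. (\<And>p. 0 < e p) \<Longrightarrow> P (dims s e) j X \<Longrightarrow>
      \<exists>m \<sigma> F. \<Phi> m F \<and> eb_data (e (Out j)) (e (In j)) m \<sigma> F \<and> X = eb_op (dims s e) j m \<sigma> F"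
  obtains k m F Q \<rho> where "cm_data N s k m F Q \<rho>" "C = process N s k (eb_step m F Q) \<rho>"
    "\<forall>j\<in>{1..<N}. \<Phi> (m j) (F j)"
proof -
  have P': "(\<exists>m \<sigma> F. \<Phi> m F \<and> eb_data (e (Out j)) (e (In j)) m \<sigma> F \<and> X = eb_op (dims s e) j m \<sigma> F) \<and> factors X = {Env (Out j), Env (In j)}"
    if "\<And>p. 0 < e p" "P (dims s e) j X" for e j X
    using P[OF that] factors_eb_op by blast
  show ?thesis
  proof (rule circuitsE[OF assms(1-3) P'])
    fix e V X \<rho>
    assume e: "\<And>p. 0 < e p"
    and X: "\<And>j. j \<in> {1..<N} \<Longrightarrow> \<exists>m \<sigma> F. \<Phi> m F \<and> eb_data (e (Out j)) (e (In j)) m \<sigma> F \<and> X j = eb_op (dims s e) j m \<sigma> F"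
    and \<rho>: "gram ({..<e (In 1)} \<times> {..<s (In 1)}) \<rho>" "(\<Sum>p\<in>{..<e (In 1)} \<times> {..<s (In 1)}. \<rho> p p) = 1"
    and V: "\<And>j. j \<in> {1..<N} \<Longrightarrow> unitary_on ({..<e (Out j)} \<times> {..<s (Out j)})
       ({..<e (In (Suc j))} \<times> {..<s (In (Suc j))}) (V j)"
    and C: "\<And>x. (\<And>j r c. j \<in> {1..<N} \<Longrightarrow> bounded (dims s e) r \<Longrightarrow> bounded (dims s e) c \<Longrightarrow>
      ev (X j) r c = x j (r (Env (Out j)), r (Env (In j))) (c (Env (Out j)), c (Env (In j)))) \<Longrightarrow>
      C = process N s (\<lambda>n. e (In n)) (circuit_step e V x) \<rho>"
  obtain m \<sigma> F where m: "\<And>j. j \<in> {1..<N} \<Longrightarrow> eb_data (e (Out j)) (e (In j)) (m j) (\<sigma> j) (F j)"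
    "\<And>j. j \<in> {1..<N} \<Longrightarrow> X j = eb_op (dims s e) j (m j) (\<sigma> j) (F j)"
    "\<And>j. j \<in> {1..<N} \<Longrightarrow> \<Phi> (m j) (F j)"
    using X by metis
  let ?Q = "\<lambda>j y. prepare_apply (e (Out j)) (\<sigma> j y) (V j)"
  have "C = process N s (\<lambda>n. e (In n)) (circuit_step e V (\<lambda>j. eb_entry (m j) (\<sigma> j) (F j))) \<rho>"
    by (rule C) (simp add: m(2) ev_eb_op)
  also have "circuit_step e V (\<lambda>j. eb_entry (m j) (\<sigma> j) (F j)) = eb_step m F ?Q"
    by (rule ext) (rule circuit_step_eb, rule refl)
  finally show ?thesis using that cm_data_circuit[OF e m(1) \<rho> V] m(3) by blast
  qed
qed

lemma CM_cases:
  assumes "C \<in> CM N s" "N \<ge> 2" "\<And>p. 0 < s p"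
  obtains k m F Q \<rho> where "cm_data N s k m F Q \<rho>" "C = process N s k (eb_step m F Q) \<rho>"
proof (rule eb_circuit_cases[OF assms(1)[unfolded CM_def] assms(2,3), where \<Phi> = "\<lambda>_ _. True"])
  show "\<exists>m \<sigma> F. True \<and> eb_data (e (Out j)) (e (In j)) m \<sigma> F \<and> X = eb_op (dims s e) j m \<sigma> F"
    if "\<And>p. 0 < e p" "entanglement_breaking (dims s e) j X" for e j X
    using entanglement_breakingE[OF that(2) assms(3) that(1)] by blast
qed (rule that)

lemma M_cases:
  assumes "C \<in> M N s" "N \<ge> 2" "\<And>p. 0 < s p"
  obtains k m F Q \<rho> where "cm_data N s k m F Q \<rho>" "C = process N s k (eb_step m F Q) \<rho>"
    "\<forall>j\<in>{1..<N}. m j = 1 \<and> F j = (\<lambda>_. kdelta)"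
proof (rule eb_circuit_cases[OF assms(1)[unfolded M_def] assms(2,3), where \<Phi> = "\<lambda>m F. m = 1 \<and> F = (\<lambda>_. kdelta)"])
  show "\<exists>m \<sigma> F. (m = 1 \<and> F = (\<lambda>_. kdelta)) \<and> eb_data (e (Out j)) (e (In j)) m \<sigma> F \<and> X = eb_op (dims s e) j m \<sigma> F"
    if "\<And>p. 0 < e p" "trace_and_prepare (dims s e) j X" for e j X
    using trace_and_prepareE[OF that(2) assms(3) that(1)] by blast
qed (rule that)

section \<open>Dilation of sequences of channels\<close>


text \<open>Digit expansion \<open>z = a + k * v\<close>: it separates the memory \<open>a\<close>
  from the Kraus record \<open>v\<close> stored in the same environment index.\<close>

lemma sum_lessThan_mult:
  fixes f :: "nat \<Rightarrow> 'a::comm_monoid_add"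
  shows "(\<Sum>z<k * m. f z) = (\<Sum>a<k. \<Sum>v<m. f (a + k * v))"
proof -
  have "(\<Sum>z<k * m. f z) = (\<Sum>v<m. \<Sum>a<k. f (a + k * v))"
  proof (induction m)
    case (Suc m)
    have "(\<Sum>z<k * Suc m. f z) = (\<Sum>z<k * m. f z) + (\<Sum>z\<in>{k * m..<k * m + k}. f z)"
      by (subst sum.union_disjoint[symmetric]) (auto intro!: sum.cong)
    also have "(\<Sum>z\<in>{k * m..<k * m + k}. f z) = (\<Sum>a<k. f (a + k * m))"
      using sum.shift_bounds_nat_ivl[of f 0 "k * m" k] by (simp add: lessThan_atLeast0 add.commute)
    finally show ?case using Suc by simp
  qed simp
  then show ?thesis by (simp add: sum.swap[of _ "{..<m}"])
qed

definition valid_step :: "nat \<Rightarrow> nat \<Rightarrow> nat \<Rightarrow> nat \<Rightarrow> step \<Rightarrow> bool" where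
  "valid_step k so k' si G \<longleftrightarrow> gram ({..<k} \<times> {..<so} \<times> {..<k'} \<times> {..<si}) G \<and>
     (\<forall>a<k. \<forall>b<k. \<forall>p<so. \<forall>q<so.
        (\<Sum>z\<in>{..<k'} \<times> {..<si}. G (a, p, z) (b, q, z)) = kdelta (a, p) (b, q))"

text \<open>\<open>W y\<close> is the matrix of the \<open>y\<close>th Kraus operator from
  \<open>(a, p)\<close> to \<open>(a', i)\<close>, written with one tuple index. The second
  condition says that the stacked Kraus operators form an isometry.\<close>

definition kraus :: "nat \<Rightarrow> nat \<Rightarrow> nat \<Rightarrow> nat \<Rightarrow> step \<Rightarrow> nat \<Rightarrow> (nat \<Rightarrow> nat \<times> nat \<times> nat \<times> nat \<Rightarrow> complex) \<Rightarrow> bool" where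
  "kraus k so k' si G Y W \<longleftrightarrow>
     (\<forall>r\<in>{..<k} \<times> {..<so} \<times> {..<k'} \<times> {..<si}. \<forall>c\<in>{..<k} \<times> {..<so} \<times> {..<k'} \<times> {..<si}.
        G r c = (\<Sum>y<Y. W y r * cnj (W y c))) \<and>
     (\<forall>a<k. \<forall>b<k. \<forall>p<so. \<forall>q<so.
        (\<Sum>y<Y. \<Sum>a'<k'. \<Sum>i<si. cnj (W y (a, p, a', i)) * W y (b, q, a', i)) = kdelta (a, p) (b, q))"

text \<open>The Gram vectors of the Choi operator are the Kraus operators; the trace condition
  becomes the isometry condition with the two inputs exchanged.\<close>

lemma valid_step_kraus:
  assumes "valid_step k so k' si G"
  shows "\<exists>Y W. kraus k so k' si G Y W"
proof -
  obtain Y W where W: "\<And>r c. r \<in> {..<k} \<times> {..<so} \<times> {..<k'} \<times> {..<si} \<Longrightarrow> c \<in> {..<k} \<times> {..<so} \<times> {..<k'} \<times> {..<si} \<Longrightarrow>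
       G r c = (\<Sum>y<(Y::nat). W y r * cnj (W y c))"
    using assms unfolding valid_step_def gram_def by blast
  have "(\<Sum>y<Y. \<Sum>a'<k'. \<Sum>i<si. cnj (W y (a, p, a', i)) * W y (b, q, a', i)) = kdelta (a, p) (b, q)"
    if "a < k" "b < k" "p < so" "q < so" for a b p q
  proof -
    have "(\<Sum>y<Y. \<Sum>a'<k'. \<Sum>i<si. cnj (W y (a, p, a', i)) * W y (b, q, a', i))
      = (\<Sum>a'<k'. \<Sum>i<si. \<Sum>y<Y. W y (b, q, a', i) * cnj (W y (a, p, a', i)))"
      by (subst sum.swap, rule sum.cong[OF refl], subst sum.swap) (simp add: mult.commute)
    also have "\<dots> = (\<Sum>a'<k'. \<Sum>i<si. G (b, q, a', i) (a, p, a', i))"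
      by (intro sum.cong refl, subst W) (use that in auto)
    also have "\<dots> = kdelta (b, q) (a, p)"
      using assms that unfolding valid_step_def by (simp add: sum.cartesian_product split_def)
    finally show ?thesis by (simp add: kdelta_commute)
  qed
  then have "kraus k so k' si G Y W" using W unfolding kraus_def by simp
  then show ?thesis by blast
qed

definition valid_data :: "nat \<Rightarrow> (port \<Rightarrow> nat) \<Rightarrow> (nat \<Rightarrow> nat) \<Rightarrow> (nat \<Rightarrow> step) \<Rightarrow>
    (nat \<times> nat \<Rightarrow> nat \<times> nat \<Rightarrow> complex) \<Rightarrow> bool" where
  "valid_data N s k G \<rho> \<longleftrightarrow> (\<forall>n. 0 < k n) \<and>
     gram ({..<k 1} \<times> {..<s (In 1)}) \<rho> \<and> (\<Sum>p\<in>{..<k 1} \<times> {..<s (In 1)}. \<rho> p p) = 1 \<and>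
     (\<forall>j\<in>{1..<N}. valid_step (k j) (s (Out j)) (k (Suc j)) (s (In (Suc j))) (G j))"

lemma process_eqI:
  assumes "\<And>p. 0 < s p" "\<And>r c. r \<in> sys_idx N s \<Longrightarrow> c \<in> sys_idx N s \<Longrightarrow>
    (\<Sum>a<k N. run k G \<rho> r c (N - 1) a a) = (\<Sum>a<k' N. run k' G' \<rho>' r c (N - 1) a a)"
  shows "process N s k G \<rho> = process N s k' G' \<rho>'"
  unfolding process_def using assms by (rule sys_op_cong)

lemma sys_idx_less: "r \<in> sys_idx N s \<Longrightarrow> r p < s p"
  by (simp add: sys_idx_def)

text \<open>The identity channel collapses the sums in \<open>circuit_step\<close>. It also forces
  one common dimension for \<open>In j\<close> and \<open>Out j\<close>, here
  \<open>E j\<close>.\<close>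

lemma QM_unitary:
  assumes N: "N \<ge> 2" and s: "\<And>p. 0 < s p" and E: "\<And>n. 0 < E n"
    and \<rho>: "gram ({..<E 1} \<times> {..<s (In 1)}) \<rho>" "(\<Sum>p\<in>{..<E 1} \<times> {..<s (In 1)}. \<rho> p p) = 1"
    and V: "\<And>j. j \<in> {1..<N} \<Longrightarrow> unitary_on ({..<E j} \<times> {..<s (Out j)}) ({..<E (Suc j)} \<times> {..<s (In (Suc j))}) (V j)"
  shows "process N s E (\<lambda>j (a, p, z) (b, q, w). V j z (a, p) * cnj (V j w (b, q))) \<rho> \<in> QM N s"
proof -
  define e where "e = (\<lambda>p. case p of In n \<Rightarrow> E n | Out n \<Rightarrow> E n)"
  have e: "0 < e p" for p using E by (cases p) (auto simp: e_def)
  let ?d = "dims s e"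
  define X where "X = (\<lambda>j. choi ?d {Env (In j)} {Env (Out j)} (relabel ?d (Env (In j)) (Env (Out j))))"
  define x :: "nat \<Rightarrow> nat \<times> nat \<Rightarrow> nat \<times> nat \<Rightarrow> complex"
    where "x = (\<lambda>j (\<alpha>, a) (\<beta>, b). kdelta \<alpha> a * kdelta \<beta> b)"
  have "process N s (\<lambda>n. e (In n)) (circuit_step e V x) \<rho> \<in> circuits N s identity_choi"
  proof (rule circuitsI[OF N s e, where X = X])
    show "factors (X j) = {Env (Out j), Env (In j)}" for j by (simp add: X_def choi_def insert_commute)
    show "identity_choi ?d j (X j)" for j by (simp add: identity_choi_def X_def e_def)
    fix j and r c :: "label \<Rightarrow> nat" assume b: "bounded ?d r" "bounded ?d c"
    let ?E = "Env (In j)" and ?O = "Env (Out j)"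
    have "r l < ?d l" "c l < ?d l" for l using b by (simp_all add: bounded_def)
    from this[of ?E] this[of ?O]
    have lt: "r ?E < e (In j)" "c ?E < e (In j)" "r ?O < e (In j)" "c ?O < e (In j)"
      by (simp_all add: e_def)
    have i1: "restrict f {l} = pt1 l (f l)" for f :: "label \<Rightarrow> nat" and l
      by (auto simp: pt1_def fun_eq_iff)
    have inj: "pt1 l a = pt1 l b \<longleftrightarrow> a = b" for l :: label and a b by (metis pt1_apply)
    have dE: "?d ?E = e (In j)" "?d ?O = e (In j)" by (simp_all add: e_def)
    have "ev (X j) r c = entry (relabel ?d ?E ?O (mat_unit ?d {?E} (restrict r {?E}) (restrict c {?E})))
        (restrict r {?O}) (restrict c {?O})"
      unfolding X_def choi_def using b by (simp only: ev_mk_op) simp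
    also have "\<dots> = (if r ?O = r ?E \<and> c ?O = c ?E then 1 else 0)"
      by (simp only: relabel_def mat_unit_def entry_mk_op i1 pt1_idx pt1_apply inj lt dE)
    also have "\<dots> = x j (r ?O, r ?E) (c ?O, c ?E)"
      by (simp add: x_def kdelta_def)
    finally show "ev (X j) r c = x j (r ?O, r ?E) (c ?O, c ?E)" .
  qed (use \<rho> V in \<open>simp_all add: e_def\<close>)
  then have "process N s E (circuit_step e V x) \<rho> \<in> QM N s" by (simp add: QM_def e_def)
  moreover have eq: "run E (circuit_step e V x) \<rho> r c n = run E (\<lambda>j (a, p, z) (b, q, w). V j z (a, p) * cnj (V j w (b, q))) \<rho> r c n" for r c n
  proof (induction n)
    case (Suc n)
    have "circuit_step e V x j (a, p, z) (b, q, w) = V j z (a, p) * cnj (V j w (b, q))"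
      if "a < E j" "b < E j" for j a b p q z w
    proof -
      have "circuit_step e V x j (a, p, z) (b, q, w) =
        (\<Sum>\<alpha><E j. \<Sum>\<beta><E j. kdelta \<alpha> a * (kdelta \<beta> b * (V j z (\<alpha>, p) * cnj (V j w (\<beta>, q)))))"
        by (cases z; cases w) (simp add: circuit_step_def x_def e_def mult_ac)
      then show ?thesis using that by (simp flip: sum_distrib_left)
    qed
    then show ?case by (simp add: Suc fun_eq_iff)
  qed simp
  ultimately show ?thesis unfolding process_def eq by simp
qed

lemma CM_unitary:
  fixes s e :: "port \<Rightarrow> nat"
  assumes "N \<ge> 2" "\<And>p. 0 < s p" "\<And>p. 0 < e p"
    and "gram ({..<e (In 1)} \<times> {..<s (In 1)}) \<rho>" "(\<Sum>p\<in>{..<e (In 1)} \<times> {..<s (In 1)}. \<rho> p p) = 1"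
    and "\<And>j. j \<in> {1..<N} \<Longrightarrow> unitary_on ({..<e (Out j)} \<times> {..<s (Out j)}) ({..<e (In (Suc j))} \<times> {..<s (In (Suc j))}) (V j)"
    and eb: "\<And>j. j \<in> {1..<N} \<Longrightarrow> eb_data (e (Out j)) (e (In j)) (m j) (\<sigma> j) (F j)"
  shows "process N s (\<lambda>n. e (In n)) (eb_step m F (\<lambda>j y. prepare_apply (e (Out j)) (\<sigma> j y) (V j))) \<rho> \<in> CM N s"
proof -
  have "process N s (\<lambda>n. e (In n)) (circuit_step e V (\<lambda>j. eb_entry (m j) (\<sigma> j) (F j))) \<rho> \<in> circuits N s entanglement_breaking"
    by (rule circuitsI[where X = "\<lambda>j. eb_op (dims s e) j (m j) (\<sigma> j) (F j)"])
       (use assms in \<open>simp_all add: factors_eb_op ev_eb_op entanglement_breakingI\<close>)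
  moreover have "circuit_step e V (\<lambda>j. eb_entry (m j) (\<sigma> j) (F j)) = eb_step m F (\<lambda>j y. prepare_apply (e (Out j)) (\<sigma> j y) (V j))"
    by (rule ext) (rule circuit_step_eb, rule refl)
  ultimately show ?thesis by (simp add: CM_def)
qed

text \<open>Stinespring dilation: the Kraus index of each step is stored in the environment, where it stays
  until it is traced out at the end. The environment index \<open>a + k n * v\<close> encodes the memory \<open>a\<close> and
  the stored Kraus indices \<open>v\<close>; the isometries are extended to unitaries on a large environment.\<close>

theorem valid_process_QM:
  assumes N: "N \<ge> 2" and s: "\<And>p. 0 < s p" and data: "valid_data N s k G \<rho>"
  shows "process N s k G \<rho> \<in> QM N s"
proof -
  have k: "0 < k n" for n using data by (simp add: valid_data_def)
  have "\<forall>j\<in>{1..<N}. \<exists>Y W. kraus (k j) (s (Out j)) (k (Suc j)) (s (In (Suc j))) (G j) Y W"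
    using data valid_step_kraus by (simp add: valid_data_def)
  then obtain Y W where YW: "\<And>j. j \<in> {1..<N} \<Longrightarrow> kraus (k j) (s (Out j)) (k (Suc j)) (s (In (Suc j))) (G j) (Y j) (W j)"
    by metis
  have W: "G j r c = (\<Sum>y<Y j. W j y r * cnj (W j y c))"
    if "j \<in> {1..<N}" "r \<in> {..<k j} \<times> {..<s (Out j)} \<times> {..<k (Suc j)} \<times> {..<s (In (Suc j))}"
       "c \<in> {..<k j} \<times> {..<s (Out j)} \<times> {..<k (Suc j)} \<times> {..<s (In (Suc j))}" for j r c
    using YW[OF that(1)] that(2,3) unfolding kraus_def by blast
  have iso: "(\<Sum>y<Y j. \<Sum>a'<k (Suc j). \<Sum>i<s (In (Suc j)). cnj (W j y (a, p, a', i)) * W j y (b, q, a', i)) = kdelta (a, p) (b, q)"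
    if "j \<in> {1..<N}" "a < k j" "b < k j" "p < s (Out j)" "q < s (Out j)" for j a b p q
    using YW[OF that(1)] that(2-) unfolding kraus_def by blast
  \<comment> \<open>Number of Kraus records that can have accumulated before step
    \<open>n\<close>.\<close>
  define w where "w = (\<lambda>n. \<Prod>i\<in>{1..<n}. Y i)"
  have w1: "w (Suc 0) = 1" by (simp add: w_def)
  have wS: "w (Suc j) = Y j * w j" if "j \<ge> 1" for j
    using that by (simp add: w_def atLeastLessThanSuc mult.commute)
  define D where "D = Suc (\<Sum>j\<in>{1..N}. k j * w j)"
  \<comment> \<open>This solves \<open>E j * s (Out j) = E (Suc j) * s (In (Suc j))\<close>: step
    \<open>j\<close> absorbs one output factor and releases one input factor. The factor
    \<open>D\<close> leaves room for memory and record at every time.\<close>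
  define E where "E = (\<lambda>n. D * (\<Prod>i\<in>{1..<n}. s (Out i)) * (\<Prod>i\<in>{Suc n..N}. s (In i)))"
  have Epos: "0 < E n" for n using s by (simp add: E_def D_def prod_pos)
  have Eeq: "E j * s (Out j) = E (Suc j) * s (In (Suc j))" if "j \<in> {1..<N}" for j
  proof -
    have "(\<Prod>i\<in>{1..<Suc j}. s (Out i)) = (\<Prod>i\<in>{1..<j}. s (Out i)) * s (Out j)"
      using that by (simp add: atLeastLessThanSuc mult.commute)
    moreover have "{Suc j..N} = insert (Suc j) {Suc (Suc j)..N}" using that by auto
    then have "(\<Prod>i\<in>{Suc j..N}. s (In i)) = s (In (Suc j)) * (\<Prod>i\<in>{Suc (Suc j)..N}. s (In i))" by simp
    ultimately show ?thesis unfolding E_def by (simp add: mult_ac)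
  qed
  have Ege: "k j * w j \<le> E j" if "j \<in> {1..N}" for j
  proof -
    have "k j * w j \<le> D * 1" unfolding D_def
      using member_le_sum[of j "{1..N}" "\<lambda>j. k j * w j"] that by simp
    also have "0 < (\<Prod>i\<in>{1..<j}. s (Out i)) * (\<Prod>i\<in>{Suc j..N}. s (In i))" using s by (simp add: prod_pos)
    then have "D * 1 \<le> D * ((\<Prod>i\<in>{1..<j}. s (Out i)) * (\<Prod>i\<in>{Suc j..N}. s (In i)))"
      by (intro mult_le_mono2) (simp only: Suc_le_eq One_nat_def)
    finally show ?thesis unfolding E_def mult.assoc .
  qed
  \<comment> \<open>Dilation of step \<open>j\<close>: memory \<open>a\<close> with record
    \<open>u\<close> is sent to memory \<open>a'\<close> with record \<open>y + Y j * u\<close>,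
    with amplitude from \<open>W j y\<close>. Targets beyond the encoded range get amplitude
    0.\<close>
  define T where "T = (\<lambda>j (z', i) (z, p). if z' < k (Suc j) * w (Suc j) \<and> z' div k (Suc j) div Y j = z div k j
     then W j (z' div k (Suc j) mod Y j) (z mod k j, p, z' mod k (Suc j), i) else 0)"
  have T: "T j (a' + k (Suc j) * (y + Y j * v), i) (a + k j * u, p) = kdelta v u * W j y (a, p, a', i)"
    if "j \<in> {1..<N}" "a' < k (Suc j)" "y < Y j" "v < w j" "a < k j" for j a' y v i a u p
  proof -
    have "y + Y j * v < Y j * w j"
    proof -
      have "y + Y j * v < Y j * Suc v" using that by simp
      also have "\<dots> \<le> Y j * w j" using that by (intro mult_le_mono) simp_all
      finally show ?thesis .
    qed
    then have "a' + k (Suc j) * (y + Y j * v) < k (Suc j) * Suc (y + Y j * v)"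
      "k (Suc j) * Suc (y + Y j * v) \<le> k (Suc j) * w (Suc j)"
      using that wS[of j] by (simp, intro mult_le_mono, simp_all)
    then have "a' + k (Suc j) * (y + Y j * v) < k (Suc j) * w (Suc j)" by (rule less_le_trans)
    then show ?thesis using that k[of j] k[of "Suc j"] unfolding T_def prod.case by (simp add: kdelta_def)
  qed
  have T0: "T j (z', i) c = 0" if "z' \<ge> k (Suc j) * w (Suc j)" for j z' i c
    using that by (cases c) (simp add: T_def)
  have V_ex: "\<exists>V. unitary_on ({..<E j} \<times> {..<s (Out j)}) ({..<E (Suc j)} \<times> {..<s (In (Suc j))}) V \<and>
     (\<forall>c\<in>{..<k j * w j} \<times> {..<s (Out j)}. \<forall>z. V z c = T j z c)" if j: "j \<in> {1..<N}" for j
  proof (rule unitary_extension)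
    have "k j * w j \<le> E j" using Ege j by simp
    then show "{..<k j * w j} \<times> {..<s (Out j)} \<subseteq> {..<E j} \<times> {..<s (Out j)}" by auto
    show "card ({..<E j} \<times> {..<s (Out j)}) = card ({..<E (Suc j)} \<times> {..<s (In (Suc j))})"
      using Eeq[OF j] by (simp add: card_cartesian_product)
    have le: "k (Suc j) * w (Suc j) \<le> E (Suc j)" using Ege j by simp
    have "(\<Sum>z\<in>{..<E (Suc j)} \<times> {..<s (In (Suc j))}. cnj (T j z (z1, p)) * T j z (z2, q)) = kdelta (z1, p) (z2, q)"
      if z: "z1 < k j * w j" "z2 < k j * w j" "p < s (Out j)" "q < s (Out j)" for z1 z2 p q
    proof -
      define a b u v where "a = z1 mod k j" and "b = z2 mod k j" and "u = z1 div k j" and "v = z2 div k j"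
      have z12: "z1 = a + k j * u" "z2 = b + k j * v" "a < k j" "b < k j" "u < w j" "v < w j"
        using z k[of j] by (simp_all add: a_def b_def u_def v_def less_mult_imp_div_less mult.commute)
      have "(\<Sum>z\<in>{..<E (Suc j)} \<times> {..<s (In (Suc j))}. cnj (T j z (z1, p)) * T j z (z2, q))
        = (\<Sum>z'<E (Suc j). \<Sum>i<s (In (Suc j)). cnj (T j (z', i) (z1, p)) * T j (z', i) (z2, q))"
        by (simp add: sum.cartesian_product split_def)
      also have "\<dots> = (\<Sum>z'<k (Suc j) * w (Suc j). \<Sum>i<s (In (Suc j)). cnj (T j (z', i) (z1, p)) * T j (z', i) (z2, q))"
        using le by (intro sum.mono_neutral_right) (auto simp: T0)
      also have "\<dots> = (\<Sum>a'<k (Suc j). \<Sum>y<Y j. \<Sum>x<w j. \<Sum>i<s (In (Suc j)).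
          cnj (T j (a' + k (Suc j) * (y + Y j * x), i) (z1, p)) * T j (a' + k (Suc j) * (y + Y j * x), i) (z2, q))"
        using j by (simp add: wS sum_lessThan_mult)
      also have "\<dots> = (\<Sum>a'<k (Suc j). \<Sum>y<Y j. \<Sum>x<w j. kdelta x u * (kdelta x v * (\<Sum>i<s (In (Suc j)).
          cnj (W j y (a, p, a', i)) * W j y (b, q, a', i))))"
      proof (intro sum.cong refl)
        fix a' y x assume "a' \<in> {..<k (Suc j)}" "y \<in> {..<Y j}" "x \<in> {..<w j}"
        then have lt: "a' < k (Suc j)" "y < Y j" "x < w j" by auto
        have t: "T j (a' + k (Suc j) * (y + Y j * x), i) (z1, p) = kdelta x u * W j y (a, p, a', i)"
          "T j (a' + k (Suc j) * (y + Y j * x), i) (z2, q) = kdelta x v * W j y (b, q, a', i)" for i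
          unfolding z12(1,2) by (rule T[OF j lt z12(3)], rule T[OF j lt z12(4)])
        show "(\<Sum>i<s (In (Suc j)). cnj (T j (a' + k (Suc j) * (y + Y j * x), i) (z1, p)) * T j (a' + k (Suc j) * (y + Y j * x), i) (z2, q))
          = kdelta x u * (kdelta x v * (\<Sum>i<s (In (Suc j)). cnj (W j y (a, p, a', i)) * W j y (b, q, a', i)))"
          unfolding t sum_distrib_left by (intro sum.cong refl) (simp only: complex_cnj_mult cnj_kdelta mult_ac)
      qed
      also have "\<dots> = (\<Sum>a'<k (Suc j). \<Sum>y<Y j. kdelta u v * (\<Sum>i<s (In (Suc j)). cnj (W j y (a, p, a', i)) * W j y (b, q, a', i)))"
        using z12(5) by simp
      also have "\<dots> = kdelta u v * (\<Sum>y<Y j. \<Sum>a'<k (Suc j). \<Sum>i<s (In (Suc j)). cnj (W j y (a, p, a', i)) * W j y (b, q, a', i))"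
        by (subst sum.swap) (simp add: sum_distrib_left)
      also have "\<dots> = kdelta u v * kdelta (a, p) (b, q)" using iso[OF j z12(3,4) z(3,4)] by simp
      also have "\<dots> = kdelta (z1, p) (z2, q)"
      proof -
        have "z1 = z2 \<longleftrightarrow> a = b \<and> u = v" by (metis a_def b_def u_def v_def z12(1,2))
        then show ?thesis by (auto simp: kdelta_def)
      qed
      finally show ?thesis .
    qed
    then show "orthonormal_cols ({..<k j * w j} \<times> {..<s (Out j)}) ({..<E (Suc j)} \<times> {..<s (In (Suc j))}) (T j)"
      unfolding orthonormal_cols_def by auto
  qed simp_all
  then have "\<exists>V. \<forall>j\<in>{1..<N}. unitary_on ({..<E j} \<times> {..<s (Out j)}) ({..<E (Suc j)} \<times> {..<s (In (Suc j))}) (V j) \<and>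
     (\<forall>c\<in>{..<k j * w j} \<times> {..<s (Out j)}. \<forall>z. V j z c = T j z c)"
    by (intro bchoice ballI)
  then obtain V where VT: "\<And>j. j \<in> {1..<N} \<Longrightarrow> unitary_on ({..<E j} \<times> {..<s (Out j)}) ({..<E (Suc j)} \<times> {..<s (In (Suc j))}) (V j) \<and>
     (\<forall>c\<in>{..<k j * w j} \<times> {..<s (Out j)}. \<forall>z. V j z c = T j z c)"
    by blast
  have V1: "unitary_on ({..<E j} \<times> {..<s (Out j)}) ({..<E (Suc j)} \<times> {..<s (In (Suc j))}) (V j)" if "j \<in> {1..<N}" for j
    using VT[OF that] by blast
  have V2: "V j z' (z, p) = T j z' (z, p)" if "j \<in> {1..<N}" "z < k j * w j" "p < s (Out j)" for j z p z'
    using VT[OF that(1)] that(2,3) by (cases z') simp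
  note V = V1 V2
  \<comment> \<open>Extension by zero to the large environment; there is only one initial record
    because \<open>w 1 = 1\<close>.\<close>
  define \<rho>' where "\<rho>' = (\<lambda>(z, i) (z2, l). if z < k 1 \<and> z2 < k 1 then \<rho> (z, i) (z2, l) else 0)"
  have E1: "k 1 \<le> E 1" using Ege[of 1] N by (simp add: w1)
  have \<rho>1: "gram ({..<E 1} \<times> {..<s (In 1)}) \<rho>'"
  proof -
    \<comment> \<open>Out-of-range indices are moved to 0 only to stay in the domain of
      \<open>\<rho>\<close>; the rank-one cutoff \<open>?h\<close> then removes them.\<close>
    let ?g = "\<lambda>(z, i). (if z < k 1 then z else 0, i)" and ?h = "\<lambda>(z, i). if z < k 1 then 1 else (0 :: complex)"
    have "gram ({..<k 1} \<times> {..<s (In 1)}) \<rho>" using data by (simp add: valid_data_def)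
    from gram_mult[OF gram_pull[OF this, of ?g] gram_rank1[of _ ?h]]
    have "gram ({..<E 1} \<times> {..<s (In 1)}) (\<lambda>r c. \<rho> (?g r) (?g c) * (?h r * cnj (?h c)))"
      using k[of 1] by (auto simp: image_subset_iff)
    moreover have "\<rho>' = (\<lambda>r c. \<rho> (?g r) (?g c) * (?h r * cnj (?h c)))" by (auto simp: \<rho>'_def fun_eq_iff)
    ultimately show ?thesis by simp
  qed
  have \<rho>2: "(\<Sum>p\<in>{..<E 1} \<times> {..<s (In 1)}. \<rho>' p p) = 1"
  proof -
    have "(\<Sum>p\<in>{..<E 1} \<times> {..<s (In 1)}. \<rho>' p p) = (\<Sum>p\<in>{..<k 1} \<times> {..<s (In 1)}. \<rho>' p p)"
      using E1 by (intro sum.mono_neutral_right) (auto simp: \<rho>'_def split: if_splits)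
    also have "\<dots> = (\<Sum>p\<in>{..<k 1} \<times> {..<s (In 1)}. \<rho> p p)"
      by (intro sum.cong refl) (auto simp: \<rho>'_def)
    finally show ?thesis using data by (simp add: valid_data_def)
  qed
  let ?G = "\<lambda>j (a, p, z) (b, q, w). V j z (a, p) * cnj (V j w (b, q))"
  let ?run = "run E ?G \<rho>'"
  have QM: "process N s E ?G \<rho>' \<in> QM N s"
    by (rule QM_unitary[OF N s Epos \<rho>1 \<rho>2 V(1)])
  \<comment> \<open>Tracing out the record yields the prescribed memory operator at every time. The
    support statement is carried along because the unitaries are known only on the encoded
    range.\<close>
  have inv: "(\<forall>z z2. z \<ge> k (Suc n) * w (Suc n) \<or> z2 \<ge> k (Suc n) * w (Suc n) \<longrightarrow> ?run r c n z z2 = 0) \<and>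
     (\<forall>a<k (Suc n). \<forall>b<k (Suc n). (\<Sum>v<w (Suc n). ?run r c n (a + k (Suc n) * v) (b + k (Suc n) * v)) = run k G \<rho> r c n a b)"
    if n: "n < N" and r: "r \<in> sys_idx N s" and c: "c \<in> sys_idx N s" for n r c
    using n
  proof (induction n)
    case 0
    then show ?case by (auto simp: \<rho>'_def w1)
  next
    case (Suc n)
    let ?j = "Suc n" and ?p = "r (Out (Suc n))" and ?q = "c (Out (Suc n))" and ?i = "r (In (Suc (Suc n)))" and ?l = "c (In (Suc (Suc n)))"
    have j: "?j \<in> {1..<N}" using Suc.prems by simp
    have lt: "?p < s (Out ?j)" "?q < s (Out ?j)" "?i < s (In (Suc ?j))" "?l < s (In (Suc ?j))"
      using r c by (auto simp: sys_idx_less)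
    have wSj: "w (Suc ?j) = Y ?j * w ?j" by (rule wS) simp
    let ?R = "?run r c n"
    have "n < N" using Suc.prems by simp
    note IHn = Suc.IH[OF this]
    have IH0: "?R z z2 = 0" if "z \<ge> k ?j * w ?j \<or> z2 \<ge> k ?j * w ?j" for z z2
      using IHn[THEN conjunct1] that by blast
    have IH: "(\<Sum>v<w ?j. ?R (a + k ?j * v) (b + k ?j * v)) = run k G \<rho> r c n a b" if "a < k ?j" "b < k ?j" for a b
      using IHn[THEN conjunct2] that by blast
    have le: "k ?j * w ?j \<le> E ?j" using Ege j by simp
    have red: "?run r c ?j z' z2' = (\<Sum>z<k ?j * w ?j. \<Sum>z2<k ?j * w ?j.
        T ?j (z', ?i) (z, ?p) * cnj (T ?j (z2', ?l) (z2, ?q)) * ?R z z2)" for z' z2'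
    proof -
      have "?run r c ?j z' z2' = (\<Sum>z<E ?j. \<Sum>z2<E ?j. V ?j (z', ?i) (z, ?p) * cnj (V ?j (z2', ?l) (z2, ?q)) * ?R z z2)"
        by simp
      also have "\<dots> = (\<Sum>z<k ?j * w ?j. \<Sum>z2<E ?j. V ?j (z', ?i) (z, ?p) * cnj (V ?j (z2', ?l) (z2, ?q)) * ?R z z2)"
        using le IH0 by (intro sum.mono_neutral_right) auto
      also have "\<dots> = (\<Sum>z<k ?j * w ?j. \<Sum>z2<k ?j * w ?j. V ?j (z', ?i) (z, ?p) * cnj (V ?j (z2', ?l) (z2, ?q)) * ?R z z2)"
        using le IH0 by (intro sum.cong refl sum.mono_neutral_right) auto
      also have "\<dots> = (\<Sum>z<k ?j * w ?j. \<Sum>z2<k ?j * w ?j.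
        T ?j (z', ?i) (z, ?p) * cnj (T ?j (z2', ?l) (z2, ?q)) * ?R z z2)"
        by (intro sum.cong refl) (simp only: lessThan_iff V(2)[OF j _ lt(1)] V(2)[OF j _ lt(2)])
      finally show ?thesis .
    qed
    show ?case
    proof (intro conjI allI impI)
      fix z' z2' assume "k (Suc ?j) * w (Suc ?j) \<le> z' \<or> k (Suc ?j) * w (Suc ?j) \<le> z2'"
      then show "?run r c ?j z' z2' = 0" unfolding red by (auto simp: T0)
    next
      fix a' b' assume a': "a' < k (Suc ?j)" and b': "b' < k (Suc ?j)"
      \<comment> \<open>The dilation preserves the older record, so for a final record containing
        \<open>v\<close> the sums over \<open>u\<close> and \<open>u'\<close> both collapse to
        \<open>v\<close>.\<close>
      have block: "?run r c ?j (a' + k (Suc ?j) * (y + Y ?j * v)) (b' + k (Suc ?j) * (y + Y ?j * v))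
        = (\<Sum>a<k ?j. \<Sum>b<k ?j. W ?j y (a, ?p, a', ?i) * cnj (W ?j y (b, ?q, b', ?l)) * ?R (a + k ?j * v) (b + k ?j * v))"
        if "y < Y ?j" "v < w ?j" for y v
      proof -
        have "?run r c ?j (a' + k (Suc ?j) * (y + Y ?j * v)) (b' + k (Suc ?j) * (y + Y ?j * v))
          = (\<Sum>a<k ?j. \<Sum>u<w ?j. \<Sum>b<k ?j. \<Sum>u'<w ?j. kdelta v u * (kdelta v u' * (W ?j y (a, ?p, a', ?i)
               * cnj (W ?j y (b, ?q, b', ?l)) * ?R (a + k ?j * u) (b + k ?j * u'))))"
          unfolding red sum_lessThan_mult
        proof (intro sum.cong refl)
          fix a u b u' assume "a \<in> {..<k ?j}" "b \<in> {..<k ?j}"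
          then have ab: "a < k ?j" "b < k ?j" by auto
          show "T ?j (a' + k (Suc ?j) * (y + Y ?j * v), ?i) (a + k ?j * u, ?p) * cnj (T ?j (b' + k (Suc ?j) * (y + Y ?j * v), ?l) (b + k ?j * u', ?q))
              * ?R (a + k ?j * u) (b + k ?j * u') = kdelta v u * (kdelta v u' * (W ?j y (a, ?p, a', ?i)
               * cnj (W ?j y (b, ?q, b', ?l)) * ?R (a + k ?j * u) (b + k ?j * u')))"
            unfolding T[OF j a' that ab(1)] T[OF j b' that ab(2)]
            by (simp only: complex_cnj_mult cnj_kdelta mult_ac)
        qed
        also have "\<dots> = (\<Sum>a<k ?j. \<Sum>u<w ?j. kdelta v u * (\<Sum>b<k ?j. W ?j y (a, ?p, a', ?i)
               * cnj (W ?j y (b, ?q, b', ?l)) * ?R (a + k ?j * u) (b + k ?j * v)))"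
          using that by (simp flip: sum_distrib_left)
        also have "\<dots> = (\<Sum>a<k ?j. \<Sum>b<k ?j. W ?j y (a, ?p, a', ?i) * cnj (W ?j y (b, ?q, b', ?l)) * ?R (a + k ?j * v) (b + k ?j * v))"
          using that by simp
        finally show ?thesis .
      qed
      have "(\<Sum>v<w (Suc ?j). ?run r c ?j (a' + k (Suc ?j) * v) (b' + k (Suc ?j) * v))
        = (\<Sum>y<Y ?j. \<Sum>v<w ?j. ?run r c ?j (a' + k (Suc ?j) * (y + Y ?j * v)) (b' + k (Suc ?j) * (y + Y ?j * v)))"
        by (simp only: wSj sum_lessThan_mult)
      also have "\<dots> = (\<Sum>y<Y ?j. \<Sum>v<w ?j. \<Sum>a<k ?j. \<Sum>b<k ?j.
          W ?j y (a, ?p, a', ?i) * cnj (W ?j y (b, ?q, b', ?l)) * ?R (a + k ?j * v) (b + k ?j * v))"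
        by (intro sum.cong refl) (simp only: lessThan_iff block)
      also have "\<dots> = (\<Sum>a<k ?j. \<Sum>b<k ?j. \<Sum>y<Y ?j. \<Sum>v<w ?j.
          W ?j y (a, ?p, a', ?i) * cnj (W ?j y (b, ?q, b', ?l)) * ?R (a + k ?j * v) (b + k ?j * v))"
        by (rule sum_swap4)
      also have "\<dots> = (\<Sum>a<k ?j. \<Sum>b<k ?j. G ?j (a, ?p, a', ?i) (b, ?q, b', ?l) * run k G \<rho> r c n a b)"
      proof (intro sum.cong refl)
        fix a b assume ab: "a \<in> {..<k ?j}" "b \<in> {..<k ?j}"
        have "G ?j (a, ?p, a', ?i) (b, ?q, b', ?l) = (\<Sum>y<Y ?j. W ?j y (a, ?p, a', ?i) * cnj (W ?j y (b, ?q, b', ?l)))"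
          by (rule W[OF j]) (use ab lt a' b' in auto)
        moreover have "run k G \<rho> r c n a b = (\<Sum>v<w ?j. ?R (a + k ?j * v) (b + k ?j * v))"
          using IH ab by simp
        ultimately show "(\<Sum>y<Y ?j. \<Sum>v<w ?j. W ?j y (a, ?p, a', ?i) * cnj (W ?j y (b, ?q, b', ?l)) * ?R (a + k ?j * v) (b + k ?j * v))
          = G ?j (a, ?p, a', ?i) (b, ?q, b', ?l) * run k G \<rho> r c n a b"
          by (simp only: sum_product)
      qed
      also have "\<dots> = run k G \<rho> r c ?j a' b'" by simp
      finally show "(\<Sum>v<w (Suc ?j). ?run r c ?j (a' + k (Suc ?j) * v) (b' + k (Suc ?j) * v)) = run k G \<rho> r c ?j a' b'" .
    qed
  qed
  have "process N s E ?G \<rho>' = process N s k G \<rho>"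
  proof (rule process_eqI[OF s])
    fix r c assume rc: "r \<in> sys_idx N s" "c \<in> sys_idx N s"
    have SN: "Suc (N - 1) = N" "N - 1 < N" using N by auto
    note inv = inv[OF SN(2) rc, unfolded SN(1)]
    have "(\<Sum>z<E N. ?run r c (N - 1) z z) = (\<Sum>z<k N * w N. ?run r c (N - 1) z z)"
      using inv Ege[of N] N by (intro sum.mono_neutral_right) auto
    also have "\<dots> = (\<Sum>a<k N. run k G \<rho> r c (N - 1) a a)"
      unfolding sum_lessThan_mult using inv by (intro sum.cong refl) blast
    finally show "(\<Sum>z<E N. ?run r c (N - 1) z z) = (\<Sum>a<k N. run k G \<rho> r c (N - 1) a a)" .
  qed
  then show ?thesis using QM by simp
qed

text \<open>The classical case: here the measurement between two steps discards the Kraus index \<open>v\<close> of the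
  environment index \<open>a + k n * v\<close> and prepares the basis state \<open>a\<close>.\<close>

theorem valid_process_CM:
  assumes N: "N \<ge> 2" and s: "\<And>p. 0 < s p" and data: "valid_data N s k G \<rho>"
    and cl: "\<And>j a b z w. j \<in> {1..<N} \<Longrightarrow> a \<noteq> b \<Longrightarrow> G j (a, z) (b, w) = 0"
  shows "process N s k G \<rho> \<in> CM N s"
proof -
  have k: "0 < k n" for n using data by (simp add: valid_data_def)
  have "\<forall>j\<in>{1..<N}. \<exists>Y W. kraus (k j) (s (Out j)) (k (Suc j)) (s (In (Suc j))) (G j) Y W"
    using data valid_step_kraus by (simp add: valid_data_def)
  then obtain Y W where YW: "\<And>j. j \<in> {1..<N} \<Longrightarrow> kraus (k j) (s (Out j)) (k (Suc j)) (s (In (Suc j))) (G j) (Y j) (W j)"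
    by metis
  have W: "G j r c = (\<Sum>y<Y j. W j y r * cnj (W j y c))"
    if "j \<in> {1..<N}" "r \<in> {..<k j} \<times> {..<s (Out j)} \<times> {..<k (Suc j)} \<times> {..<s (In (Suc j))}"
       "c \<in> {..<k j} \<times> {..<s (Out j)} \<times> {..<k (Suc j)} \<times> {..<s (In (Suc j))}" for j r c
    using YW[OF that(1)] that(2,3) unfolding kraus_def by blast
  have iso: "(\<Sum>y<Y j. \<Sum>a'<k (Suc j). \<Sum>i<s (In (Suc j)). cnj (W j y (a, p, a', i)) * W j y (b, q, a', i)) = kdelta (a, p) (b, q)"
    if "j \<in> {1..<N}" "a < k j" "b < k j" "p < s (Out j)" "q < s (Out j)" for j a b p q
    using YW[OF that(1)] that(2-) unfolding kraus_def by blast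
  \<comment> \<open>\<open>D j\<close> accommodates the memory before step \<open>j\<close> as well
    as memory and Kraus index after it. Multiplying it crosswise by the system dimension of the
    other side gives both sides of the unitary the size
    \<open>D j * s (In (Suc j)) * s (Out j)\<close>.\<close>
  define D where "D = (\<lambda>j. k j + k (Suc j) * Y j)"
  define e where "e = (\<lambda>p. case p of
      In n \<Rightarrow> (if n \<le> 1 then k 1 else D (n - 1) * s (Out (n - 1))) | Out n \<Rightarrow> D n * s (In (Suc n)))"
  have e1: "e (In (Suc 0)) = k (Suc 0)" by (simp add: e_def)
  have eS: "e (In (Suc j)) = D j * s (Out j)" if "j \<ge> 1" for j using that by (simp add: e_def)
  have eO: "e (Out j) = D j * s (In (Suc j))" for j by (simp add: e_def)
  have Dpos: "0 < D n" for n using k[of n] by (simp add: D_def)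
  have epos: "0 < e p" for p using k Dpos s by (cases p) (auto simp: e_def)
  have geO: "k j \<le> e (Out j)" for j
  proof -
    have "k j \<le> D j * 1" by (simp add: D_def)
    also have "\<dots> \<le> D j * s (In (Suc j))" using s by (intro mult_le_mono2) (simp only: Suc_le_eq One_nat_def)
    finally show ?thesis unfolding eO .
  qed
  have geI: "k (Suc j) * Y j \<le> e (In (Suc j))" if "j \<ge> 1" for j
  proof -
    have "k (Suc j) * Y j \<le> D j * 1" by (simp add: D_def)
    also have "\<dots> \<le> D j * s (Out j)" using s by (intro mult_le_mono2) (simp only: Suc_le_eq One_nat_def)
    finally show ?thesis unfolding eS[OF that] .
  qed
  define T where "T = (\<lambda>j (z', i) (x, p). if z' < k (Suc j) * Y j
     then W j (z' div k (Suc j)) (x, p, z' mod k (Suc j), i) else 0)"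
  have T: "T j (a' + k (Suc j) * y, i) (x, p) = W j y (x, p, a', i)"
    if "a' < k (Suc j)" "y < Y j" for j a' y i x p
  proof -
    have "a' + k (Suc j) * y < k (Suc j) * Suc y" "k (Suc j) * Suc y \<le> k (Suc j) * Y j"
      using that by (simp, intro mult_le_mono2, simp)
    then have "a' + k (Suc j) * y < k (Suc j) * Y j" by (rule less_le_trans)
    then show ?thesis using that k[of "Suc j"] by (simp add: T_def)
  qed
  have T0: "T j (z', i) c = 0" if "z' \<ge> k (Suc j) * Y j" for j z' i c
    using that by (cases c) (simp add: T_def)
  have V_ex: "\<exists>V. unitary_on ({..<e (Out j)} \<times> {..<s (Out j)}) ({..<e (In (Suc j))} \<times> {..<s (In (Suc j))}) V \<and>
     (\<forall>c\<in>{..<k j} \<times> {..<s (Out j)}. \<forall>z. V z c = T j z c)" if j: "j \<in> {1..<N}" for j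
  proof (rule unitary_extension)
    show "{..<k j} \<times> {..<s (Out j)} \<subseteq> {..<e (Out j)} \<times> {..<s (Out j)}" using geO[of j] by auto
    show "card ({..<e (Out j)} \<times> {..<s (Out j)}) = card ({..<e (In (Suc j))} \<times> {..<s (In (Suc j))})"
      using j by (simp add: card_cartesian_product eO eS)
    have le: "k (Suc j) * Y j \<le> e (In (Suc j))" using geI j by simp
    have "(\<Sum>z\<in>{..<e (In (Suc j))} \<times> {..<s (In (Suc j))}. cnj (T j z (a, p)) * T j z (b, q)) = kdelta (a, p) (b, q)"
      if z: "a < k j" "b < k j" "p < s (Out j)" "q < s (Out j)" for a b p q
    proof -
      have "(\<Sum>z\<in>{..<e (In (Suc j))} \<times> {..<s (In (Suc j))}. cnj (T j z (a, p)) * T j z (b, q))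
        = (\<Sum>z'<e (In (Suc j)). \<Sum>i<s (In (Suc j)). cnj (T j (z', i) (a, p)) * T j (z', i) (b, q))"
        by (simp add: sum.cartesian_product split_def)
      also have "\<dots> = (\<Sum>z'<k (Suc j) * Y j. \<Sum>i<s (In (Suc j)). cnj (T j (z', i) (a, p)) * T j (z', i) (b, q))"
        using le by (intro sum.mono_neutral_right) (auto simp: T0)
      also have "\<dots> = (\<Sum>a'<k (Suc j). \<Sum>y<Y j. \<Sum>i<s (In (Suc j)). cnj (W j y (a, p, a', i)) * W j y (b, q, a', i))"
        unfolding sum_lessThan_mult by (intro sum.cong refl) (simp add: T)
      also have "\<dots> = (\<Sum>y<Y j. \<Sum>a'<k (Suc j). \<Sum>i<s (In (Suc j)). cnj (W j y (a, p, a', i)) * W j y (b, q, a', i))"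
        by (rule sum.swap)
      also have "\<dots> = kdelta (a, p) (b, q)" by (rule iso[OF j z])
      finally show ?thesis .
    qed
    then show "orthonormal_cols ({..<k j} \<times> {..<s (Out j)}) ({..<e (In (Suc j))} \<times> {..<s (In (Suc j))}) (T j)"
      unfolding orthonormal_cols_def by auto
  qed simp_all
  then have "\<exists>V. \<forall>j\<in>{1..<N}. unitary_on ({..<e (Out j)} \<times> {..<s (Out j)}) ({..<e (In (Suc j))} \<times> {..<s (In (Suc j))}) (V j) \<and>
     (\<forall>c\<in>{..<k j} \<times> {..<s (Out j)}. \<forall>z. V j z c = T j z c)"
    by (intro bchoice ballI)
  then obtain V where VT: "\<And>j. j \<in> {1..<N} \<Longrightarrow> unitary_on ({..<e (Out j)} \<times> {..<s (Out j)}) ({..<e (In (Suc j))} \<times> {..<s (In (Suc j))}) (V j) \<and>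
     (\<forall>c\<in>{..<k j} \<times> {..<s (Out j)}. \<forall>z. V j z c = T j z c)"
    by blast
  have V1: "unitary_on ({..<e (Out j)} \<times> {..<s (Out j)}) ({..<e (In (Suc j))} \<times> {..<s (In (Suc j))}) (V j)" if "j \<in> {1..<N}" for j
    using VT[OF that] by blast
  have V2: "V j z' (x, p) = T j z' (x, p)" if "j \<in> {1..<N}" "x < k j" "p < s (Out j)" for j x p z'
    using VT[OF that(1)] that(2,3) by (cases z') simp
  note V = V1 V2
  \<comment> \<open>The remainder modulo \<open>k j\<close> is the memory digit. It is read off
    every environment index, also outside the encoding, so the effects sum to the identity.\<close>
  define \<sigma> :: "nat \<Rightarrow> nat \<Rightarrow> nat \<Rightarrow> nat \<Rightarrow> complex" where "\<sigma> = (\<lambda>j x \<alpha> \<beta>. kdelta \<alpha> x * kdelta \<beta> x)"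
  define F :: "nat \<Rightarrow> nat \<Rightarrow> nat \<Rightarrow> nat \<Rightarrow> complex" where "F = (\<lambda>j x a b. kdelta a b * kdelta (a mod k j) x)"
  have eb: "eb_data (e (Out j)) (e (In j)) (k j) (\<sigma> j) (F j)" for j
    unfolding eb_data_def
  proof (intro conjI allI impI)
    fix x assume x: "x < k j"
    show "gram {..<e (Out j)} (\<sigma> j x)"
      using gram_rank1[of _ "\<lambda>\<alpha>. kdelta \<alpha> x"] unfolding \<sigma>_def by simp
    show "(\<Sum>a<e (Out j). \<sigma> j x a a) = 1" using x geO[of j] by (simp add: \<sigma>_def kdelta_def[of x x])
    have "F j x = (\<lambda>a b. kdelta a b * (kdelta (a mod k j) x * cnj (kdelta (b mod k j) x)))"
      by (auto simp: F_def kdelta_def fun_eq_iff)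
    then show "gram {..<e (In j)} (F j x)"
      using gram_mult[OF gram_kdelta[of "{..<e (In j)}"] gram_rank1[of _ "\<lambda>a. kdelta (a mod k j) x"]] by simp
  next
    fix a b
    show "(\<Sum>x<k j. F j x a b) = kdelta a b"
      using k[of j] by (simp add: F_def flip: sum_distrib_left) (simp add: kdelta_def)
  qed
  let ?Q = "\<lambda>j y. prepare_apply (e (Out j)) (\<sigma> j y) (V j)"
  let ?G = "eb_step k F ?Q"
  let ?run = "run (\<lambda>n. e (In n)) ?G \<rho>"
  have CM: "process N s (\<lambda>n. e (In n)) ?G \<rho> \<in> CM N s"
    by (rule CM_unitary[OF N s epos _ _ V(1) eb]) (use data in \<open>simp_all add: valid_data_def e1\<close>)
  have Q: "?Q j x (p, z) (q, w) = V j z (x, p) * cnj (V j w (x, q))" if "x < k j" for j x p q z w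
    using that geO[of j] by (simp add: prepare_apply_def \<sigma>_def mult.assoc flip: sum_distrib_left)
  \<comment> \<open>Only diagonal memory entries are compared: the measurement destroys the
    coherences that \<open>run k G \<rho>\<close> may still have, and by \<open>cl\<close> later
    steps do not see them.\<close>
  have inv: "(\<Sum>z<e (In (Suc n)). kdelta (z mod k (Suc n)) x * ?run r c n z z) = run k G \<rho> r c n x x"
    if n: "n < N" and x: "x < k (Suc n)" and r: "r \<in> sys_idx N s" and c: "c \<in> sys_idx N s" for n x r c
    using n x
  proof (induction n arbitrary: x)
    case 0
    have "(\<Sum>z<e (In (Suc 0)). kdelta (z mod k (Suc 0)) x * ?run r c 0 z z)
      = (\<Sum>z<k (Suc 0). kdelta z x * ?run r c 0 z z)"
      unfolding e1 by (intro sum.cong refl) simp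
    then show ?case using 0 by simp
  next
    case (Suc n)
    let ?j = "Suc n" and ?p = "r (Out (Suc n))" and ?q = "c (Out (Suc n))" and ?i = "r (In (Suc (Suc n)))" and ?l = "c (In (Suc (Suc n)))"
    have j: "?j \<in> {1..<N}" using Suc.prems by simp
    have lt: "?p < s (Out ?j)" "?q < s (Out ?j)" "?i < s (In (Suc ?j))" "?l < s (In (Suc ?j))"
      using r c by (auto simp: sys_idx_less)
    let ?R = "?run r c n" and ?S = "run k G \<rho> r c n"
    have IH: "(\<Sum>z<e (In ?j). kdelta (z mod k ?j) y * ?R z z) = ?S y y" if "y < k ?j" for y
      using Suc.IH[of y] Suc.prems that by simp
    have red: "?run r c ?j z' z' = (\<Sum>y<k ?j. T ?j (z', ?i) (y, ?p) * cnj (T ?j (z', ?l) (y, ?q)) * ?S y y)" for z'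
    proof -
      have "?run r c ?j z' z' = (\<Sum>a<e (In ?j). \<Sum>b<e (In ?j). \<Sum>y<k ?j.
          kdelta a b * (kdelta (a mod k ?j) y * (?Q ?j y (?p, z', ?i) (?q, z', ?l) * ?R a b)))"
        by (simp add: eb_step_def F_def sum_distrib_right mult.assoc)
      also have "\<dots> = (\<Sum>a<e (In ?j). \<Sum>y<k ?j. \<Sum>b<e (In ?j).
          kdelta a b * (kdelta (a mod k ?j) y * (?Q ?j y (?p, z', ?i) (?q, z', ?l) * ?R a b)))"
        by (intro sum.cong refl sum.swap)
      also have "\<dots> = (\<Sum>y<k ?j. \<Sum>a<e (In ?j). kdelta (a mod k ?j) y * (?Q ?j y (?p, z', ?i) (?q, z', ?l) * ?R a a))"
        by (subst sum.swap) simp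
      also have "\<dots> = (\<Sum>y<k ?j. T ?j (z', ?i) (y, ?p) * cnj (T ?j (z', ?l) (y, ?q)) * ?S y y)"
      proof (intro sum.cong refl)
        fix y assume "y \<in> {..<k ?j}"
        then have y: "y < k ?j" by simp
        have "(\<Sum>a<e (In ?j). kdelta (a mod k ?j) y * (?Q ?j y (?p, z', ?i) (?q, z', ?l) * ?R a a))
          = ?Q ?j y (?p, z', ?i) (?q, z', ?l) * (\<Sum>a<e (In ?j). kdelta (a mod k ?j) y * ?R a a)"
          unfolding sum_distrib_left by (intro sum.cong refl) (simp add: mult_ac)
        then show "(\<Sum>a<e (In ?j). kdelta (a mod k ?j) y * (?Q ?j y (?p, z', ?i) (?q, z', ?l) * ?R a a))
          = T ?j (z', ?i) (y, ?p) * cnj (T ?j (z', ?l) (y, ?q)) * ?S y y"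
          by (simp only: IH[OF y] Q[OF y] V(2)[OF j y lt(1)] V(2)[OF j y lt(2)])
      qed
      finally show ?thesis .
    qed
    have x: "x < k (Suc ?j)" using Suc.prems by simp
    have le: "k (Suc ?j) * Y ?j \<le> e (In (Suc ?j))" using geI[of ?j] by simp
    have "(\<Sum>z'<e (In (Suc ?j)). kdelta (z' mod k (Suc ?j)) x * ?run r c ?j z' z')
      = (\<Sum>z'<k (Suc ?j) * Y ?j. kdelta (z' mod k (Suc ?j)) x * ?run r c ?j z' z')"
      unfolding red using le by (intro sum.mono_neutral_right) (auto simp: T0)
    also have "\<dots> = (\<Sum>a'<k (Suc ?j). \<Sum>v<Y ?j. kdelta a' x * (\<Sum>y<k ?j. W ?j v (y, ?p, a', ?i) * cnj (W ?j v (y, ?q, a', ?l)) * ?S y y))"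
      unfolding sum_lessThan_mult red by (intro sum.cong refl) (simp add: T)
    also have "\<dots> = (\<Sum>v<Y ?j. \<Sum>y<k ?j. W ?j v (y, ?p, x, ?i) * cnj (W ?j v (y, ?q, x, ?l)) * ?S y y)"
      using x by (subst sum.swap) simp
    also have "\<dots> = (\<Sum>y<k ?j. (\<Sum>v<Y ?j. W ?j v (y, ?p, x, ?i) * cnj (W ?j v (y, ?q, x, ?l))) * ?S y y)"
      by (subst sum.swap) (simp add: sum_distrib_right)
    also have "\<dots> = (\<Sum>y<k ?j. G ?j (y, ?p, x, ?i) (y, ?q, x, ?l) * ?S y y)"
      by (intro sum.cong refl, subst W[OF j]) (use lt x in auto)
    also have "\<dots> = (\<Sum>y<k ?j. \<Sum>b<k ?j. kdelta y b * (G ?j (y, ?p, x, ?i) (b, ?q, x, ?l) * ?S y b))"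
      by simp
    \<comment> \<open>By \<open>cl\<close> all terms with \<open>b\<close> different from
      \<open>y\<close> are 0, so including them restores a step of \<open>run\<close>.\<close>
    also have "\<dots> = (\<Sum>y<k ?j. \<Sum>b<k ?j. G ?j (y, ?p, x, ?i) (b, ?q, x, ?l) * ?S y b)"
      by (intro sum.cong refl) (use cl[OF j] in \<open>auto simp: kdelta_def\<close>)
    also have "\<dots> = run k G \<rho> r c ?j x x" by simp
    finally show ?case .
  qed
  have "process N s (\<lambda>n. e (In n)) ?G \<rho> = process N s k G \<rho>"
  proof (rule process_eqI[OF s])
    fix r c assume rc: "r \<in> sys_idx N s" "c \<in> sys_idx N s"
    have SN: "Suc (N - 1) = N" "N - 1 < N" using N by auto
    let ?R = "?run r c (N - 1)"
    \<comment> \<open>Each environment index has exactly one memory digit, so the final trace splits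
      according to it.\<close>
    have "(\<Sum>z<e (In N). ?R z z) = (\<Sum>z<e (In N). \<Sum>x<k N. kdelta (z mod k N) x * ?R z z)"
      using k[of N] by (simp flip: sum_distrib_right add: sum_kdelta(2)[where f = "\<lambda>_. 1", simplified])
    also have "\<dots> = (\<Sum>x<k N. \<Sum>z<e (In N). kdelta (z mod k N) x * ?R z z)" by (rule sum.swap)
    also have "\<dots> = (\<Sum>x<k N. run k G \<rho> r c (N - 1) x x)"
      by (intro sum.cong refl) (use inv[OF SN(2) _ rc, unfolded SN(1)] in simp)
    finally show "(\<Sum>z<e (In N). ?R z z) = (\<Sum>a<k N. run k G \<rho> r c (N - 1) a a)" .
  qed
  then show ?thesis using CM by simp
qed

section \<open>Mixtures of products and the inclusions\<close>


definition mixture :: "nat \<Rightarrow> nat \<Rightarrow> (nat \<Rightarrow> real) \<Rightarrow> (nat \<Rightarrow> nat \<Rightarrow> nat \<times> nat \<Rightarrow> nat \<times> nat \<Rightarrow> complex) \<Rightarrow>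
    (nat \<Rightarrow> nat \<Rightarrow> nat \<Rightarrow> complex) \<Rightarrow> (port \<Rightarrow> nat) \<Rightarrow> (port \<Rightarrow> nat) \<Rightarrow> complex" where
  "mixture N m p L \<rho> r c = (\<Sum>x<m. complex_of_real (p x) *
     ((\<Prod>j\<in>{1..<N}. L x j (r (Out j), r (In (Suc j))) (c (Out j), c (In (Suc j)))) * \<rho> x (r (In 1)) (c (In 1))))"

lemma factors_big_tensor: "factors (big_tensor d f n) = (\<Union>j\<in>{1..n}. factors (f j))"
  by (induction n) (auto simp: atLeastAtMostSuc_conv)

lemma ev_big_tensor:
  assumes "bounded d r" "bounded d c"
  shows "ev (big_tensor d f n) r c = (\<Prod>j\<in>{1..n}. ev (f j) r c)"
  by (induction n) (simp_all add: ev_tensor[OF assms] atLeastAtMostSuc_conv)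

lemma psd1_repr: "psd d {x} A \<Longrightarrow> \<exists>f. A = op1 d x f"
  by (metis psd1E)

lemma psd2_repr: "psd d {x, y} A \<Longrightarrow> x \<noteq> y \<Longrightarrow> \<exists>f. A = op2 d x y f"
  by (metis psd2E)

lemma product_mixture_eq:
  fixes s :: "port \<Rightarrow> nat"
  defines "d \<equiv> dims s (\<lambda>_. 1)"
  assumes N: "N \<ge> 1" and s: "\<And>p. 0 < s p"
    and L: "\<And>x j. x < m \<Longrightarrow> j \<in> {1..<N} \<Longrightarrow> L x j = op2 d (Sys (Out j)) (Sys (In (j + 1))) (L' x j)"
    and \<rho>: "\<And>x. x < m \<Longrightarrow> \<rho> x = op1 d (Sys (In 1)) (\<rho>' x)"
  shows "product_mixture d N m p L \<rho> = sys_op N s (mixture N m p L' \<rho>')"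
proof (rule op_eqI[of _ d "sys_labels N"])
  show "0 < d l" for l using s by (cases l) (auto simp: d_def)
  show "product_mixture d N m p L \<rho> \<in> opers d (sys_labels N)" by (simp add: product_mixture_def sum_op_def)
  show "sys_op N s (mixture N m p L' \<rho>') \<in> opers d (sys_labels N)" unfolding d_def by (rule sys_op_opers)
  fix r c assume b: "bounded d r" "bounded d c"
  have range: "{1..N - 1} = {1..<N}" using N by auto
  have f: "factors (scale_op a (tensor d (big_tensor d (L x) (N - 1)) (\<rho> x))) = sys_labels N" if "x < m" for x a
  proof -
    have "(\<Union>j\<in>{1..<N}. factors (L x j)) = (\<Union>j\<in>{1..<N}. {Sys (Out j), Sys (In (j + 1))})"
      using L[OF that] by simp
    moreover have "(\<Union>j\<in>{1..<N}. {Sys (Out j), Sys (In (j + 1))}) \<union> {Sys (In 1)} = sys_labels N"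
    proof -
      have "x \<in> Suc ` {1..<N}" if "x \<in> {1..N}" "x \<noteq> 1" for x
        by (rule image_eqI[of _ _ "x - 1"]) (use that in auto)
      moreover have "{1..N} \<supseteq> insert 1 (Suc ` {1..<N})" using N by auto
      ultimately have S: "{1..N} = insert 1 (Suc ` {1..<N})" by blast
      show ?thesis unfolding sys_labels_def S image_insert image_image by auto
    qed
    ultimately show ?thesis
      unfolding factors_scale_op factors_tensor factors_big_tensor range \<rho>[OF that] factors_op by simp
  qed
  have "ev (product_mixture d N m p L \<rho>) r c = (\<Sum>x<m. complex_of_real (p x) * ((\<Prod>j\<in>{1..<N}. ev (L x j) r c) * ev (\<rho> x) r c))"
  proof -
    have "ev (product_mixture d N m p L \<rho>) r c = (\<Sum>x<m. ev (scale_op (complex_of_real (p x))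
        (tensor d (big_tensor d (L x) (N - 1)) (\<rho> x))) r c)"
      unfolding product_mixture_def by (rule ev_sum_op[OF b]) (simp only: lessThan_iff f)
    then show ?thesis by (simp only: ev_scale_op ev_tensor[OF b] ev_big_tensor[OF b] range)
  qed
  also have "\<dots> = mixture N m p L' \<rho>' (r \<circ> Sys) (c \<circ> Sys)"
    unfolding mixture_def
  proof (intro sum.cong refl arg_cong2[of _ _ _ _ "(*)"] prod.cong)
    fix x j assume "x \<in> {..<m}" "j \<in> {1..<N}"
    then show "ev (L x j) r c = L' x j ((r \<circ> Sys) (Out j), (r \<circ> Sys) (In (Suc j))) ((c \<circ> Sys) (Out j), (c \<circ> Sys) (In (Suc j)))"
      using L[of x j] b by (simp add: ev_op2)
  next
    fix x assume "x \<in> {..<m}"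
    then show "ev (\<rho> x) r c = \<rho>' x ((r \<circ> Sys) (In 1)) ((c \<circ> Sys) (In 1))"
      using \<rho>[of x] b by (simp add: ev_op1)
  qed
  also have "\<dots> = mixture N m p L' \<rho>' (sys_ext N r) (sys_ext N c)"
    unfolding mixture_def using N
    by (intro sum.cong refl arg_cong2[of _ _ _ _ "(*)"] prod.cong) (auto simp: sys_ext_def sys_labels_def)
  also have "\<dots> = ev (sys_op N s (mixture N m p L' \<rho>')) r c"
    using b unfolding d_def by (simp add: ev_sys_op)
  finally show "ev (product_mixture d N m p L \<rho>) r c = ev (sys_op N s (mixture N m p L' \<rho>')) r c" .
qed

definition sep_data :: "nat \<Rightarrow> (port \<Rightarrow> nat) \<Rightarrow> nat \<Rightarrow> (nat \<Rightarrow> real) \<Rightarrow>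
    (nat \<Rightarrow> nat \<Rightarrow> nat \<times> nat \<Rightarrow> nat \<times> nat \<Rightarrow> complex) \<Rightarrow> (nat \<Rightarrow> nat \<Rightarrow> nat \<Rightarrow> complex) \<Rightarrow> bool" where
  "sep_data N s m p L \<rho> \<longleftrightarrow> prob_dist m p \<and> (\<forall>x<m. gram {..<s (In 1)} (\<rho> x) \<and>
     (\<forall>j\<in>{1..<N}. gram ({..<s (Out j)} \<times> {..<s (In (Suc j))}) (L x j)))"

definition mm_data :: "nat \<Rightarrow> (port \<Rightarrow> nat) \<Rightarrow> nat \<Rightarrow> (nat \<Rightarrow> real) \<Rightarrow>
    (nat \<Rightarrow> nat \<Rightarrow> nat \<times> nat \<Rightarrow> nat \<times> nat \<Rightarrow> complex) \<Rightarrow> (nat \<Rightarrow> nat \<Rightarrow> nat \<Rightarrow> complex) \<Rightarrow> bool" where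
  "mm_data N s m p L \<rho> \<longleftrightarrow> sep_data N s m p L \<rho> \<and> (\<forall>x<m. (\<Sum>a<s (In 1). \<rho> x a a) = 1 \<and>
     (\<forall>j\<in>{1..<N}. \<forall>a<s (Out j). \<forall>b<s (Out j). (\<Sum>i<s (In (Suc j)). L x j (a, i) (b, i)) = kdelta a b))"

lemma MM_iff:
  assumes N: "N \<ge> 1" and s: "\<And>p. 0 < s p"
  shows "C \<in> MM N s \<longleftrightarrow> (\<exists>m p L \<rho>. mm_data N s m p L \<rho> \<and> C = sys_op N s (mixture N m p L \<rho>))"
proof
  let ?d = "dims s (\<lambda>_. 1)"
  have pos: "0 < ?d l" for l using s by (cases l) auto
  have ne: "Sys (Out j) \<noteq> Sys (In (j + 1))" for j by simp
  {
    assume "C \<in> MM N s"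
    then obtain m p L \<rho> where p: "prob_dist m p"
      and L: "\<forall>x<m. density ?d {Sys (In 1)} (\<rho> x) \<and>
           (\<forall>j\<in>{1..<N}. channel_choi ?d {Sys (Out j)} {Sys (In (j + 1))} (L x j))"
      and C: "C = product_mixture ?d N m p L \<rho>"
      unfolding MM_def Let_def by blast
    have d: "density ?d {Sys (In 1)} (\<rho> x)" if "x < m" for x using L that by blast
    have ch: "channel_choi ?d {Sys (Out j)} {Sys (In (j + 1))} (L x j)" if "x < m" "j \<in> {1..<N}" for x j
      using L that by blast
    have "\<exists>f. \<rho> x = op1 ?d (Sys (In 1)) f" if "x < m" for x
      by (rule psd1_repr) (use d[OF that] in \<open>simp add: density_def\<close>)
    then obtain \<rho>' where \<rho>': "\<And>x. x < m \<Longrightarrow> \<rho> x = op1 ?d (Sys (In 1)) (\<rho>' x)" by metis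
    have "\<exists>f. L x j = op2 ?d (Sys (Out j)) (Sys (In (j + 1))) f" if "x < m" "j \<in> {1..<N}" for x j
    proof (rule psd2_repr[OF _ ne])
      show "psd ?d {Sys (Out j), Sys (In (j + 1))} (L x j)"
        using ch[OF that] unfolding channel_choi_def insert_is_Un[of _ "{Sys (In (j + 1))}"] by blast
    qed
    then obtain L' where L': "\<And>x j. x < m \<Longrightarrow> j \<in> {1..<N} \<Longrightarrow> L x j = op2 ?d (Sys (Out j)) (Sys (In (j + 1))) (L' x j)"
      by metis
    have "mm_data N s m p L' \<rho>'"
      unfolding mm_data_def sep_data_def
    proof (intro conjI allI impI ballI)
      fix x assume x: "x < m"
      have "density ?d {Sys (In 1)} (op1 ?d (Sys (In 1)) (\<rho>' x))" using d[OF x] unfolding \<rho>'[OF x] .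
      then show "gram {..<s (In 1)} (\<rho>' x)" "(\<Sum>a<s (In 1). \<rho>' x a a) = 1" by (simp_all add: density_op1)
      fix j assume j: "j \<in> {1..<N}"
      have chx: "channel_choi ?d {Sys (Out j)} {Sys (In (j + 1))} (op2 ?d (Sys (Out j)) (Sys (In (j + 1))) (L' x j))"
        using ch[OF x j] unfolding L'[OF x j] .
      then show "gram ({..<s (Out j)} \<times> {..<s (In (Suc j))}) (L' x j)"
        unfolding channel_choi_op2[OF ne pos] by simp
      show "(\<Sum>i<s (In (Suc j)). L' x j (a, i) (b, i)) = kdelta a b" if "a < s (Out j)" "b < s (Out j)" for a b
        using chx that unfolding channel_choi_op2[OF ne pos] by simp
    qed (rule p)
    moreover have "C = sys_op N s (mixture N m p L' \<rho>')"
      unfolding C by (rule product_mixture_eq[OF N s L' \<rho>'])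
    ultimately show "\<exists>m p L \<rho>. mm_data N s m p L \<rho> \<and> C = sys_op N s (mixture N m p L \<rho>)" by blast
  }
  {
    assume "\<exists>m p L \<rho>. mm_data N s m p L \<rho> \<and> C = sys_op N s (mixture N m p L \<rho>)"
    then obtain m p L \<rho> where D: "mm_data N s m p L \<rho>" and C: "C = sys_op N s (mixture N m p L \<rho>)" by blast
    let ?L = "\<lambda>x j. op2 ?d (Sys (Out j)) (Sys (In (j + 1))) (L x j)" and ?\<rho> = "\<lambda>x. op1 ?d (Sys (In 1)) (\<rho> x)"
    have "C = product_mixture ?d N m p ?L ?\<rho>"
      unfolding C by (rule product_mixture_eq[OF N s, symmetric]) (rule refl)+
    moreover have "channel_choi ?d {Sys (Out j)} {Sys (In (j + 1))} (?L x j)" if "x < m" "j \<in> {1..<N}" for x j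
      using D that unfolding channel_choi_op2[OF ne pos] by (simp add: mm_data_def sep_data_def)
    moreover have "density ?d {Sys (In 1)} (?\<rho> x)" if "x < m" for x
      using D that by (simp add: density_op1 mm_data_def sep_data_def)
    moreover have "prob_dist m p" using D by (simp add: mm_data_def sep_data_def)
    ultimately show "C \<in> MM N s" unfolding MM_def Let_def
      by (intro CollectI exI[of _ m] exI[of _ p] exI[of _ ?L] exI[of _ ?\<rho>]) simp
  }
qed

lemma SEP_iff:
  assumes N: "N \<ge> 1" and s: "\<And>p. 0 < s p"
  shows "C \<in> SEP N s \<longleftrightarrow> C \<in> QM N s \<and> (\<exists>m p L \<rho>. sep_data N s m p L \<rho> \<and> C = sys_op N s (mixture N m p L \<rho>))"
proof
  let ?d = "dims s (\<lambda>_. 1)"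
  have ne: "Sys (Out j) \<noteq> Sys (In (j + 1))" for j by simp
  {
    assume "C \<in> SEP N s"
    then obtain m p L \<rho> where QM: "C \<in> QM N s" and p: "prob_dist m p"
      and L: "\<forall>x<m. psd ?d {Sys (In 1)} (\<rho> x) \<and>
           (\<forall>j\<in>{1..<N}. psd ?d {Sys (Out j), Sys (In (j + 1))} (L x j))"
      and C: "C = product_mixture ?d N m p L \<rho>"
      unfolding SEP_def Let_def by blast
    have d: "psd ?d {Sys (In 1)} (\<rho> x)" if "x < m" for x using L that by blast
    have ch: "psd ?d {Sys (Out j), Sys (In (j + 1))} (L x j)" if "x < m" "j \<in> {1..<N}" for x j
      using L that by blast
    have "\<exists>f. \<rho> x = op1 ?d (Sys (In 1)) f" if "x < m" for x
      using psd1_repr[OF d[OF that]] .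
    then obtain \<rho>' where \<rho>': "\<And>x. x < m \<Longrightarrow> \<rho> x = op1 ?d (Sys (In 1)) (\<rho>' x)" by metis
    have "\<exists>f. L x j = op2 ?d (Sys (Out j)) (Sys (In (j + 1))) f" if "x < m" "j \<in> {1..<N}" for x j
      using psd2_repr[OF ch[OF that] ne] .
    then obtain L' where L': "\<And>x j. x < m \<Longrightarrow> j \<in> {1..<N} \<Longrightarrow> L x j = op2 ?d (Sys (Out j)) (Sys (In (j + 1))) (L' x j)"
      by metis
    have "sep_data N s m p L' \<rho>'"
      unfolding sep_data_def
    proof (intro conjI allI impI ballI)
      fix x assume x: "x < m"
      have "psd ?d {Sys (In 1)} (op1 ?d (Sys (In 1)) (\<rho>' x))" using d[OF x] unfolding \<rho>'[OF x] .
      then show "gram {..<s (In 1)} (\<rho>' x)" by (simp add: psd_op1)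
      fix j assume j: "j \<in> {1..<N}"
      have "psd ?d {Sys (Out j), Sys (In (j + 1))} (op2 ?d (Sys (Out j)) (Sys (In (j + 1))) (L' x j))"
        using ch[OF x j] unfolding L'[OF x j] .
      then show "gram ({..<s (Out j)} \<times> {..<s (In (Suc j))}) (L' x j)"
        unfolding psd_op2[OF ne] by simp
    qed (rule p)
    moreover have "C = sys_op N s (mixture N m p L' \<rho>')"
      unfolding C by (rule product_mixture_eq[OF N s L' \<rho>'])
    ultimately show "C \<in> QM N s \<and> (\<exists>m p L \<rho>. sep_data N s m p L \<rho> \<and> C = sys_op N s (mixture N m p L \<rho>))"
      using QM by blast
  }
  {
    assume "C \<in> QM N s \<and> (\<exists>m p L \<rho>. sep_data N s m p L \<rho> \<and> C = sys_op N s (mixture N m p L \<rho>))"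
    then obtain m p L \<rho> where QM: "C \<in> QM N s" and D: "sep_data N s m p L \<rho>" and C: "C = sys_op N s (mixture N m p L \<rho>)" by blast
    let ?L = "\<lambda>x j. op2 ?d (Sys (Out j)) (Sys (In (j + 1))) (L x j)" and ?\<rho> = "\<lambda>x. op1 ?d (Sys (In 1)) (\<rho> x)"
    have "C = product_mixture ?d N m p ?L ?\<rho>"
      unfolding C by (rule product_mixture_eq[OF N s, symmetric]) (rule refl)+
    moreover have "psd ?d {Sys (Out j), Sys (In (j + 1))} (?L x j)" if "x < m" "j \<in> {1..<N}" for x j
      using D that unfolding psd_op2[OF ne] by (simp add: sep_data_def)
    moreover have "psd ?d {Sys (In 1)} (?\<rho> x)" if "x < m" for x
      using D that by (simp add: psd_op1 sep_data_def)
    moreover have "prob_dist m p" using D by (simp add: sep_data_def)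
    ultimately show "C \<in> SEP N s" using QM unfolding SEP_def Let_def
      by (intro CollectI conjI exI[of _ m] exI[of _ p] exI[of _ ?L] exI[of _ ?\<rho>]) simp_all
  }
qed

section \<open>The inclusions from memoryless to separable processes\<close>

lemma gram_traced_output:
  assumes "finite A" "gram (I \<times> A \<times> J) Q" "gram A \<Phi>"
  shows "gram (I \<times> J) (\<lambda>(p, i) (q, l). \<Sum>a\<in>A. \<Sum>b\<in>A. \<Phi> a b * Q (p, a, i) (q, b, l))"
proof -
  have "gram (A \<times> I \<times> J) (\<lambda>r c. Q ((\<lambda>(a, p, i). (p, a, i)) r) ((\<lambda>(a, p, i). (p, a, i)) c))"
    by (rule gram_pull[OF assms(2)]) auto
  from gram_contract[OF assms(1,3) this] show ?thesis by (simp add: split_def)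
qed

lemma gram_traced_output_kdelta:
  assumes "finite A" "gram (I \<times> A \<times> J) Q"
  shows "gram (I \<times> J) (\<lambda>(p, i) (q, l). \<Sum>a\<in>A. Q (p, a, i) (q, a, l))"
proof -
  have "gram (I \<times> J) (\<lambda>(p, i) (q, l). \<Sum>a\<in>A. \<Sum>b\<in>A. kdelta a b * Q (p, a, i) (q, b, l))"
    by (rule gram_traced_output[OF assms gram_kdelta[OF assms(1)]])
  then show ?thesis by (simp add: assms(1) split_def cong: sum.cong)
qed

text \<open>With \<open>F j = kdelta\<close> a step sees only the trace of the old memory, so the
  traced memory acquires one factor per step. \<open>L\<close> and \<open>\<rho>'\<close> are the
  steps and the initial state with their memory outputs traced out.\<close>

lemma M_product:
  assumes N: "N \<ge> 2" and s: "\<And>p. 0 < s p" and C: "C \<in> M N s"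
  obtains L \<rho> where "mm_data N s 1 (\<lambda>_. 1) L \<rho>" "C = sys_op N s (mixture N 1 (\<lambda>_. 1) L \<rho>)"
proof -
  obtain k m F Q \<rho> where D: "cm_data N s k m F Q \<rho>" and C: "C = process N s k (eb_step m F Q) \<rho>"
    and mF': "\<forall>j\<in>{1..<N}. m j = 1 \<and> F j = (\<lambda>_. kdelta)"
    by (rule M_cases[OF C N s])
  have mF: "m j = 1 \<and> F j = (\<lambda>_. kdelta)" if "j \<in> {1..<N}" for j using mF' that by blast
  define \<rho>' :: "nat \<Rightarrow> nat \<Rightarrow> nat \<Rightarrow> complex" where "\<rho>' = (\<lambda>_ i l. \<Sum>a<k 1. \<rho> (a, i) (a, l))"
  define L :: "nat \<Rightarrow> nat \<Rightarrow> nat \<times> nat \<Rightarrow> nat \<times> nat \<Rightarrow> complex"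
    where "L = (\<lambda>_ j (p, i) (q, l). \<Sum>a<k (Suc j). Q j 0 (p, a, i) (q, a, l))"
  have mm: "mm_data N s 1 (\<lambda>_. 1) L \<rho>'"
    unfolding mm_data_def sep_data_def
  proof (intro conjI allI impI ballI)
    show "prob_dist 1 (\<lambda>_. 1)" by (simp add: prob_dist_def)
    fix x
    show "gram {..<s (In 1)} (\<rho>' x)"
      unfolding \<rho>'_def by (rule gram_trace) (use D in \<open>simp_all add: cm_data_def\<close>)
    have "(\<Sum>i<s (In 1). \<rho>' x i i) = (\<Sum>p\<in>{..<k 1} \<times> {..<s (In 1)}. \<rho> p p)"
      unfolding \<rho>'_def by (subst sum.swap) (simp add: sum.cartesian_product split_def)
    then show "(\<Sum>i<s (In 1). \<rho>' x i i) = 1" using D by (simp add: cm_data_def)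
    fix j assume j: "j \<in> {1..<N}"
    show "gram ({..<s (Out j)} \<times> {..<s (In (Suc j))}) (L x j)"
      unfolding L_def by (rule gram_traced_output_kdelta) (use D j mF in \<open>simp_all add: cm_data_def\<close>)
    fix a b assume ab: "a < s (Out j)" "b < s (Out j)"
    have "(\<Sum>i<s (In (Suc j)). L x j (a, i) (b, i)) = (\<Sum>z\<in>{..<k (Suc j)} \<times> {..<s (In (Suc j))}. Q j 0 (a, z) (b, z))"
      unfolding L_def prod.case by (subst sum.swap) (simp add: sum.cartesian_product split_def)
    also have "\<dots> = kdelta a b" using D j ab mF[OF j] by (simp add: cm_data_def)
    finally show "(\<Sum>i<s (In (Suc j)). L x j (a, i) (b, i)) = kdelta a b" .
  qed
  have run: "(\<Sum>a<k (Suc n). run k (eb_step m F Q) \<rho> r c n a a)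
     = (\<Prod>j\<in>{1..n}. L 0 j (r (Out j), r (In (Suc j))) (c (Out j), c (In (Suc j)))) * \<rho>' 0 (r (In 1)) (c (In 1))"
    if "n < N" for n r c
    using that
  proof (induction n)
    case 0
    then show ?case by (simp add: \<rho>'_def)
  next
    case (Suc n)
    have j: "Suc n \<in> {1..<N}" using Suc.prems by simp
    let ?S = "run k (eb_step m F Q) \<rho> r c n"
    have "(\<Sum>a'<k (Suc (Suc n)). run k (eb_step m F Q) \<rho> r c (Suc n) a' a')
      = (\<Sum>a'<k (Suc (Suc n)). \<Sum>a<k (Suc n). \<Sum>b<k (Suc n). kdelta a b * (Q (Suc n) 0 (r (Out (Suc n)), a', r (In (Suc (Suc n))))
          (c (Out (Suc n)), a', c (In (Suc (Suc n)))) * ?S a b))"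
      using mF[OF j] by (simp add: eb_step_def mult.assoc)
    also have "\<dots> = (\<Sum>a'<k (Suc (Suc n)). Q (Suc n) 0 (r (Out (Suc n)), a', r (In (Suc (Suc n))))
          (c (Out (Suc n)), a', c (In (Suc (Suc n)))) * (\<Sum>a<k (Suc n). ?S a a))"
      by (simp add: sum_distrib_left)
    also have "\<dots> = L 0 (Suc n) (r (Out (Suc n)), r (In (Suc (Suc n)))) (c (Out (Suc n)), c (In (Suc (Suc n))))
        * (\<Sum>a<k (Suc n). ?S a a)"
      by (simp add: L_def sum_distrib_right)
    finally show ?case using Suc.IH Suc.prems by (simp add: atLeastAtMostSuc_conv mult.assoc)
  qed
  have SN: "Suc (N - 1) = N" "N - 1 < N" "{1..N - 1} = {1..<N}" using N by auto
  have "C = sys_op N s (mixture N 1 (\<lambda>_. 1) L \<rho>')"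
    unfolding C process_def mixture_def using run[OF SN(2)] unfolding SN(1,3) by simp
  with mm show ?thesis by (rule that)
qed

lemma M_subset_MM:
  assumes "N \<ge> 2" "\<And>p. 0 < s p"
  shows "M N s \<subseteq> MM N s"
proof
  fix C assume C: "C \<in> M N s"
  obtain L \<rho> where "mm_data N s 1 (\<lambda>_. 1) L \<rho>" "C = sys_op N s (mixture N 1 (\<lambda>_. 1) L \<rho>)"
    by (rule M_product[OF assms C])
  moreover have "N \<ge> 1" using assms(1) by simp
  ultimately show "C \<in> MM N s" using MM_iff[where s = s, OF _ assms(2)] by blast
qed

text \<open>The mixing index is drawn together with the initial state and kept in a classical memory
  of dimension \<open>m\<close>; step \<open>j\<close> reads it, applies \<open>L x j\<close> and
  passes it on.\<close>

lemma MM_subset_CM: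
  assumes N: "N \<ge> 2" and s: "\<And>p. 0 < s p"
  shows "MM N s \<subseteq> CM N s"
proof
  fix C assume "C \<in> MM N s"
  moreover have "N \<ge> 1" using N by simp
  ultimately obtain m p L \<rho> where D: "mm_data N s m p L \<rho>" and C: "C = sys_op N s (mixture N m p L \<rho>)"
    using MM_iff[where s = s, OF _ s] by blast
  \<comment> \<open>\<open>kdelta x y\<close> makes the step blind to memory coherences, which
    \<open>valid_process_CM\<close> demands.\<close>
  define G :: "nat \<Rightarrow> step" where "G = (\<lambda>j (x, o', x', i) (y, q, y', l). kdelta x y * (kdelta x x' * kdelta y y' * L x j (o', i) (q, l)))"
  define \<rho>0 :: "nat \<times> nat \<Rightarrow> nat \<times> nat \<Rightarrow> complex" where "\<rho>0 = (\<lambda>(x, i) (y, l). kdelta x y * (complex_of_real (p x) * \<rho> x i l))"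
  have p: "\<And>x. x < m \<Longrightarrow> 0 \<le> p x" "(\<Sum>x<m. p x) = 1" using D by (auto simp: mm_data_def sep_data_def prob_dist_def)
  have m: "0 < m" using p(2) by (cases m) auto
  have val: "valid_data N s (\<lambda>_. m) G \<rho>0"
    unfolding valid_data_def valid_step_def
  proof (intro conjI allI impI ballI)
    \<comment> \<open>A sum over memory values of a rank-one kernel times a Gram kernel shows
      positivity of the block-diagonal state.\<close>
    have eq: "\<rho>0 r c = (\<Sum>y<m. (kdelta (fst r) y * cnj (kdelta (fst c) y)) * (complex_of_real (p y) * \<rho> y (snd r) (snd c)))"
      if "r \<in> {..<m} \<times> {..<s (In 1)}" "c \<in> {..<m} \<times> {..<s (In 1)}" for r c
    proof -
      obtain x i y l where rc: "r = (x, i)" "c = (y, l)" by (cases r; cases c) auto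
      have "(\<Sum>z<m. (kdelta (fst r) z * cnj (kdelta (fst c) z)) * (complex_of_real (p z) * \<rho> z (snd r) (snd c)))
        = (\<Sum>z<m. kdelta x z * (kdelta y z * (complex_of_real (p z) * \<rho> z i l)))"
        unfolding rc by (simp add: mult.assoc)
      also have "\<dots> = kdelta y x * (complex_of_real (p x) * \<rho> x i l)" using that unfolding rc by simp
      also have "\<dots> = \<rho>0 r c" by (simp add: rc \<rho>0_def kdelta_commute[of y])
      finally show ?thesis by simp
    qed
    have "gram ({..<m} \<times> {..<s (In 1)}) (\<lambda>r c. \<Sum>y<m. (kdelta (fst r) y * cnj (kdelta (fst c) y)) * (complex_of_real (p y) * \<rho> y (snd r) (snd c)))"
      (is "gram ?I ?g")
    proof (rule gram_sum)
      fix y assume "y \<in> {..<m}"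
      then have "gram {..<s (In 1)} (\<lambda>i l. complex_of_real (p y) * \<rho> y i l)"
        using D p(1) by (intro gram_cmult) (auto simp: mm_data_def sep_data_def)
      then have "gram ({..<m} \<times> {..<s (In 1)}) (\<lambda>r c. complex_of_real (p y) * \<rho> y (snd r) (snd c))"
        by (rule gram_pull) auto
      then show "gram ({..<m} \<times> {..<s (In 1)}) (\<lambda>r c. (kdelta (fst r) y * cnj (kdelta (fst c) y)) * (complex_of_real (p y) * \<rho> y (snd r) (snd c)))"
        by (rule gram_mult[OF gram_rank1])
    qed simp
    then show "gram ({..<m} \<times> {..<s (In 1)}) \<rho>0"
      using gram_cong[of ?I \<rho>0 ?g, OF eq] by (simp only:)
    have "(\<Sum>z\<in>{..<m} \<times> {..<s (In 1)}. \<rho>0 z z) = (\<Sum>x<m. \<Sum>i<s (In 1). \<rho>0 (x, i) (x, i))"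
      by (simp add: sum.cartesian_product split_def)
    also have "\<dots> = (\<Sum>x<m. complex_of_real (p x) * (\<Sum>i<s (In 1). \<rho> x i i))"
      by (simp add: \<rho>0_def kdelta_def sum_distrib_left)
    also have "\<dots> = (\<Sum>x<m. complex_of_real (p x))" using D by (intro sum.cong refl) (simp add: mm_data_def)
    also have "\<dots> = 1" using p(2) by (simp flip: of_real_sum)
    finally show "(\<Sum>z\<in>{..<m} \<times> {..<s (In 1)}. \<rho>0 z z) = 1" .
  next
    fix j assume j: "j \<in> {1..<N}"
    let ?I = "{..<m} \<times> {..<s (Out j)} \<times> {..<m} \<times> {..<s (In (Suc j))}"
    let ?f = "\<lambda>y (x, o', x', i). kdelta x y * kdelta x' y" and ?g = "\<lambda>(x, o', x', i). (o', i)"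
    have eq: "G j r c = (\<Sum>y<m. (?f y r * cnj (?f y c)) * L y j (?g r) (?g c))"
      if "r \<in> ?I" "c \<in> ?I" for r c
    proof -
      obtain x o' x' i y q y' l where rc: "r = (x, o', x', i)" "c = (y, q, y', l)" by (cases r; cases c) auto
      have "(\<Sum>z<m. (?f z r * cnj (?f z c)) * L z j (?g r) (?g c))
        = (\<Sum>z<m. kdelta x z * (kdelta x' z * (kdelta y z * (kdelta y' z * L z j (o', i) (q, l)))))"
        unfolding rc by (simp add: mult.assoc)
      also have "\<dots> = kdelta x' x * (kdelta y x * (kdelta y' x * L x j (o', i) (q, l)))"
        using that unfolding rc by simp
      also have "\<dots> = G j r c" by (simp add: rc G_def kdelta_def)
      finally show ?thesis by simp
    qed
    have "gram ?I (\<lambda>r c. \<Sum>y<m. (?f y r * cnj (?f y c)) * L y j (?g r) (?g c))"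
      (is "gram _ ?h")
    proof (rule gram_sum)
      fix y assume "y \<in> {..<m}"
      then have "gram ({..<s (Out j)} \<times> {..<s (In (Suc j))}) (L y j)" using D j by (simp add: mm_data_def sep_data_def)
      then have "gram ?I (\<lambda>r c. L y j (?g r) (?g c))" by (rule gram_pull) auto
      then show "gram ?I (\<lambda>r c. (?f y r * cnj (?f y c)) * L y j (?g r) (?g c))"
        by (rule gram_mult[OF gram_rank1])
    qed simp
    then show "gram ?I (G j)" using gram_cong[of ?I "G j" ?h, OF eq] by (simp only:)
    fix x y o' q assume x: "x < m" "y < m" "o' < s (Out j)" "q < s (Out j)"
    have "(\<Sum>z\<in>{..<m} \<times> {..<s (In (Suc j))}. G j (x, o', z) (y, q, z))
      = (\<Sum>x'<m. \<Sum>i<s (In (Suc j)). G j (x, o', x', i) (y, q, x', i))"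
      by (simp add: sum.cartesian_product split_def)
    also have "\<dots> = (\<Sum>x'<m. kdelta x x' * (kdelta x y * kdelta y x' * (\<Sum>i<s (In (Suc j)). L x j (o', i) (q, i))))"
      by (simp add: G_def sum_distrib_left mult_ac)
    also have "\<dots> = kdelta x y * kdelta o' q"
      using D j x by (simp add: mm_data_def) (simp add: kdelta_def)
    finally show "(\<Sum>z\<in>{..<m} \<times> {..<s (In (Suc j))}. G j (x, o', z) (y, q, z)) = kdelta (x, o') (y, q)"
      by (auto simp: kdelta_def)
  qed (use m in simp_all)
  have run: "run (\<lambda>_. m) G \<rho>0 r c n x y = kdelta x y * (complex_of_real (p x) *
     ((\<Prod>j\<in>{1..n}. L x j (r (Out j), r (In (Suc j))) (c (Out j), c (In (Suc j)))) * \<rho> x (r (In 1)) (c (In 1))))"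
    if "x < m" "y < m" for n x y r c
    using that
  proof (induction n arbitrary: x y)
    case 0
    then show ?case by (simp add: \<rho>0_def)
  next
    case (Suc n)
    let ?P = "\<lambda>x. complex_of_real (p x) *
     ((\<Prod>j\<in>{1..n}. L x j (r (Out j), r (In (Suc j))) (c (Out j), c (In (Suc j)))) * \<rho> x (r (In 1)) (c (In 1)))"
    let ?L = "\<lambda>x. L x (Suc n) (r (Out (Suc n)), r (In (Suc (Suc n)))) (c (Out (Suc n)), c (In (Suc (Suc n))))"
    have "run (\<lambda>_. m) G \<rho>0 r c (Suc n) x y = (\<Sum>a<m. \<Sum>b<m. kdelta a b * (kdelta a x * (kdelta b y * (?L a * ?P a))))"
      unfolding run.simps
    proof (intro sum.cong refl)
      fix a b assume "a \<in> {..<m}" "b \<in> {..<m}"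
      then have R: "run (\<lambda>_. m) G \<rho>0 r c n a b = kdelta a b * ?P a" using Suc.IH by simp
      show "G (Suc n) (a, r (Out (Suc n)), x, r (In (Suc (Suc n)))) (b, c (Out (Suc n)), y, c (In (Suc (Suc n))))
          * run (\<lambda>_. m) G \<rho>0 r c n a b = kdelta a b * (kdelta a x * (kdelta b y * (?L a * ?P a)))"
        unfolding R unfolding G_def prod.case by (simp add: kdelta_def)
    qed
    also have "\<dots> = (\<Sum>a<m. kdelta a x * (kdelta a y * (?L a * ?P a)))" by simp
    also have "\<dots> = kdelta x y * (?L x * ?P x)" using Suc.prems by simp
    finally show ?case by (simp add: atLeastAtMostSuc_conv mult_ac)
  qed
  have range: "{1..N - 1} = {1..<N}" using N by auto
  have kk: "kdelta x x = 1" for x :: nat by (simp add: kdelta_def)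
  have "C = process N s (\<lambda>_. m) G \<rho>0"
    unfolding C process_def mixture_def
    by (rule sys_op_cong[OF s]) (intro sum.cong refl, simp only: lessThan_iff run range kk mult_1_left)
  then show "C \<in> CM N s"
    using valid_process_CM[OF N s val] by (simp add: G_def kdelta_def split_def)
qed

text \<open>Every term is the tensor product of an effect and the Choi operator of a channel; the
  effects sum to the identity.\<close>

lemma cm_data_valid: "cm_data N s k m F Q \<rho> \<Longrightarrow> valid_data N s k (eb_step m F Q) \<rho>"
  unfolding valid_data_def valid_step_def
proof (intro conjI allI impI ballI)
  assume D: "cm_data N s k m F Q \<rho>"
  fix j assume j: "j \<in> {1..<N}"
  let ?I = "{..<k j} \<times> {..<s (Out j)} \<times> {..<k (Suc j)} \<times> {..<s (In (Suc j))}"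
  have "gram ?I (\<lambda>r c. \<Sum>x<m j. F j x (fst r) (fst c) * Q j x (snd r) (snd c))"
  proof (rule gram_sum)
    fix x assume "x \<in> {..<m j}"
    then have "gram {..<k j} (F j x)" "gram ({..<s (Out j)} \<times> {..<k (Suc j)} \<times> {..<s (In (Suc j))}) (Q j x)"
      using D j by (simp_all add: cm_data_def)
    then show "gram ?I (\<lambda>r c. F j x (fst r) (fst c) * Q j x (snd r) (snd c))"
      by (intro gram_mult; elim gram_pull) auto
  qed simp
  then show "gram ?I (eb_step m F Q j)" by (simp add: eb_step_def split_def)
  fix a b p q assume *: "a < k j" "b < k j" "p < s (Out j)" "q < s (Out j)"
  have "(\<Sum>z\<in>{..<k (Suc j)} \<times> {..<s (In (Suc j))}. eb_step m F Q j (a, p, z) (b, q, z))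
    = (\<Sum>x<m j. F j x a b * (\<Sum>z\<in>{..<k (Suc j)} \<times> {..<s (In (Suc j))}. Q j x (p, z) (q, z)))"
    unfolding eb_step_def prod.case sum_distrib_left by (rule sum.swap)
  also have "\<dots> = (\<Sum>x<m j. F j x a b) * kdelta p q"
    unfolding sum_distrib_right by (intro sum.cong refl) (use D j * in \<open>simp add: cm_data_def\<close>)
  also have "\<dots> = kdelta a b * kdelta p q" using D j * by (simp add: cm_data_def)
  finally show "(\<Sum>z\<in>{..<k (Suc j)} \<times> {..<s (In (Suc j))}. eb_step m F Q j (a, p, z) (b, q, z)) = kdelta (a, p) (b, q)"
    by (auto simp: kdelta_def)
qed (simp_all add: cm_data_def)

text \<open>Unnormalised separability of the first \<open>n\<close> steps. Having no weights, and
  possibly no terms, makes it closed under sums and under appending a factor.\<close>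

definition sep_fun :: "(port \<Rightarrow> nat) \<Rightarrow> nat \<Rightarrow> ((port \<Rightarrow> nat) \<Rightarrow> (port \<Rightarrow> nat) \<Rightarrow> complex) \<Rightarrow> bool" where
  "sep_fun s n f \<longleftrightarrow> (\<exists>(m::nat) L \<rho>. (\<forall>x<m. gram {..<s (In 1)} (\<rho> x) \<and>
        (\<forall>j\<in>{1..n}. gram ({..<s (Out j)} \<times> {..<s (In (Suc j))}) (L x j))) \<and>
     (\<forall>r c. f r c = (\<Sum>x<m. (\<Prod>j\<in>{1..n}. L x j (r (Out j), r (In (Suc j))) (c (Out j), c (In (Suc j))))
        * \<rho> x (r (In 1)) (c (In 1)))))"

lemma sep_fun_zero: "sep_fun s n (\<lambda>_ _. 0)"
  unfolding sep_fun_def by (rule exI[of _ 0]) simp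

lemma sep_fun_add:
  assumes "sep_fun s n f" "sep_fun s n g"
  shows "sep_fun s n (\<lambda>r c. f r c + g r c)"
proof -
  obtain m L \<rho> where f: "\<And>x. x < (m::nat) \<Longrightarrow> gram {..<s (In 1)} (\<rho> x) \<and>
        (\<forall>j\<in>{1..n}. gram ({..<s (Out j)} \<times> {..<s (In (Suc j))}) (L x j))"
     "\<And>r c. f r c = (\<Sum>x<m. (\<Prod>j\<in>{1..n}. L x j (r (Out j), r (In (Suc j))) (c (Out j), c (In (Suc j))))
        * \<rho> x (r (In 1)) (c (In 1)))"
    using assms(1) unfolding sep_fun_def by blast
  obtain m' L' \<rho>' where g: "\<And>x. x < (m'::nat) \<Longrightarrow> gram {..<s (In 1)} (\<rho>' x) \<and>
        (\<forall>j\<in>{1..n}. gram ({..<s (Out j)} \<times> {..<s (In (Suc j))}) (L' x j))"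
     "\<And>r c. g r c = (\<Sum>x<m'. (\<Prod>j\<in>{1..n}. L' x j (r (Out j), r (In (Suc j))) (c (Out j), c (In (Suc j))))
        * \<rho>' x (r (In 1)) (c (In 1)))"
    using assms(2) unfolding sep_fun_def by blast
  define L2 \<rho>2 where "L2 = (\<lambda>x. if x < m then L x else L' (x - m))" and "\<rho>2 = (\<lambda>x. if x < m then \<rho> x else \<rho>' (x - m))"
  have split: "(\<Sum>x<m + m'. h x) = (\<Sum>x<m. h x) + (\<Sum>x<m'. h (m + x))" for h :: "nat \<Rightarrow> complex"
    by (induction m') (simp_all add: add.assoc)
  have "f r c + g r c = (\<Sum>x<m + m'. (\<Prod>j\<in>{1..n}. L2 x j (r (Out j), r (In (Suc j))) (c (Out j), c (In (Suc j))))
        * \<rho>2 x (r (In 1)) (c (In 1)))" for r c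
    unfolding split f(2) g(2) by (simp add: L2_def \<rho>2_def)
  moreover have "gram {..<s (In 1)} (\<rho>2 x) \<and> (\<forall>j\<in>{1..n}. gram ({..<s (Out j)} \<times> {..<s (In (Suc j))}) (L2 x j))"
    if "x < m + m'" for x
    using f(1)[of x] g(1)[of "x - m"] that by (simp add: L2_def \<rho>2_def)
  ultimately show ?thesis unfolding sep_fun_def by blast
qed

lemma sep_fun_sum:
  assumes "finite X" "\<And>x. x \<in> X \<Longrightarrow> sep_fun s n (f x)"
  shows "sep_fun s n (\<lambda>r c. \<Sum>x\<in>X. f x r c)"
  using assms by (induction X rule: finite_induct) (simp_all add: sep_fun_zero sep_fun_add)

lemma sep_fun_step:
  assumes "sep_fun s n f" "gram ({..<s (Out (Suc n))} \<times> {..<s (In (Suc (Suc n)))}) K"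
  shows "sep_fun s (Suc n) (\<lambda>r c. f r c * K (r (Out (Suc n)), r (In (Suc (Suc n)))) (c (Out (Suc n)), c (In (Suc (Suc n)))))"
proof -
  obtain m L \<rho> where f: "\<And>x. x < (m::nat) \<Longrightarrow> gram {..<s (In 1)} (\<rho> x) \<and>
        (\<forall>j\<in>{1..n}. gram ({..<s (Out j)} \<times> {..<s (In (Suc j))}) (L x j))"
     "\<And>r c. f r c = (\<Sum>x<m. (\<Prod>j\<in>{1..n}. L x j (r (Out j), r (In (Suc j))) (c (Out j), c (In (Suc j))))
        * \<rho> x (r (In 1)) (c (In 1)))"
    using assms(1) unfolding sep_fun_def by blast
  define L' where "L' = (\<lambda>x. (L x)(Suc n := K))"
  have "f r c * K (r (Out (Suc n)), r (In (Suc (Suc n)))) (c (Out (Suc n)), c (In (Suc (Suc n))))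
    = (\<Sum>x<m. (\<Prod>j\<in>{1..Suc n}. L' x j (r (Out j), r (In (Suc j))) (c (Out j), c (In (Suc j)))) * \<rho> x (r (In 1)) (c (In 1)))" for r c
    unfolding f(2) sum_distrib_right by (simp add: L'_def atLeastAtMostSuc_conv mult_ac)
  moreover have "gram {..<s (In 1)} (\<rho> x) \<and> (\<forall>j\<in>{1..Suc n}. gram ({..<s (Out j)} \<times> {..<s (In (Suc j))}) (L' x j))"
    if "x < m" for x
    using f(1)[OF that] assms(2) by (auto simp: L'_def)
  ultimately show ?thesis unfolding sep_fun_def by blast
qed

lemma sep_fun_gram: "gram {..<s (In 1)} K \<Longrightarrow> sep_fun s 0 (\<lambda>r c. K (r (In 1)) (c (In 1)))"
  unfolding sep_fun_def by (rule exI[of _ 1], rule exI, rule exI[of _ "\<lambda>_. K"]) simp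

text \<open>An arbitrary effect \<open>\<Phi>\<close> on the memory makes the induction work: for
  outcome \<open>x\<close> of the next step, the past is contracted with \<open>F x\<close> in the
  role of \<open>\<Phi>\<close>, while \<open>Q x\<close> contracted with the given
  \<open>\<Phi>\<close> is a factor on the ports of that step alone.\<close>

lemma sep_fun_run:
  assumes D: "cm_data N s k m F Q \<rho>" and "n < N" "gram {..<k (Suc n)} \<Phi>"
  shows "sep_fun s n (\<lambda>r c. \<Sum>a<k (Suc n). \<Sum>b<k (Suc n). \<Phi> a b * run k (eb_step m F Q) \<rho> r c n a b)"
  using assms(2,3)
proof (induction n arbitrary: \<Phi>)
  case 0
  have "gram {..<s (In 1)} (\<lambda>i l. \<Sum>a<k (Suc 0). \<Sum>b<k (Suc 0). \<Phi> a b * \<rho> (a, i) (b, l))"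
    by (rule gram_contract) (use D 0 in \<open>simp_all add: cm_data_def\<close>)
  from sep_fun_gram[where s = s and K = "\<lambda>i l. \<Sum>a<k (Suc 0). \<Sum>b<k (Suc 0). \<Phi> a b * \<rho> (a, i) (b, l)", OF this] show ?case by simp
next
  case (Suc n)
  have j: "Suc n \<in> {1..<N}" using Suc.prems by simp
  let ?S = "\<lambda>r c. run k (eb_step m F Q) \<rho> r c n"
  let ?K = "\<lambda>x (p, i) (q, l). \<Sum>a'<k (Suc (Suc n)). \<Sum>b'<k (Suc (Suc n)). \<Phi> a' b' * Q (Suc n) x (p, a', i) (q, b', l)"
  have "sep_fun s (Suc n) (\<lambda>r c. \<Sum>x<m (Suc n). (\<Sum>a<k (Suc n). \<Sum>b<k (Suc n). F (Suc n) x a b * ?S r c a b)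
     * ?K x (r (Out (Suc n)), r (In (Suc (Suc n)))) (c (Out (Suc n)), c (In (Suc (Suc n)))))"
  proof (rule sep_fun_sum)
    fix x assume "x \<in> {..<m (Suc n)}"
    then have F: "gram {..<k (Suc n)} (F (Suc n) x)" and
      Q: "gram ({..<s (Out (Suc n))} \<times> {..<k (Suc (Suc n))} \<times> {..<s (In (Suc (Suc n)))}) (Q (Suc n) x)"
      using D j by (simp_all add: cm_data_def)
    show "sep_fun s (Suc n) (\<lambda>r c. (\<Sum>a<k (Suc n). \<Sum>b<k (Suc n). F (Suc n) x a b * ?S r c a b)
     * ?K x (r (Out (Suc n)), r (In (Suc (Suc n)))) (c (Out (Suc n)), c (In (Suc (Suc n)))))"
      by (rule sep_fun_step[OF Suc.IH[OF _ F] gram_traced_output[OF _ Q Suc.prems(2)]]) (use Suc.prems in simp_all)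
  qed simp
  moreover have eq: "(\<Sum>a'<k (Suc (Suc n)). \<Sum>b'<k (Suc (Suc n)). \<Phi> a' b' * run k (eb_step m F Q) \<rho> r c (Suc n) a' b')
    = (\<Sum>x<m (Suc n). (\<Sum>a<k (Suc n). \<Sum>b<k (Suc n). F (Suc n) x a b * ?S r c a b)
     * ?K x (r (Out (Suc n)), r (In (Suc (Suc n)))) (c (Out (Suc n)), c (In (Suc (Suc n)))))" for r c
  proof -
    let ?q = "\<lambda>x a' b'. Q (Suc n) x (r (Out (Suc n)), a', r (In (Suc (Suc n)))) (c (Out (Suc n)), b', c (In (Suc (Suc n))))"
    let ?mu = "\<lambda>x. \<Sum>a<k (Suc n). \<Sum>b<k (Suc n). F (Suc n) x a b * ?S r c a b"
    have step: "run k (eb_step m F Q) \<rho> r c (Suc n) a' b' = (\<Sum>x<m (Suc n). ?mu x * ?q x a' b')" for a' b'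
    proof -
      have "run k (eb_step m F Q) \<rho> r c (Suc n) a' b' = (\<Sum>a<k (Suc n). \<Sum>b<k (Suc n). \<Sum>x<m (Suc n). F (Suc n) x a b * ?S r c a b * ?q x a' b')"
        unfolding run.simps eb_step_def prod.case sum_distrib_right
        by (intro sum.cong refl) (simp only: mult_ac)
      also have "\<dots> = (\<Sum>x<m (Suc n). \<Sum>a<k (Suc n). \<Sum>b<k (Suc n). F (Suc n) x a b * ?S r c a b * ?q x a' b')"
        by (subst sum.swap[of _ "{..<m (Suc n)}"]) (intro sum.cong refl sum.swap)
      finally show ?thesis by (simp only: sum_distrib_right)
    qed
    have "(\<Sum>a'<k (Suc (Suc n)). \<Sum>b'<k (Suc (Suc n)). \<Phi> a' b' * run k (eb_step m F Q) \<rho> r c (Suc n) a' b')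
      = (\<Sum>a'<k (Suc (Suc n)). \<Sum>b'<k (Suc (Suc n)). \<Sum>x<m (Suc n). ?mu x * (\<Phi> a' b' * ?q x a' b'))"
      unfolding step sum_distrib_left by (intro sum.cong refl) (simp only: mult.left_commute)
    also have "\<dots> = (\<Sum>x<m (Suc n). \<Sum>a'<k (Suc (Suc n)). \<Sum>b'<k (Suc (Suc n)). ?mu x * (\<Phi> a' b' * ?q x a' b'))"
      by (subst sum.swap[of _ "{..<m (Suc n)}"]) (intro sum.cong refl sum.swap)
    finally show ?thesis by (simp only: sum_distrib_left prod.case)
  qed
  ultimately show ?case by (simp only: eq)
qed

text \<open>Since the factors have no trace conditions, the weights can be chosen uniform and
  compensated in the state factor.\<close>

lemma sep_fun_mixture:
  assumes "sep_fun s (N - 1) f" "N \<ge> 1"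
  shows "\<exists>m p L \<rho>. sep_data N s m p L \<rho> \<and> f = mixture N m p L \<rho>"
proof -
  have range: "{1..N - 1} = {1..<N}" using assms(2) by auto
  obtain m L \<rho> where f: "\<And>x. x < (m::nat) \<Longrightarrow> gram {..<s (In 1)} (\<rho> x) \<and>
        (\<forall>j\<in>{1..<N}. gram ({..<s (Out j)} \<times> {..<s (In (Suc j))}) (L x j))"
     "\<And>r c. f r c = (\<Sum>x<m. (\<Prod>j\<in>{1..<N}. L x j (r (Out j), r (In (Suc j))) (c (Out j), c (In (Suc j))))
        * \<rho> x (r (In 1)) (c (In 1)))"
    using assms(1) unfolding sep_fun_def range by blast
  \<comment> \<open>The extra term, with zero state, keeps this a probability distribution even for
    \<open>m = 0\<close>.\<close>
  define p :: "nat \<Rightarrow> real" where "p = (\<lambda>_. 1 / real (Suc m))"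
  define \<rho>' where "\<rho>' = (\<lambda>x i l. if x < m then complex_of_real (real (Suc m)) * \<rho> x i l else complex_of_real 0 * 1)"
  define L' where "L' = (\<lambda>x. if x < m then L x else (\<lambda>_ _ _. 1))"
  have "sep_data N s (Suc m) p L' \<rho>'"
    unfolding sep_data_def
  proof (intro conjI allI impI ballI)
    show "prob_dist (Suc m) p" by (simp add: prob_dist_def p_def)
    fix x assume "x < Suc m"
    show "gram {..<s (In 1)} (\<rho>' x)"
      unfolding \<rho>'_def using gram_cmult[of _ "\<rho> x" "real (Suc m)"] gram_cmult[OF gram_one, of 0] f(1)[of x]
      by (cases "x < m") simp_all
    fix j assume "j \<in> {1..<N}"
    then show "gram ({..<s (Out j)} \<times> {..<s (In (Suc j))}) (L' x j)" using f(1)[of x] by (simp add: L'_def gram_one)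
  qed
  moreover have "f r c = mixture N (Suc m) p L' \<rho>' r c" for r c
  proof -
    have "complex_of_real (1 / real (Suc m)) * (P * (complex_of_real (real (Suc m)) * R)) = P * R" for P R :: complex
      by (simp add: field_simps del: of_nat_Suc)
    then show ?thesis
      unfolding mixture_def f(2) by (simp add: L'_def \<rho>'_def p_def del: of_nat_Suc)
  qed
  ultimately show ?thesis by blast
qed

lemma CM_subset_SEP:
  assumes N: "N \<ge> 2" and s: "\<And>p. 0 < s p"
  shows "CM N s \<subseteq> SEP N s"
proof
  fix C assume CM: "C \<in> CM N s"
  obtain k m F Q \<rho> where D: "cm_data N s k m F Q \<rho>" and C: "C = process N s k (eb_step m F Q) \<rho>"
    by (rule CM_cases[OF CM N s])
  have QM: "C \<in> QM N s" unfolding C by (rule valid_process_QM[OF N s cm_data_valid[OF D]])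
  have SN: "Suc (N - 1) = N" "N - 1 < N" "N \<ge> 1" using N by auto
  \<comment> \<open>The final trace is the contraction with the effect
    \<open>kdelta\<close>.\<close>
  have "sep_fun s (N - 1) (\<lambda>r c. \<Sum>a<k N. \<Sum>b<k N. kdelta a b * run k (eb_step m F Q) \<rho> r c (N - 1) a b)"
    using sep_fun_run[OF D SN(2) gram_kdelta] unfolding SN(1) by simp
  then have "sep_fun s (N - 1) (\<lambda>r c. \<Sum>a<k N. run k (eb_step m F Q) \<rho> r c (N - 1) a a)" by simp
  from sep_fun_mixture[OF this SN(3)] obtain m' p L \<rho>' where
    S: "sep_data N s m' p L \<rho>'" "(\<lambda>r c. \<Sum>a<k N. run k (eb_step m F Q) \<rho> r c (N - 1) a a) = mixture N m' p L \<rho>'"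
    by blast
  have "C = sys_op N s (mixture N m' p L \<rho>')" unfolding C process_def S(2) ..
  with S(1) QM show "C \<in> SEP N s" unfolding SEP_iff[where s = s, OF SN(3) s] by blast
qed

section \<open>Strictness\<close>


definition ports :: "nat \<Rightarrow> nat \<Rightarrow> nat \<Rightarrow> port \<Rightarrow> nat" where
  "ports u v w = (\<lambda>_. 0)(Out 1 := u, Out 2 := v, In 3 := w)"

text \<open>The qubits sit at the first output and the third input; the second output has dimension
  \<open>n\<close>, which is 1 where no measurement setting is needed.\<close>

definition dims3 :: "nat \<Rightarrow> port \<Rightarrow> nat" where
  "dims3 n = (\<lambda>_. 1)(Out 1 := 2, Out 2 := n, In 3 := 2)"

lemma ports_simps [simp]:
  "ports u v w (Out (Suc 0)) = u" "ports u v w (Out 2) = v" "ports u v w (Out (Suc (Suc 0))) = v"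
  "ports u v w (In 3) = w" "ports u v w (In (Suc (Suc (Suc 0)))) = w"
  "ports u v w (In (Suc 0)) = 0" "ports u v w (In 2) = 0" "ports u v w (In (Suc (Suc 0))) = 0"
  by (simp_all add: ports_def numeral_3_eq_3 numeral_2_eq_2)

lemma dims3_simps [simp]:
  "dims3 n (Out (Suc 0)) = 2" "dims3 n (Out 2) = n" "dims3 n (Out (Suc (Suc 0))) = n"
  "dims3 n (In 3) = 2" "dims3 n (In (Suc (Suc (Suc 0)))) = 2"
  "dims3 n (In (Suc 0)) = 1" "dims3 n (In 2) = 1" "dims3 n (In (Suc (Suc 0))) = 1"
  "j \<ge> 3 \<Longrightarrow> dims3 n (Out j) = 1" "j \<ge> 3 \<Longrightarrow> dims3 n (In (Suc j)) = 1"
  by (simp_all add: dims3_def numeral_3_eq_3 numeral_2_eq_2)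

lemma dims3_pos: "0 < n \<Longrightarrow> 0 < dims3 n p"
  by (simp add: dims3_def)

lemma ports_sys_idx:
  assumes "N \<ge> 3" "u < 2" "v < n" "w < 2"
  shows "ports u v w \<in> sys_idx N (dims3 n)"
proof -
  have "Sys (Out 1) \<in> sys_labels N" "Sys (Out 2) \<in> sys_labels N" "Sys (In 3) \<in> sys_labels N"
    using assms(1) by (auto simp: sys_labels_def)
  then show ?thesis using assms by (auto simp: sys_idx_def ports_def dims3_def)
qed

text \<open>With one-dimensional ports a valid step is a channel on the memory alone, so it
  preserves the trace.\<close>

lemma run_trace:
  assumes D: "valid_data N s k G \<rho>" and n: "Suc n < N" and s: "s (Out (Suc n)) = 1" "s (In (Suc (Suc n))) = 1"
    and r: "r \<in> sys_idx N s" and c: "c \<in> sys_idx N s"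
  shows "(\<Sum>a<k (Suc (Suc n)). run k G \<rho> r c (Suc n) a a) = (\<Sum>a<k (Suc n). run k G \<rho> r c n a a)"
proof -
  have z: "r (Out (Suc n)) = 0" "c (Out (Suc n)) = 0" "r (In (Suc (Suc n))) = 0" "c (In (Suc (Suc n))) = 0"
    using sys_idx_less[OF r, of "Out (Suc n)"] sys_idx_less[OF c, of "Out (Suc n)"]
      sys_idx_less[OF r, of "In (Suc (Suc n))"] sys_idx_less[OF c, of "In (Suc (Suc n))"] by (simp_all add: s)
  have tp: "(\<Sum>a'<k (Suc (Suc n)). G (Suc n) (a, 0, a', 0) (b, 0, a', 0)) = kdelta a b"
    if "a < k (Suc n)" "b < k (Suc n)" for a b
  proof -
    have j: "Suc n \<in> {1..<N}" using n by simp
    have "\<forall>j\<in>{1..<N}. valid_step (k j) (s (Out j)) (k (Suc j)) (s (In (Suc j))) (G j)"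
      using D unfolding valid_data_def by (elim conjE)
    from bspec[OF this j] have "valid_step (k (Suc n)) 1 (k (Suc (Suc n))) 1 (G (Suc n))"
      by (simp only: s)
    then have "\<forall>a<k (Suc n). \<forall>b<k (Suc n). \<forall>p<1. \<forall>q<1.
        (\<Sum>z\<in>{..<k (Suc (Suc n))} \<times> {..<1}. G (Suc n) (a, p, z) (b, q, z)) = kdelta (a, p) (b, q)"
      unfolding valid_step_def by (rule conjunct2)
    from this[rule_format, of a b 0 0] that
    have "(\<Sum>z\<in>{..<k (Suc (Suc n))} \<times> {..<1}. G (Suc n) (a, 0, z) (b, 0, z)) = kdelta (a, 0) (b, 0::nat)"
      by (simp only: zero_less_one)
    moreover have "(\<Sum>z\<in>{..<k (Suc (Suc n))} \<times> {..<1}. G (Suc n) (a, 0, z) (b, 0, z))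
      = (\<Sum>a'<k (Suc (Suc n)). \<Sum>i<1. G (Suc n) (a, 0, a', i) (b, 0, a', i))"
      unfolding sum.cartesian_product by (simp add: split_def)
    ultimately show ?thesis by (simp add: kdelta_def)
  qed
  have "(\<Sum>a'<k (Suc (Suc n)). run k G \<rho> r c (Suc n) a' a')
    = (\<Sum>a<k (Suc n). \<Sum>b<k (Suc n). (\<Sum>a'<k (Suc (Suc n)). G (Suc n) (a, 0, a', 0) (b, 0, a', 0)) * run k G \<rho> r c n a b)"
    unfolding run.simps z sum_distrib_right
    by (subst sum.swap, rule sum.cong[OF refl], rule sum.swap)
  also have "\<dots> = (\<Sum>a<k (Suc n). \<Sum>b<k (Suc n). kdelta a b * run k G \<rho> r c n a b)"
    by (intro sum.cong refl) (simp add: tp)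
  also have "\<dots> = (\<Sum>a<k (Suc n). run k G \<rho> r c n a a)" by simp
  finally show ?thesis .
qed

text \<open>All ports after the third input are trivial, which reduces every
  \<open>N \<ge> 3\<close> to three times.\<close>

lemma run_tail:
  assumes D: "valid_data N (dims3 m) k G \<rho>" and N: "N \<ge> 3"
    and r: "r \<in> sys_idx N (dims3 m)" and c: "c \<in> sys_idx N (dims3 m)"
  shows "(\<Sum>a<k N. run k G \<rho> r c (N - 1) a a) = (\<Sum>a<k 3. run k G \<rho> r c 2 a a)"
proof -
  have "(\<Sum>a<k (Suc n). run k G \<rho> r c n a a) = (\<Sum>a<k 3. run k G \<rho> r c 2 a a)" if "2 \<le> n" "n < N" for n
    using that
  proof (induction n rule: dec_induct)
    case base
    have "Suc 2 = 3" by simp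
    then show ?case by (simp only:)
  next
    case (step n)
    have "(\<Sum>a<k (Suc (Suc n)). run k G \<rho> r c (Suc n) a a) = (\<Sum>a<k (Suc n). run k G \<rho> r c n a a)"
      by (rule run_trace[OF D _ _ _ r c]) (use step.hyps step.prems in simp_all)
    then show ?case using step.IH step.prems by simp
  qed
  from this[of "N - 1"] show ?thesis using N by simp
qed

text \<open>\<open>A\<close> writes the first output into a memory qubit; \<open>B\<close> turns
  this qubit and the second output into the third input. The later default step will act on
  one-dimensional spaces, where its single entry is 1.\<close>

definition two_step :: "step \<Rightarrow> step \<Rightarrow> nat \<Rightarrow> step" where
  "two_step A B = (\<lambda>j. if j = 1 then A else if j = 2 then B else (\<lambda>(a, _) (b, _). kdelta a b))"

definition two_step_fun :: "step \<Rightarrow> step \<Rightarrow> (port \<Rightarrow> nat) \<Rightarrow> (port \<Rightarrow> nat) \<Rightarrow> complex" where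
  "two_step_fun A B r c = (\<Sum>a<2. \<Sum>b<2. B (a, r (Out 2), 0, r (In 3)) (b, c (Out 2), 0, c (In 3))
     * A (0, r (Out 1), a, 0) (0, c (Out 1), b, 0))"

lemma two_step_process:
  fixes n :: nat
  defines "s \<equiv> dims3 n" and "k \<equiv> (\<lambda>_. 1)(2 := 2)"
  assumes N: "N \<ge> 3" and n: "0 < n"
    and A: "valid_step 1 2 2 1 A" and B: "valid_step 2 n 1 2 B"
  shows "valid_data N s k (two_step A B) (\<lambda>_ _. 1)"
    "process N s k (two_step A B) (\<lambda>_ _. 1) = sys_op N s (two_step_fun A B)"
proof -
  have k: "k (Suc 0) = 1" "k (Suc (Suc 0)) = 2" "k 2 = 2" "\<And>j. j \<ge> 3 \<Longrightarrow> k j = 1" by (auto simp: k_def)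
  show D: "valid_data N s k (two_step A B) (\<lambda>_ _. 1)"
    unfolding valid_data_def
  proof (intro conjI allI ballI)
    show "0 < k n" for n by (simp add: k_def)
    show "gram ({..<k 1} \<times> {..<s (In 1)}) (\<lambda>_ _. 1)" by (rule gram_one)
    show "(\<Sum>p\<in>{..<k 1} \<times> {..<s (In 1)}. 1) = (1 :: complex)" by (simp add: k s_def)
    fix j assume "j \<in> {1..<N}"
    then consider "j = 1" | "j = 2" | "j \<ge> 3" by fastforce
    then show "valid_step (k j) (s (Out j)) (k (Suc j)) (s (In (Suc j))) (two_step A B j)"
    proof cases
      case 1
      then show ?thesis using A by (simp add: two_step_def k s_def)
    next
      case 2
      then have "k (Suc j) = 1" "s (In (Suc j)) = 2" by (simp_all add: k_def s_def eval_nat_numeral)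
      then show ?thesis using 2 B by (simp add: two_step_def k s_def)
    next
      case 3
      have "gram I (\<lambda>(a, _) (b, _). kdelta a b)" if "finite I" for I :: "(nat \<times> nat \<times> nat \<times> nat) set"
        using gram_kdelta_pull[OF that, of fst] by (simp add: split_def)
      then show ?thesis using 3 k(4)[of j] k(4)[of "Suc j"] by (simp add: two_step_def s_def valid_step_def kdelta_def)
    qed
  qed
  have "(\<Sum>a<k N. run k (two_step A B) (\<lambda>_ _. 1) r c (N - 1) a a) = two_step_fun A B r c"
    if rc: "r \<in> sys_idx N s" "c \<in> sys_idx N s" for r c
  proof -
    have z: "r (In (Suc (Suc 0))) = 0" "c (In (Suc (Suc 0))) = 0"
      using sys_idx_less[OF rc(1), of "In 2"] sys_idx_less[OF rc(2), of "In 2"] by (simp_all add: s_def numeral_2_eq_2)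
    have "(\<Sum>a<k N. run k (two_step A B) (\<lambda>_ _. 1) r c (N - 1) a a)
      = (\<Sum>a<k 3. run k (two_step A B) (\<lambda>_ _. 1) r c 2 a a)"
      using run_tail[OF D[unfolded s_def] N] rc unfolding s_def by blast
    also have "\<dots> = run k (two_step A B) (\<lambda>_ _. 1) r c (Suc (Suc 0)) 0 0"
      by (simp add: k numeral_2_eq_2)
    also have "\<dots> = (\<Sum>a<2. \<Sum>b<2. two_step A B (Suc (Suc 0)) (a, r (Out 2), 0, r (In 3)) (b, c (Out 2), 0, c (In 3))
     * two_step A B (Suc 0) (0, r (Out 1), a, 0) (0, c (Out 1), b, 0))"
      unfolding run.simps k z by (simp add: numeral_3_eq_3 numeral_2_eq_2)
    also have "\<dots> = two_step_fun A B r c" by (simp add: two_step_def two_step_fun_def)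
    finally show ?thesis .
  qed
  then show "process N s k (two_step A B) (\<lambda>_ _. 1) = sys_op N s (two_step_fun A B)"
    unfolding process_def by (intro sys_op_cong) (use n in \<open>auto simp: s_def dims3_pos\<close>)
qed

lemma two_step_QM:
  assumes "N \<ge> 3" "0 < n" "valid_step 1 2 2 1 A" "valid_step 2 n 1 2 B"
  shows "sys_op N (dims3 n) (two_step_fun A B) \<in> QM N (dims3 n)"
proof -
  have "N \<ge> 2" using assms(1) by simp
  from valid_process_QM[OF this dims3_pos[OF assms(2)] two_step_process(1)[OF assms]]
  show ?thesis unfolding two_step_process(2)[OF assms] .
qed

lemma two_step_CM:
  assumes "N \<ge> 3" "0 < n" "valid_step 1 2 2 1 A" "valid_step 2 n 1 2 B"
    and "\<And>a b z w. a \<noteq> b \<Longrightarrow> A (a, z) (b, w) = 0" "\<And>a b z w. a \<noteq> b \<Longrightarrow> B (a, z) (b, w) = 0"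
  shows "sys_op N (dims3 n) (two_step_fun A B) \<in> CM N (dims3 n)"
proof -
  have N: "N \<ge> 2" using assms(1) by simp
  have "two_step A B j (a, z) (b, w) = 0" if "a \<noteq> b" for j a b z w
    using assms(5,6)[OF that] that by (simp add: two_step_def kdelta_def)
  then show ?thesis
    using valid_process_CM[OF N dims3_pos[OF assms(2)] two_step_process(1)[OF assms(1-4)]]
    unfolding two_step_process(2)[OF assms(1-4)] by blast
qed

section \<open>Separation of the classes\<close>

lemma prod_first_two:
  fixes g :: "nat \<Rightarrow> complex"
  assumes "N \<ge> 3"
  shows "(\<Prod>j\<in>{1..<N}. g j) = g 1 * (g 2 * (\<Prod>j\<in>{3..<N}. g j))"
proof -
  have "{1..<N} = insert 1 (insert 2 {3..<N})" using assms by auto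
  then show ?thesis by simp
qed

lemma less_two_cases: "(a::nat) < 2 \<longleftrightarrow> a = 0 \<or> a = 1"
  by auto

lemma sum_Times: "(\<Sum>z\<in>A \<times> B. f z) = (\<Sum>a\<in>A. \<Sum>b\<in>B. f (a, b))"
  by (simp add: sum.cartesian_product split_def)

lemma sum_lessThan_two: "(\<Sum>a<2. f a) = f 0 + f (Suc 0)" for f :: "nat \<Rightarrow> complex"
  by (simp add: numeral_2_eq_2)

lemma sum_lessThan_four: "(\<Sum>x<4. f x) = f 0 + f (Suc 0) + f 2 + f 3" for f :: "nat \<Rightarrow> complex"
  by (simp add: eval_nat_numeral)

text \<open>Passes from an event of probability 0 to each term of a decomposition.\<close>

lemma sum_nonneg_zero:
  fixes f :: "nat \<Rightarrow> complex"
  assumes "\<And>x. x < m \<Longrightarrow> f x \<in> \<real>\<^sub>\<ge>\<^sub>0" "(\<Sum>x<m. f x) = 0" "x < m"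
  shows "f x = 0"
proof -
  have re: "f x = complex_of_real (Re (f x))" "Re (f x) \<ge> 0" if "x < m" for x
    using assms(1)[OF that] by (auto simp: complex_nonneg_Reals_iff complex_eq_iff)
  have "(\<Sum>x<m. Re (f x)) = 0" using arg_cong[OF assms(2), of Re] by simp
  then have "Re (f x) = 0" using re(2) assms(3) by (subst (asm) sum_nonneg_eq_0_iff) auto
  then show ?thesis using re(1)[OF assms(3)] by simp
qed

lemma gram_diag: "gram I f \<Longrightarrow> r \<in> I \<Longrightarrow> f r r \<in> \<real>\<^sub>\<ge>\<^sub>0"
  using gram_diag_nonneg[of I f r] by auto

lemma prod_nonneg_Reals: "(\<And>x. x \<in> X \<Longrightarrow> f x \<in> \<real>\<^sub>\<ge>\<^sub>0) \<Longrightarrow> (\<Prod>x\<in>X. f x) \<in> (\<real>\<^sub>\<ge>\<^sub>0 :: complex set)"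
  by (induction X rule: infinite_finite_induct) (auto intro: nonneg_Reals_mult_I)

text \<open>Classically correlated inputs at the first two times.\<close>

lemma MM_not_M:
  assumes N: "N \<ge> 3"
  shows "\<exists>s. (\<forall>p. 0 < s p) \<and> (\<exists>C\<in>MM N s. C \<notin> M N s)"
proof -
  define s :: "port \<Rightarrow> nat" where "s = (\<lambda>_. 1)(In 1 := 2, In 2 := 2)"
  have s: "0 < s p" for p by (simp add: s_def)
  \<comment> \<open>All outputs are one-dimensional, so \<open>L x 1\<close> merely prepares basis
    state \<open>x\<close> at the second input; the later channels are trivial.\<close>
  define L :: "nat \<Rightarrow> nat \<Rightarrow> nat \<times> nat \<Rightarrow> nat \<times> nat \<Rightarrow> complex" where
    "L = (\<lambda>x j r c. (if j = 1 then kdelta (snd r) x else 1) * cnj (if j = 1 then kdelta (snd c) x else 1))"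
  define \<rho> :: "nat \<Rightarrow> nat \<Rightarrow> nat \<Rightarrow> complex" where "\<rho> = (\<lambda>x i l. kdelta i x * cnj (kdelta l x))"
  define C where "C = sys_op N s (mixture N 2 (\<lambda>_. 1 / 2) L \<rho>)"
  have "mm_data N s 2 (\<lambda>_. 1 / 2) L \<rho>"
    unfolding mm_data_def sep_data_def
  proof (intro conjI allI impI ballI)
    show "prob_dist 2 (\<lambda>_. 1 / 2)" by (simp add: prob_dist_def)
    fix x :: nat assume x: "x < 2"
    show "gram {..<s (In 1)} (\<rho> x)" unfolding \<rho>_def by (rule gram_rank1)
    show "(\<Sum>a<s (In 1). \<rho> x a a) = 1" using x by (simp add: \<rho>_def s_def) (simp add: kdelta_def)
    fix j assume j: "j \<in> {1..<N}"
    show "gram ({..<s (Out j)} \<times> {..<s (In (Suc j))}) (L x j)" unfolding L_def by (rule gram_rank1)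
    fix a b assume "a < s (Out j)" "b < s (Out j)"
    then have ab: "a = 0" "b = 0" by (simp_all add: s_def)
    show "(\<Sum>i<s (In (Suc j)). L x j (a, i) (b, i)) = kdelta a b"
    proof (cases "j = 1")
      case True
      then have "s (In (Suc j)) = 2" by (simp add: s_def numeral_2_eq_2)
      then show ?thesis using x True by (simp add: L_def ab) (simp add: kdelta_def)
    next
      case False
      then have "s (In (Suc j)) = 1" using j by (simp add: s_def)
      then show ?thesis using False by (simp add: L_def ab kdelta_def)
    qed
  qed
  moreover have "N \<ge> 1" "N \<ge> 2" using N by auto
  ultimately have MM: "C \<in> MM N s" unfolding MM_iff[where s = s, OF \<open>N \<ge> 1\<close> s] C_def by blast
  define q :: "nat \<Rightarrow> nat \<Rightarrow> port \<Rightarrow> nat" where "q = (\<lambda>i l. (\<lambda>_. 0)(In 1 := i, In 2 := l))"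
  have q: "q i l \<in> sys_idx N s" if "i < 2" "l < 2" for i l
  proof -
    have "Sys (In 1) \<in> sys_labels N" "Sys (In 2) \<in> sys_labels N" using N by (auto simp: sys_labels_def)
    then show ?thesis using that by (auto simp: sys_idx_def q_def s_def)
  qed
  have "C \<notin> M N s"
  proof
    assume C: "C \<in> M N s"
    obtain L' \<rho>' where eq: "C = sys_op N s (mixture N 1 (\<lambda>_. 1) L' \<rho>')"
      by (rule M_product[OF \<open>N \<ge> 2\<close> s C])
    define P where "P = (\<lambda>l. \<Prod>j\<in>{1..<N}. L' 0 j (0, if j = 1 then l else 0) (0, if j = 1 then l else 0))"
    have M': "mixture N 1 (\<lambda>_. 1) L' \<rho>' (q i l) (q i l) = P l * \<rho>' 0 i i" for i l
    proof -
      have "(\<Prod>j\<in>{1..<N}. L' 0 j (q i l (Out j), q i l (In (Suc j))) (q i l (Out j), q i l (In (Suc j)))) = P l"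
        unfolding P_def by (rule prod.cong) (auto simp: q_def)
      then show ?thesis by (simp add: mixture_def) (simp add: q_def)
    qed
    have M: "mixture N 2 (\<lambda>_. 1 / 2) L \<rho> (q i l) (q i l) = kdelta i l / 2" if "i < 2" "l < 2" for i l
    proof -
      have "(\<Prod>j\<in>{1..<N}. L x j (q i l (Out j), q i l (In (Suc j))) (q i l (Out j), q i l (In (Suc j)))) = kdelta l x * kdelta l x" for x
        unfolding prod_first_two[OF N] by (simp add: L_def) (simp add: q_def numeral_2_eq_2)
      then have "mixture N 2 (\<lambda>_. 1 / 2) L \<rho> (q i l) (q i l) = (\<Sum>x<2. complex_of_real (1 / 2) * (kdelta l x * kdelta l x * (kdelta i x * kdelta i x)))"
        unfolding mixture_def by (simp add: \<rho>_def) (simp add: q_def)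
      then show ?thesis using that by (auto simp: sum_lessThan_two less_two_cases kdelta_def)
    qed
    have "kdelta i l / 2 = P l * \<rho>' 0 i i" if "i < 2" "l < 2" for i l
      using sys_op_inj[OF eq[unfolded C_def] q[OF that] q[OF that]] unfolding M'[of i l] M[OF that] .
    \<comment> \<open>With \<open>a = \<rho>' 0 0 0\<close> and \<open>b = \<rho>' 0 1 1\<close>
      these read \<open>P 0 * a = 1/2\<close>, \<open>P 1 * b = 1/2\<close> and
      \<open>P 1 * a = 0\<close>: a product cannot be perfectly correlated.\<close>
    from this[of 0 0] this[of 1 1] this[of 0 1] show False by (auto simp: kdelta_def)
  qed
  then show ?thesis using MM s by blast
qed

text \<open>A classical bit is sent from the first output to the third input.\<close>

lemma CM_not_MM:
  assumes N: "N \<ge> 3"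
  shows "\<exists>s. (\<forall>p. 0 < s p) \<and> (\<exists>C\<in>CM N s. C \<notin> MM N s)"
proof -
  \<comment> \<open>\<open>kdelta u v\<close> dephases the transmitted bit;
    \<open>kdelta a b\<close> is what \<open>two_step_CM\<close> asks of a step that sees its memory
    classically.\<close>
  define A :: step where "A = (\<lambda>(a, u, a', i) (b, v, b', l). kdelta a b * (kdelta u v * (kdelta a' u * cnj (kdelta b' v))))"
  define B :: step where "B = (\<lambda>(a, u, a', i) (b, v, b', l). kdelta a b * (kdelta i a * cnj (kdelta l b)))"
  define C where "C = sys_op N (dims3 1) (two_step_fun A B)"
  have s: "0 < dims3 1 p" for p by (simp add: dims3_pos)
  have A: "valid_step 1 2 2 1 A"
  proof -
    let ?I = "{..<1} \<times> {..<2} \<times> {..<2} \<times> {..<1} :: (nat \<times> nat \<times> nat \<times> nat) set"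
    have "gram ?I (\<lambda>r c. kdelta (fst r) (fst c) * (kdelta (fst (snd r)) (fst (snd c)) *
        (kdelta (fst (snd (snd r))) (fst (snd r)) * cnj (kdelta (fst (snd (snd c))) (fst (snd c))))))"
      by (intro gram_mult gram_kdelta_pull gram_rank1) simp_all
    then have "gram ?I A" by (simp add: A_def split_def)
    moreover have "(\<Sum>z\<in>{..<2} \<times> {..<1}. A (a, p, z) (b, q, z)) = kdelta (a, p) (b, q)"
      if "a < 1" "b < 1" "p < 2" "q < 2" for a b p q :: nat
      using that by (auto simp: A_def sum_Times sum_lessThan_two less_two_cases kdelta_def)
    ultimately show ?thesis by (simp add: valid_step_def)
  qed
  have B: "valid_step 2 1 1 2 B"
  proof -
    let ?I = "{..<2} \<times> {..<1} \<times> {..<1} \<times> {..<2} :: (nat \<times> nat \<times> nat \<times> nat) set"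
    have "gram ?I (\<lambda>r c. kdelta (fst r) (fst c) *
        (kdelta (snd (snd (snd r))) (fst r) * cnj (kdelta (snd (snd (snd c))) (fst c))))"
      by (intro gram_mult gram_kdelta_pull gram_rank1) simp_all
    then have "gram ?I B" by (simp add: B_def split_def)
    moreover have "(\<Sum>z\<in>{..<1} \<times> {..<2}. B (a, p, z) (b, q, z)) = kdelta (a, p) (b, q)"
      if "a < 2" "b < 2" "p < 1" "q < 1" for a b p q :: nat
      using that by (auto simp: B_def sum_Times sum_lessThan_two less_two_cases kdelta_def)
    ultimately show ?thesis by (simp add: valid_step_def)
  qed
  have CM: "C \<in> CM N (dims3 1)"
    unfolding C_def by (rule two_step_CM[OF N _ A B]) (auto simp: A_def B_def kdelta_def)
  have "C \<notin> MM N (dims3 1)"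
  proof
    assume "C \<in> MM N (dims3 1)"
    moreover have "N \<ge> 1" using N by simp
    ultimately obtain m p L \<rho> where D: "mm_data N (dims3 1) m p L \<rho>" and eq: "C = sys_op N (dims3 1) (mixture N m p L \<rho>)"
      using MM_iff[where s = "dims3 1", OF _ s] by blast
    \<comment> \<open>The first output occurs only in \<open>L x 1\<close>, where the second input
      is one-dimensional. The trace condition of a channel then fixes this factor to be 1, whatever
      the first output is.\<close>
    have "mixture N m p L \<rho> (ports 0 0 0) (ports 0 0 0) = mixture N m p L \<rho> (ports 1 0 0) (ports 1 0 0)"
      unfolding mixture_def
    proof (intro sum.cong refl arg_cong2[of _ _ _ _ "(*)"] prod.cong)
      fix x j assume x: "x \<in> {..<m}" and j: "j \<in> {1..<N}"
      show "L x j (ports 0 0 0 (Out j), ports 0 0 0 (In (Suc j))) (ports 0 0 0 (Out j), ports 0 0 0 (In (Suc j)))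
        = L x j (ports 1 0 0 (Out j), ports 1 0 0 (In (Suc j))) (ports 1 0 0 (Out j), ports 1 0 0 (In (Suc j)))"
      proof (cases "j = 1")
        case True
        have "(\<Sum>i<dims3 1 (In (Suc 1)). L x 1 (a, i) (b, i)) = kdelta a b"
          if "a < dims3 1 (Out 1)" "b < dims3 1 (Out 1)" for a b
          using D x j[unfolded True] that unfolding mm_data_def lessThan_iff by blast
        from this[of 0 0] this[of 1 1]
        have "L x 1 (0, 0) (0, 0) = 1" "L x 1 (1, 0) (1, 0) = 1" by (simp_all add: kdelta_def)
        then show ?thesis unfolding True by simp
      next
        case False
        then show ?thesis by (simp add: ports_def)
      qed
    qed (simp add: ports_def)
    moreover have "two_step_fun A B r c = mixture N m p L \<rho> r c"
      if "r \<in> sys_idx N (dims3 1)" "c \<in> sys_idx N (dims3 1)" for r c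
      by (rule sys_op_inj[OF eq[unfolded C_def] that])
    ultimately have "two_step_fun A B (ports 0 0 0) (ports 0 0 0) = two_step_fun A B (ports 1 0 0) (ports 1 0 0)"
      using ports_sys_idx[OF N] by simp
    then show False by (simp add: two_step_fun_def A_def B_def sum_lessThan_two kdelta_def)
  qed
  then show ?thesis using CM s by blast
qed

text \<open>Choi operator of the identity channel from the first output to the memory.\<close>

definition store_qubit :: step where
  "store_qubit = (\<lambda>(a, u, a', i) (b, v, b', l). kdelta a' u * cnj (kdelta b' v))"

lemma valid_step_store_qubit: "valid_step 1 2 2 1 store_qubit"
proof -
  have "gram I store_qubit" for I
    using gram_rank1[of I "\<lambda>(a, u, a', i). kdelta a' u"] by (simp add: store_qubit_def split_def)
  moreover have "(\<Sum>z\<in>{..<2} \<times> {..<1}. store_qubit (a, p, z) (b, q, z)) = kdelta (a, p) (b, q)"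
    if "a < 1" "b < 1" "p < 2" "q < 2" for a b p q :: nat
    using that by (auto simp: store_qubit_def sum_Times sum_lessThan_two less_two_cases kdelta_def)
  ultimately show ?thesis by (simp add: valid_step_def)
qed

text \<open>A qubit is stored coherently and sent from the first output to the third input.\<close>

lemma QM_not_SEP:
  assumes N: "N \<ge> 3"
  shows "\<exists>s. (\<forall>p. 0 < s p) \<and> (\<exists>C\<in>QM N s. C \<notin> SEP N s)"
proof -
  define B :: step where "B = (\<lambda>(a, u, a', i) (b, v, b', l). kdelta i a * cnj (kdelta l b))"
  define C where "C = sys_op N (dims3 1) (two_step_fun store_qubit B)"
  have s: "0 < dims3 1 p" for p by (simp add: dims3_pos)
  have B: "valid_step 2 1 1 2 B"
  proof -
    have "gram I B" for I
      using gram_rank1[of I "\<lambda>(a, u, a', i). kdelta i a"] by (simp add: B_def split_def)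
    moreover have "(\<Sum>z\<in>{..<1} \<times> {..<2}. B (a, p, z) (b, q, z)) = kdelta (a, p) (b, q)"
      if "a < 2" "b < 2" "p < 1" "q < 1" for a b p q :: nat
      using that by (auto simp: B_def sum_Times sum_lessThan_two less_two_cases kdelta_def)
    ultimately show ?thesis by (simp add: valid_step_def)
  qed
  have QM: "C \<in> QM N (dims3 1)" unfolding C_def by (rule two_step_QM[OF N _ valid_step_store_qubit B]) simp
  have "C \<notin> SEP N (dims3 1)"
  proof
    assume "C \<in> SEP N (dims3 1)"
    moreover have "N \<ge> 1" using N by simp
    ultimately obtain m p L \<rho> where D: "sep_data N (dims3 1) m p L \<rho>" and eq: "C = sys_op N (dims3 1) (mixture N m p L \<rho>)"
      using SEP_iff[where s = "dims3 1", OF _ s] by blast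
    \<comment> \<open>The weight and all factors at trivial ports combine into one nonnegative
      scalar.\<close>
    define K where "K = (\<lambda>x. complex_of_real (p x) * ((\<Prod>j\<in>{3..<N}. L x j (0, 0) (0, 0)) * \<rho> x 0 0))"
    have mix: "mixture N m p L \<rho> (ports u 0 i) (ports v 0 l) = (\<Sum>x<m. K x * (L x 1 (u, 0) (v, 0) * L x 2 (0, i) (0, l)))" for u i v l
    proof -
      have "(\<Prod>j\<in>{3..<N}. L x j (ports u 0 i (Out j), ports u 0 i (In (Suc j))) (ports v 0 l (Out j), ports v 0 l (In (Suc j))))
        = (\<Prod>j\<in>{3..<N}. L x j (0, 0) (0, 0))" for x
        by (rule prod.cong) (auto simp: ports_def)
      then show ?thesis
        unfolding mixture_def prod_first_two[OF N] by (simp add: K_def mult_ac eval_nat_numeral)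
    qed
    have ev: "two_step_fun store_qubit B (ports u 0 i) (ports v 0 l) = (\<Sum>x<m. K x * (L x 1 (u, 0) (v, 0) * L x 2 (0, i) (0, l)))"
      if "u < 2" "i < 2" "v < 2" "l < 2" for u i v l
      unfolding mix[symmetric] by (rule sys_op_inj[OF eq[unfolded C_def]]) (use that N in \<open>auto intro!: ports_sys_idx\<close>)
    \<comment> \<open>On its two qubits \<open>C\<close> is an unnormalised maximally entangled
      projector. Its diagonal entry at output 0, input 1 is 0, so each product term has a vanishing
      scalar or diagonal factor, and this kills the term's coherence between 00 and 11.\<close>
    have zero: "K x * (L x 1 (0, 0) (1, 0) * L x 2 (0, 0) (0, 1)) = 0" if x: "x < m" for x
    proof -
      have g: "gram ({..<dims3 1 (Out j)} \<times> {..<dims3 1 (In (Suc j))}) (L y j)" if "y < m" "j \<in> {1..<N}" for y j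
        using D that unfolding sep_data_def by blast
      have g1: "gram ({..<2} \<times> {..<1}) (L y 1)" and g2: "gram ({..<1} \<times> {..<2}) (L y 2)" if "y < m" for y
        using g[OF that, of 1] g[OF that, of 2] N by simp_all
      have "K y * (L y 1 (0, 0) (0, 0) * L y 2 (0, 1) (0, 1)) \<in> \<real>\<^sub>\<ge>\<^sub>0" if y: "y < m" for y
      proof -
        have "L y 1 (0, 0) (0, 0) \<in> \<real>\<^sub>\<ge>\<^sub>0" "L y 2 (0, 1) (0, 1) \<in> \<real>\<^sub>\<ge>\<^sub>0"
          using gram_diag[OF g1[OF y], of "(0, 0)"] gram_diag[OF g2[OF y], of "(0, 1)"] by auto
        moreover have "K y \<in> \<real>\<^sub>\<ge>\<^sub>0"
        proof -
          have "complex_of_real (p y) \<in> \<real>\<^sub>\<ge>\<^sub>0" using D y by (simp add: sep_data_def prob_dist_def)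
          moreover have "\<rho> y 0 0 \<in> \<real>\<^sub>\<ge>\<^sub>0"
          proof (rule gram_diag[of "{..<dims3 1 (In 1)}" "\<rho> y"])
            show "gram {..<dims3 1 (In 1)} (\<rho> y)" using D y by (simp add: sep_data_def)
          qed simp
          moreover have "(\<Prod>j\<in>{3..<N}. L y j (0, 0) (0, 0)) \<in> \<real>\<^sub>\<ge>\<^sub>0"
          proof (rule prod_nonneg_Reals)
            fix j assume j: "j \<in> {3..<N}"
            show "L y j (0, 0) (0, 0) \<in> \<real>\<^sub>\<ge>\<^sub>0"
            proof (rule gram_diag[of "{..<dims3 1 (Out j)} \<times> {..<dims3 1 (In (Suc j))}" "L y j"])
              show "gram ({..<dims3 1 (Out j)} \<times> {..<dims3 1 (In (Suc j))}) (L y j)"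
                by (rule g[OF y]) (use j in simp)
            qed (use j in simp)
          qed
          ultimately show ?thesis unfolding K_def by (intro nonneg_Reals_mult_I)
        qed
        ultimately show ?thesis by (intro nonneg_Reals_mult_I)
      qed
      moreover have "(\<Sum>y<m. K y * (L y 1 (0, 0) (0, 0) * L y 2 (0, 1) (0, 1))) = 0"
        using ev[of 0 1 0 1] by (simp add: two_step_fun_def store_qubit_def B_def sum_lessThan_two kdelta_def)
      ultimately have "K x * (L x 1 (0, 0) (0, 0) * L x 2 (0, 1) (0, 1)) = 0"
        using sum_nonneg_zero[of m "\<lambda>y. K y * (L y 1 (0, 0) (0, 0) * L y 2 (0, 1) (0, 1))" x] x by blast
      then consider "K x = 0" | "L x 1 (0, 0) (0, 0) = 0" | "L x 2 (0, 1) (0, 1) = 0" by auto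
      then show ?thesis
      proof cases
        case 2
        then show ?thesis using gram_zero_row(1)[OF g1[OF x], of "(0, 0)" "(1, 0)"] by simp
      next
        case 3
        then show ?thesis using gram_zero_row(2)[OF g2[OF x], of "(0, 1)" "(0, 0)"] by simp
      qed simp
    qed
    have "two_step_fun store_qubit B (ports 0 0 0) (ports 1 0 1) = (\<Sum>x<m. K x * (L x 1 (0, 0) (1, 0) * L x 2 (0, 0) (0, 1)))"
      by (rule ev) simp_all
    also have "\<dots> = 0" using zero by (intro sum.neutral ballI) (simp only: lessThan_iff)
    finally show False by (simp add: two_step_fun_def store_qubit_def B_def sum_lessThan_two kdelta_def)
  qed
  then show ?thesis using QM s by blast
qed

text \<open>The second output decides in which of two mutually unbiased bases the stored first output is
  measured, and the third input is the outcome. With classical memory the first output has to be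
  measured before the basis is known.\<close>

lemma SEP_not_CM:
  assumes N: "N \<ge> 3"
  shows "\<exists>s. (\<forall>p. 0 < s p) \<and> (\<exists>C\<in>SEP N s. C \<notin> CM N s)"
proof -
  define h where "h = complex_of_real (1 / sqrt 2)"
  have hh: "h * h = 1 / 2" unfolding h_def by (simp flip: of_real_mult)
  have h_cnj: "cnj h = h" by (simp add: h_def)
  \<comment> \<open>\<open>\<psi> v i\<close> is vector \<open>i\<close> of basis \<open>v\<close>:
    the computational basis for \<open>v = 0\<close>, the Hadamard basis for \<open>v = 1\<close>.
    All entries are real.\<close>
  define \<psi> :: "nat \<Rightarrow> nat \<Rightarrow> nat \<Rightarrow> complex" where
    "\<psi> = (\<lambda>v i a. if v = 0 then kdelta i a else if i = 1 \<and> a = 1 then - h else h)"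
  have \<psi>_cnj: "cnj (\<psi> v i a) = \<psi> v i a" for v i a by (simp add: \<psi>_def h_cnj)
  \<comment> \<open>Setting and outcome are both dephased, so the process becomes a sum of product
    terms, one for each setting and outcome.\<close>
  define B :: step where "B = (\<lambda>(a, u, a', i) (b, v, b', l). kdelta u v * (kdelta i l * (\<psi> u i a * cnj (\<psi> v l b))))"
  define C where "C = sys_op N (dims3 2) (two_step_fun store_qubit B)"
  have s: "0 < dims3 2 p" for p by (simp add: dims3_pos)
  have B: "valid_step 2 2 1 2 B"
  proof -
    let ?I = "{..<2} \<times> {..<2} \<times> {..<1} \<times> {..<2} :: (nat \<times> nat \<times> nat \<times> nat) set"
    have "gram ?I (\<lambda>r c. kdelta (fst (snd r)) (fst (snd c)) * (kdelta (snd (snd (snd r))) (snd (snd (snd c))) *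
        (\<psi> (fst (snd r)) (snd (snd (snd r))) (fst r) * cnj (\<psi> (fst (snd c)) (snd (snd (snd c))) (fst c)))))"
      by (intro gram_mult gram_kdelta_pull gram_rank1) simp_all
    then have "gram ?I B" by (simp add: B_def split_def)
    moreover have "(\<Sum>z\<in>{..<1} \<times> {..<2}. B (a, p, z) (b, q, z)) = kdelta (a, p) (b, q)"
      if "a < 2" "b < 2" "p < 2" "q < 2" for a b p q :: nat
      using that by (auto simp: B_def \<psi>_cnj sum_Times sum_lessThan_two less_two_cases kdelta_def \<psi>_def hh h_cnj)
    ultimately show ?thesis by (simp add: valid_step_def)
  qed
  have QM: "C \<in> QM N (dims3 2)" unfolding C_def by (rule two_step_QM[OF N _ valid_step_store_qubit B]) simp
  have AB: "two_step_fun store_qubit B (ports u v i) (ports u' v' i') = kdelta v v' * (kdelta i i' * (\<psi> v i u * \<psi> v' i' u'))"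
    if "u < 2" "u' < 2" for u v i u' v' i'
    using that by (auto simp: two_step_fun_def store_qubit_def B_def \<psi>_cnj sum_lessThan_two less_two_cases kdelta_def)
  have "C \<in> SEP N (dims3 2)"
  proof -
    \<comment> \<open>\<open>x\<close> encodes setting \<open>x div 2\<close> and outcome
      \<open>x mod 2\<close>. The factor at step 2 is the projector on this setting and outcome; it
      is not the Choi operator of a channel, which separability permits.\<close>
    define L :: "nat \<Rightarrow> nat \<Rightarrow> nat \<times> nat \<Rightarrow> nat \<times> nat \<Rightarrow> complex" where
      "L = (\<lambda>x j r c. if j = 1 then \<psi> (x div 2) (x mod 2) (fst r) * cnj (\<psi> (x div 2) (x mod 2) (fst c))
         else if j = 2 then (kdelta (fst r) (x div 2) * kdelta (snd r) (x mod 2)) * cnj (kdelta (fst c) (x div 2) * kdelta (snd c) (x mod 2))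
         else 1)"
    define f where "f = (\<lambda>r c. \<Sum>x<4. (\<Prod>j\<in>{1..N - 1}. L x j (r (Out j), r (In (Suc j))) (c (Out j), c (In (Suc j)))) * (1 :: complex))"
    have "gram I (L x j)" for I x j
      unfolding L_def by (cases "j = 1"; cases "j = 2") (simp_all add: gram_rank1 gram_one del: complex_cnj_mult)
    then have "sep_fun (dims3 2) (N - 1) f"
      unfolding sep_fun_def f_def
      by (intro exI[of _ 4] exI[of _ L] exI[of _ "\<lambda>_ _ _. 1"]) (simp add: gram_one)
    moreover have N1: "N \<ge> 1" using N by simp
    ultimately obtain m p L' \<rho>' where S: "sep_data N (dims3 2) m p L' \<rho>'" "f = mixture N m p L' \<rho>'"
      using sep_fun_mixture by blast
    have "two_step_fun store_qubit B r c = f r c" if rc: "r \<in> sys_idx N (dims3 2)" "c \<in> sys_idx N (dims3 2)" for r c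
    proof -
      have lt: "r (Out 1) < 2" "r (Out 2) < 2" "r (In 3) < 2" "c (Out 1) < 2" "c (Out 2) < 2" "c (In 3) < 2"
        using sys_idx_less[OF rc(1)] sys_idx_less[OF rc(2)]
        by (metis One_nat_def dims3_simps(1,2,4))+
      have range: "{1..N - 1} = {1..<N}" using N by auto
      have "(\<Prod>j\<in>{3..<N}. L x j (r (Out j), r (In (Suc j))) (c (Out j), c (In (Suc j)))) = 1" for x
        by (rule prod.neutral) (auto simp: L_def)
      then have "f r c = (\<Sum>x<4. (\<psi> (x div 2) (x mod 2) (r (Out 1)) * \<psi> (x div 2) (x mod 2) (c (Out 1)))
         * ((kdelta (r (Out 2)) (x div 2) * kdelta (r (In 3)) (x mod 2)) * (kdelta (c (Out 2)) (x div 2) * kdelta (c (In 3)) (x mod 2))))"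
        unfolding f_def range prod_first_two[OF N] by (simp add: L_def \<psi>_cnj numeral_3_eq_3 numeral_2_eq_2)
      also have "\<dots> = (\<Sum>v<2. \<Sum>i<2. (\<psi> v i (r (Out 1)) * \<psi> v i (c (Out 1)))
         * ((kdelta (r (Out 2)) v * kdelta (r (In 3)) i) * (kdelta (c (Out 2)) v * kdelta (c (In 3)) i)))"
        unfolding sum_lessThan_four sum_lessThan_two by simp
      also have "\<dots> = kdelta (r (Out 2)) (c (Out 2)) * (kdelta (r (In 3)) (c (In 3)) *
          (\<psi> (r (Out 2)) (r (In 3)) (r (Out 1)) * \<psi> (c (Out 2)) (c (In 3)) (c (Out 1))))"
        using lt(2,3,5,6) unfolding sum_lessThan_two less_two_cases kdelta_def by auto
      also have "\<dots> = two_step_fun store_qubit B r c"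
        using lt(1,4) unfolding two_step_fun_def sum_lessThan_two less_two_cases store_qubit_def B_def prod.case \<psi>_cnj cnj_kdelta kdelta_def by auto
      finally show ?thesis by simp
    qed
    then have "C = sys_op N (dims3 2) f" unfolding C_def by (intro sys_op_cong s)
    then show ?thesis unfolding SEP_iff[where s = "dims3 2", OF N1 s] using S QM by blast
  qed
  moreover have "C \<notin> CM N (dims3 2)"
  proof
    assume CM: "C \<in> CM N (dims3 2)"
    have N2: "N \<ge> 2" using N by simp
    obtain k m F Q \<rho> where D: "cm_data N (dims3 2) k m F Q \<rho>" and eq: "C = process N (dims3 2) k (eb_step m F Q) \<rho>"
      by (rule CM_cases[OF CM N2 s])
    note V = cm_data_valid[OF D]
    have j1: "1 \<in> {1..<N}" and j2: "2 \<in> {1..<N}" using N by auto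
    \<comment> \<open>\<open>S\<close> is the kernel from the first output to the memory at time 2,
      \<open>M x\<close> what outcome \<open>x\<close> leaves on the first output, and
      \<open>t x v i\<close> the probability of answer \<open>i\<close> to setting \<open>v\<close>
      when only \<open>x\<close> is known.\<close>
    define S where "S = (\<lambda>(a', u) (b', u'). \<Sum>a<k 1. \<Sum>b<k 1. \<rho> (a, 0) (b, 0) * eb_step m F Q 1 (a, u, a', 0) (b, u', b', 0))"
    define M where "M = (\<lambda>x u u'. \<Sum>a<k 2. \<Sum>b<k 2. F 2 x a b * S (a, u) (b, u'))"
    define t where "t = (\<lambda>x v i. \<Sum>a<k 3. Q 2 x (v, a, i) (v, a, i))"
    have F2: "gram {..<k 2} (F 2 x)" and Q2: "gram ({..<2} \<times> {..<k 3} \<times> {..<2}) (Q 2 x)"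
      and T2: "(\<Sum>z\<in>{..<k 3} \<times> {..<2}. Q 2 x (0, z) (0, z)) = kdelta 0 (0::nat)" if "x < m 2" for x
    proof -
      have "Suc 2 = 3" by simp
      then show "gram {..<k 2} (F 2 x)" "gram ({..<2} \<times> {..<k 3} \<times> {..<2}) (Q 2 x)"
        "(\<Sum>z\<in>{..<k 3} \<times> {..<2}. Q 2 x (0, z) (0, z)) = kdelta 0 (0::nat)"
        using bspec[OF conjunct2[OF conjunct2[OF conjunct2[OF D[unfolded cm_data_def]]]] j2] that by auto
    qed
    have gS: "gram ({..<k 2} \<times> {..<2}) S"
    proof -
      have "gram ({..<k 1} \<times> {..<1}) \<rho>" using D by (simp add: cm_data_def)
      then have \<rho>: "gram {..<k 1} (\<lambda>a b. \<rho> (a, 0) (b, 0))" by (rule gram_pull) auto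
      have "valid_step (k 1) 2 (k 2) 1 (eb_step m F Q 1)"
        using V j1 unfolding valid_data_def by (auto dest!: bspec[of _ _ 1] simp: numeral_2_eq_2)
      then have G: "gram ({..<k 1} \<times> {..<2} \<times> {..<k 2} \<times> {..<1}) (eb_step m F Q 1)" by (simp add: valid_step_def)
      have "gram ({..<k 1} \<times> {..<k 2} \<times> {..<2}) (\<lambda>r c. eb_step m F Q 1 ((\<lambda>(a, a', u). (a, u, a', 0)) r) ((\<lambda>(a, a', u). (a, u, a', 0)) c))"
        by (rule gram_pull[OF G]) auto
      from gram_contract[OF _ \<rho> this] show ?thesis by (simp add: S_def split_def)
    qed
    have gM: "gram {..<2} (M x)" if "x < m 2" for x
      unfolding M_def by (rule gram_contract[OF _ F2[OF that] gS]) simp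
    have t_nonneg: "t x v i \<in> \<real>\<^sub>\<ge>\<^sub>0" if "x < m 2" "v < 2" "i < 2" for x v i
    proof -
      have "gram ({..<2} \<times> {..<2}) (\<lambda>(p, i) (q, l). \<Sum>a<k 3. Q 2 x (p, a, i) (q, a, l))"
        by (rule gram_traced_output_kdelta[OF _ Q2[OF that(1)]]) simp
      from gram_diag[OF this, of "(v, i)"] show ?thesis using that by (simp add: t_def)
    qed
    have t_sum: "t x 0 0 + t x 0 1 = 1" if "x < m 2" for x
    proof -
      have "t x 0 0 + t x 0 1 = (\<Sum>i<2. \<Sum>a<k 3. Q 2 x (0, a, i) (0, a, i))" by (simp add: sum_lessThan_two t_def)
      also have "\<dots> = (\<Sum>z\<in>{..<k 3} \<times> {..<2}. Q 2 x (0, z) (0, z))"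
        by (subst sum.swap) (simp add: sum.cartesian_product split_def)
      finally show ?thesis using T2[OF that] by (simp add: kdelta_def)
    qed
    \<comment> \<open>The setting enters only through \<open>t\<close>, because the memory is
      measured without knowing it. Both bases are thus served by one and the same family
      \<open>M\<close>.\<close>
    have ev: "\<psi> v i u * \<psi> v i u' = (\<Sum>x<m 2. M x u u' * t x v i)" if "u < 2" "u' < 2" "v < 2" "i < 2" for u u' v i
    proof -
      have rc: "ports u v i \<in> sys_idx N (dims3 2)" "ports u' v i \<in> sys_idx N (dims3 2)"
        using that N by (auto intro!: ports_sys_idx)
      let ?R = "run k (eb_step m F Q) \<rho> (ports u v i) (ports u' v i)"
      have R1: "?R (Suc 0) a b = S (a, u) (b, u')" for a b
        by (simp add: S_def mult.commute)
      have "\<psi> v i u * \<psi> v i u' = two_step_fun store_qubit B (ports u v i) (ports u' v i)"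
        using AB[OF that(1,2)] by (simp add: kdelta_def)
      also have "\<dots> = (\<Sum>a<k N. ?R (N - 1) a a)"
        by (rule sys_op_inj[OF eq[unfolded C_def process_def] rc])
      also have "\<dots> = (\<Sum>a<k 3. ?R (Suc (Suc 0)) a a)" using run_tail[OF V N rc] by (simp add: numeral_2_eq_2)
      also have "\<dots> = (\<Sum>a'<k 3. \<Sum>a<k 2. \<Sum>b<k 2. \<Sum>x<m 2. F 2 x a b * Q 2 x (v, a', i) (v, a', i) * S (a, u) (b, u'))"
        unfolding run.simps(2)[of _ _ _ _ _ "Suc 0"] R1 eb_step_def prod.case sum_distrib_right
        by (simp add: numeral_2_eq_2)
      also have "\<dots> = (\<Sum>a'<k 3. \<Sum>x<m 2. M x u u' * Q 2 x (v, a', i) (v, a', i))"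
      proof (rule sum.cong[OF refl])
        fix a'
        have "(\<Sum>a<k 2. \<Sum>b<k 2. \<Sum>x<m 2. F 2 x a b * Q 2 x (v, a', i) (v, a', i) * S (a, u) (b, u'))
          = (\<Sum>x<m 2. \<Sum>a<k 2. \<Sum>b<k 2. F 2 x a b * Q 2 x (v, a', i) (v, a', i) * S (a, u) (b, u'))"
          by (subst sum.swap[of _ "{..<m 2}"]) (intro sum.cong refl sum.swap)
        also have "\<dots> = (\<Sum>x<m 2. M x u u' * Q 2 x (v, a', i) (v, a', i))"
          unfolding M_def sum_distrib_right by (intro sum.cong refl) (simp only: mult_ac)
        finally show "(\<Sum>a<k 2. \<Sum>b<k 2. \<Sum>x<m 2. F 2 x a b * Q 2 x (v, a', i) (v, a', i) * S (a, u) (b, u'))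
          = (\<Sum>x<m 2. M x u u' * Q 2 x (v, a', i) (v, a', i))" .
      qed
      also have "\<dots> = (\<Sum>x<m 2. M x u u' * t x v i)"
        unfolding t_def sum_distrib_left by (rule sum.swap)
      finally show ?thesis .
    qed
    \<comment> \<open>Setting 0 repeats the computational basis, so \<open>M x 1 1 * t x 0 0\<close>
      and \<open>M x 0 0 * t x 0 1\<close> vanish. The two values of \<open>t\<close> sum to 1, so a
      diagonal entry of \<open>M x\<close> is 0, and its coherence with it.\<close>
    have "M x 0 1 = 0" if x: "x < m 2" for x
    proof (cases "t x 0 0 = 0")
      case False
      have "M y 1 1 * t y 0 0 \<in> \<real>\<^sub>\<ge>\<^sub>0" if "y < m 2" for y
        using gram_diag[OF gM[OF that], of 1] t_nonneg[OF that, of 0 0] by (intro nonneg_Reals_mult_I) auto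
      moreover have "(\<Sum>y<m 2. M y 1 1 * t y 0 0) = 0"
        using ev[of 1 1 0 0] by (simp add: \<psi>_def kdelta_def)
      ultimately have "M x 1 1 * t x 0 0 = 0"
        using sum_nonneg_zero[of "m 2" "\<lambda>y. M y 1 1 * t y 0 0" x] x by blast
      then show ?thesis using False gram_zero_row(2)[OF gM[OF x], of 1 0] by simp
    next
      case True
      have "M y 0 0 * t y 0 1 \<in> \<real>\<^sub>\<ge>\<^sub>0" if "y < m 2" for y
        using gram_diag[OF gM[OF that], of 0] t_nonneg[OF that, of 0 1] by (intro nonneg_Reals_mult_I) auto
      moreover have "(\<Sum>y<m 2. M y 0 0 * t y 0 1) = 0"
        using ev[of 0 0 0 1] by (simp add: \<psi>_def kdelta_def)
      ultimately have "M x 0 0 * t x 0 1 = 0"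
        using sum_nonneg_zero[of "m 2" "\<lambda>y. M y 0 0 * t y 0 1" x] x by blast
      then show ?thesis using True t_sum[OF x] gram_zero_row(1)[OF gM[OF x], of 0 1] by simp
    qed
    \<comment> \<open>Without coherences in the \<open>M x\<close> the Hadamard projector would have
      off-diagonal entry 0, but this entry is \<open>h * h = 1 / 2\<close>.\<close>
    then have "\<psi> 1 0 0 * \<psi> 1 0 1 = 0" using ev[of 0 1 1 0] by simp
    then show False using hh by (simp add: \<psi>_def)
  qed
  ultimately show ?thesis using s by blast
qed

theorem theorem1:
  fixes N :: nat
  assumes "N \<ge> 3"
  shows "strictly_included (M N) (MM N) \<and> strictly_included (MM N) (CM N) \<and>
    strictly_included (CM N) (SEP N) \<and> strictly_included (SEP N) (QM N)"
proof -
  have N: "N \<ge> 2" using assms by simp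
  have "M N s \<subseteq> MM N s \<and> MM N s \<subseteq> CM N s \<and> CM N s \<subseteq> SEP N s \<and> SEP N s \<subseteq> QM N s"
    if "\<forall>p. 0 < s p" for s
    using M_subset_MM[OF N, of s] MM_subset_CM[OF N, of s] CM_subset_SEP[OF N, of s] that
    by (auto simp: SEP_def Let_def)
  then show ?thesis
    unfolding strictly_included_def
    using MM_not_M[OF assms] CM_not_MM[OF assms] SEP_not_CM[OF assms] QM_not_SEP[OF assms] by blast
qed

end
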